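(* Assume that $a>0$ and $b=c=0$. Then the $C_0$-semigroup of contractions $(e^{t\mathcal{A}_{a,0,0}})_{t\ge0}$ is exponentially stable; i.e., there exist constants $M\ge1$ and $\epsilon>0$ such that for all $U_0\in\mathcal{H}$ and all $t\ge 0$, $$\|e^{t\mathcal{A}_{a,0,0}}U_0\|_{\mathcal{H}}\le Me^{-\epsilon t}\|U_0\|_{\mathcal{H}}.$$
   Context: Let $L,\rho,\alpha,\gamma,\xi,\varepsilon_3,\mu>0$ be constants and let $a,b,c\ge 0$ be damping coefficients. All functions are complex valued, and $H^1_L(0,L)=\{f\in H^1(0,L): f(0)=0\}$. Define $$\mathcal{H}=\Big\{U=(v,z,u^1,u^2,u^3)\in H^1_L(0,L)\times (L^2(0,L))^4:\ u^2_x\in L^2(0,L),\ u^2(0)=u^2(L)=0,\ \xi u^2_x-u^3+\tfrac{\gamma}{\varepsilon_3}v_x=0\Big\}$$ (superscripts on $u$ are indices, not powers), a Hilbert space with inner product $$\langle U,\widetilde U\rangle_{\mathcal{H}}=\int_0^L\big(\alpha v_x\overline{\widetilde v_x}+\rho z\overline{\widetilde z}+\mu u^1\overline{\widetilde u^1}+\xi\varepsilon_3u^2\overline{\widetilde u^2}+\varepsilon_3u^3\overline{\widetilde u^3}\big)dx$$ and associated norm $\|\cdot\|_{\mathcal{H}}$. Let $$D(\mathcal{A})=\{U\in\mathcal{H}:\ z\in H^1_L(0,L),\ v\in H^2(0,L)\cap H^1_L(0,L),\ u^1,u^2\in H^1_0(0,L),\ u^3\in H^1(0,L),\ \alpha v_x(L)+\gamma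 u^3(L)=0\},$$ $$\mathcal{A}U=\Big(z,\ \tfrac{\alpha}{\rho}v_{xx}+\tfrac{\gamma}{\rho}u^3_x,\ u^2-u^3_x,\ -\tfrac{\mu}{\xi\varepsilon_3}u^1,\ -\tfrac{\mu}{\varepsilon_3}u^1_x+\tfrac{\gamma}{\varepsilon_3}z_x\Big),\qquad BU=\Big(0,\tfrac{a}{\rho}z,0,bu^2,cu^3\Big),$$ and $\mathcal{A}_{a,b,c}=\mathcal{A}-B$ with $D(\mathcal{A}_{a,b,c})=D(\mathcal{A})$; it is taken to be the generator of the $C_0$-semigroup of contractions $(e^{t\mathcal{A}_{a,b,c}})_{t\ge0}$ on $\mathcal{H}$. *)

theory Defs
  imports "HOL-Analysis.Analysis" "HOL-Library.Function_Algebras"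
begin

section \<open>Sobolev spaces on a bounded interval\<close>

text \<open>Elements of the Lebesgue and Sobolev spaces are represented by functions
  \<^typ>\<open>real \<Rightarrow> complex\<close>, identified when they agree almost everywhere on the open interval
  from 0 to \<open>L\<close>. The spaces below are therefore sets of representatives, closed under
  a.e. equality, and values outside the interval (or at single points of it) are irrelevant.\<close>

abbreviation intv :: "real \<Rightarrow> real measure" where
  "intv L \<equiv> lebesgue_on {0<..<L}"

definition L2 :: "real \<Rightarrow> (real \<Rightarrow> complex) set" where
  "L2 L = {f \<in> borel_measurable (intv L). integrable (intv L) (\<lambda>x. (cmod (f x))\<^sup>2)}"

definition test_function :: "real \<Rightarrow> (real \<Rightarrow> real) \<Rightarrow> bool" where
  "test_function L \<phi> \<longleftrightarrow>
     (\<forall>n. (deriv ^^ n) \<phi> differentiable_on UNIV) \<and> closure {x. \<phi> x \<noteq> 0} \<subseteq> {0<..<L}"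

definition has_weak_deriv :: "real \<Rightarrow> (real \<Rightarrow> complex) \<Rightarrow> (real \<Rightarrow> complex) \<Rightarrow> bool" where
  "has_weak_deriv L f g \<longleftrightarrow>
     (\<forall>\<phi>. test_function L \<phi> \<longrightarrow>
        (LINT x|intv L. f x * of_real (deriv \<phi> x)) = - (LINT x|intv L. g x * of_real (\<phi> x)))"

definition H1 :: "real \<Rightarrow> (real \<Rightarrow> complex) set" where
  "H1 L = {f \<in> L2 L. \<exists>g \<in> L2 L. has_weak_deriv L f g}"

text \<open>The weak derivative is unique only almost everywhere; \<open>wd\<close> selects a representative.\<close>

definition wd :: "real \<Rightarrow> (real \<Rightarrow> complex) \<Rightarrow> real \<Rightarrow> complex" where
  "wd L f = (SOME g. g \<in> L2 L \<and> has_weak_deriv L f g)"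

definition H2 :: "real \<Rightarrow> (real \<Rightarrow> complex) set" where
  "H2 L = {f \<in> H1 L. wd L f \<in> H1 L}"

text \<open>Pointwise values of an \<open>H\<^sup>1\<close> function are those of its continuous representative on the
  closed interval.\<close>

definition val :: "real \<Rightarrow> (real \<Rightarrow> complex) \<Rightarrow> real \<Rightarrow> complex" where
  "val L f x = (THE c. \<exists>g. continuous_on {0..L} g \<and> (AE y in intv L. f y = g y) \<and> g x = c)"

definition H1_left :: "real \<Rightarrow> (real \<Rightarrow> complex) set" where
  "H1_left L = {f \<in> H1 L. val L f 0 = 0}"

definition H1_zero :: "real \<Rightarrow> (real \<Rightarrow> complex) set" where
  "H1_zero L = {f \<in> H1 L. val L f 0 = 0 \<and> val L f L = 0}"


section \<open>States and the energy space\<close>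

text \<open>A state is \<open>(v, z, u1, u2, u3)\<close>. Addition and subtraction of states are the pointwise ones
  of the product and function types.\<close>

type_synonym state =
  "(real \<Rightarrow> complex) \<times> (real \<Rightarrow> complex) \<times> (real \<Rightarrow> complex) \<times> (real \<Rightarrow> complex) \<times> (real \<Rightarrow> complex)"

fun scale :: "complex \<Rightarrow> state \<Rightarrow> state" where
  "scale k (v, z, u1, u2, u3) =
     (\<lambda>x. k * v x, \<lambda>x. k * z x, \<lambda>x. k * u1 x, \<lambda>x. k * u2 x, \<lambda>x. k * u3 x)"

fun state_eq :: "real \<Rightarrow> state \<Rightarrow> state \<Rightarrow> bool" where
  "state_eq L (v, z, u1, u2, u3) (v', z', u1', u2', u3') \<longleftrightarrow>
     (AE x in intv L. v x = v' x \<and> z x = z' x \<and> u1 x = u1' x \<and> u2 x = u2' x \<and> u3 x = u3' x)"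

definition energy_space :: "real \<Rightarrow> real \<Rightarrow> real \<Rightarrow> real \<Rightarrow> state set" where
  "energy_space L \<gamma> \<xi> \<epsilon>\<^sub>3 =
     {(v, z, u1, u2, u3).
        v \<in> H1_left L \<and> z \<in> L2 L \<and> u1 \<in> L2 L \<and> u2 \<in> H1_zero L \<and> u3 \<in> L2 L \<and>
        (AE x in intv L. of_real \<xi> * wd L u2 x - u3 x + of_real (\<gamma> / \<epsilon>\<^sub>3) * wd L v x = 0)}"

fun energy_inner ::
  "real \<Rightarrow> real \<Rightarrow> real \<Rightarrow> real \<Rightarrow> real \<Rightarrow> real \<Rightarrow> state \<Rightarrow> state \<Rightarrow> complex" where
  "energy_inner L \<rho> \<alpha> \<xi> \<epsilon>\<^sub>3 \<mu> (v, z, u1, u2, u3) (v', z', u1', u2', u3') =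
     (LINT x|intv L.
        of_real \<alpha> * wd L v x * cnj (wd L v' x) + of_real \<rho> * z x * cnj (z' x)
        + of_real \<mu> * u1 x * cnj (u1' x) + of_real (\<xi> * \<epsilon>\<^sub>3) * u2 x * cnj (u2' x)
        + of_real \<epsilon>\<^sub>3 * u3 x * cnj (u3' x))"

definition energy_norm ::
  "real \<Rightarrow> real \<Rightarrow> real \<Rightarrow> real \<Rightarrow> real \<Rightarrow> real \<Rightarrow> state \<Rightarrow> real" where
  "energy_norm L \<rho> \<alpha> \<xi> \<epsilon>\<^sub>3 \<mu> U = sqrt (Re (energy_inner L \<rho> \<alpha> \<xi> \<epsilon>\<^sub>3 \<mu> U U))"


section \<open>The system operator\<close>

definition op_dom :: "real \<Rightarrow> real \<Rightarrow> real \<Rightarrow> real \<Rightarrow> real \<Rightarrow> state set" where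
  "op_dom L \<alpha> \<gamma> \<xi> \<epsilon>\<^sub>3 =
     {(v, z, u1, u2, u3).
        (v, z, u1, u2, u3) \<in> energy_space L \<gamma> \<xi> \<epsilon>\<^sub>3 \<and>
        z \<in> H1_left L \<and> v \<in> H2 L \<inter> H1_left L \<and> u1 \<in> H1_zero L \<and> u2 \<in> H1_zero L \<and> u3 \<in> H1 L \<and>
        of_real \<alpha> * val L (wd L v) L + of_real \<gamma> * val L u3 L = 0}"

fun op_A ::
  "real \<Rightarrow> real \<Rightarrow> real \<Rightarrow> real \<Rightarrow> real \<Rightarrow> real \<Rightarrow> real \<Rightarrow> state \<Rightarrow> state" where
  "op_A L \<rho> \<alpha> \<gamma> \<xi> \<epsilon>\<^sub>3 \<mu> (v, z, u1, u2, u3) =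
     (z,
      \<lambda>x. of_real (\<alpha> / \<rho>) * wd L (wd L v) x + of_real (\<gamma> / \<rho>) * wd L u3 x,
      \<lambda>x. u2 x - wd L u3 x,
      \<lambda>x. - of_real (\<mu> / (\<xi> * \<epsilon>\<^sub>3)) * u1 x,
      \<lambda>x. - of_real (\<mu> / \<epsilon>\<^sub>3) * wd L u1 x + of_real (\<gamma> / \<epsilon>\<^sub>3) * wd L z x)"

fun op_B :: "real \<Rightarrow> real \<Rightarrow> real \<Rightarrow> real \<Rightarrow> state \<Rightarrow> state" where
  "op_B \<rho> a b c (v, z, u1, u2, u3) =
     (\<lambda>x. 0, \<lambda>x. of_real (a / \<rho>) * z x, \<lambda>x. 0, \<lambda>x. of_real b * u2 x, \<lambda>x. of_real c * u3 x)"

definition op_A_damped ::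
  "real \<Rightarrow> real \<Rightarrow> real \<Rightarrow> real \<Rightarrow> real \<Rightarrow> real \<Rightarrow> real \<Rightarrow> real \<Rightarrow> real \<Rightarrow> real \<Rightarrow> state \<Rightarrow> state"
  where
  "op_A_damped L \<rho> \<alpha> \<gamma> \<xi> \<epsilon>\<^sub>3 \<mu> a b c U = op_A L \<rho> \<alpha> \<gamma> \<xi> \<epsilon>\<^sub>3 \<mu> U - op_B \<rho> a b c U"


section \<open>Semigroups\<close>

text \<open>A \<open>C\<^sub>0\<close>-semigroup of contractions on the normed complex vector space \<open>X\<close> modulo \<open>eqv\<close>:
  the maps \<open>T t\<close> act on representatives, respect \<open>eqv\<close>, and satisfy the algebraic laws
  up to \<open>eqv\<close>.\<close>

definition C0_contraction_semigroup ::
  "state set \<Rightarrow> (state \<Rightarrow> state \<Rightarrow> bool) \<Rightarrow> (state \<Rightarrow> real) \<Rightarrow> (real \<Rightarrow> state \<Rightarrow> state) \<Rightarrow> bool" where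
  "C0_contraction_semigroup X eqv nrm T \<longleftrightarrow>
     (\<forall>t\<ge>0. \<forall>U\<in>X. T t U \<in> X) \<and>
     (\<forall>t\<ge>0. \<forall>U\<in>X. \<forall>V\<in>X. eqv U V \<longrightarrow> eqv (T t U) (T t V)) \<and>
     (\<forall>t\<ge>0. \<forall>U\<in>X. \<forall>V\<in>X. eqv (T t (U + V)) (T t U + T t V)) \<and>
     (\<forall>t\<ge>0. \<forall>U\<in>X. \<forall>k. eqv (T t (scale k U)) (scale k (T t U))) \<and>
     (\<forall>U\<in>X. eqv (T 0 U) U) \<and>
     (\<forall>s\<ge>0. \<forall>t\<ge>0. \<forall>U\<in>X. eqv (T (s + t) U) (T s (T t U))) \<and>
     (\<forall>U\<in>X. ((\<lambda>t. nrm (T t U - U)) \<longlongrightarrow> 0) (at_right 0)) \<and>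
     (\<forall>t\<ge>0. \<forall>U\<in>X. nrm (T t U) \<le> nrm U)"

text \<open>The operator \<open>G\<close> with domain \<open>D\<close> has, modulo \<open>eqv\<close>, the same graph as the infinitesimal
  generator of \<open>T\<close>; this includes the equality of the domains.\<close>

definition generates ::
  "state set \<Rightarrow> (state \<Rightarrow> state \<Rightarrow> bool) \<Rightarrow> (state \<Rightarrow> real) \<Rightarrow>
   state set \<Rightarrow> (state \<Rightarrow> state) \<Rightarrow> (real \<Rightarrow> state \<Rightarrow> state) \<Rightarrow> bool" where
  "generates X eqv nrm D G T \<longleftrightarrow>
     D \<subseteq> X \<and> G ` D \<subseteq> X \<and>
     (\<forall>U\<in>X. \<forall>F\<in>X.
        ((\<lambda>h. nrm (scale (of_real (1 / h)) (T h U - U) - F)) \<longlongrightarrow> 0) (at_right 0)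
        \<longleftrightarrow> U \<in> D \<and> eqv (G U) F)"

end

theory Submission
  imports Defs
begin

text \<open>
  The proof is a Lyapunov argument in the time domain. The damping controls only \<open>z\<close>. Let
  \<open>s = \<alpha> v\<^sub>x + \<gamma> u3\<close> be the stress, so that \<open>\<rho> z\<^sub>t = s\<^sub>x - a z\<close> and \<open>s(L) = 0\<close>. By the constraint,
  \<open>R = \<gamma> \<xi> u2 + \<alpha>1 v\<close> with \<open>\<alpha>1 = \<alpha> + \<gamma>\<^sup>2 / \<epsilon>\<^sub>3\<close> is the antiderivative of \<open>s\<close> that vanishes at 0.
  Along strong solutions,
  \<^item> \<open>\<rho>\<langle>z, R\<rangle>\<close> produces \<open>- \<parallel>s\<parallel>\<^sup>2\<close>, because \<open>s\<^sub>x\<close> is paired with an antiderivative of \<open>s\<close>;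
  \<^item> \<open>\<langle>u1, R\<rangle>\<close> produces \<open>- \<parallel>u1\<parallel>\<^sup>2\<close>, because \<open>R\<^sub>t\<close> contains a negative multiple of \<open>u1\<close>, at the price of
    the trace \<open>u3(L)\<close> multiplied by \<open>R(L)\<close>, where \<open>R(L)\<close> is bounded by \<open>\<parallel>s\<parallel>\<close>;
  \<^item> \<open>- \<langle>u1, u2\<rangle>\<close> converts the control of \<open>u1\<close> into control of \<open>u2\<close> and \<open>u3\<close>;
  \<^item> the multiplier \<open>x d/dx\<close> controls the trace \<open>u3(L)\<close> by the energy.

  A combination of these four forms with a large multiple of the energy is equivalent to the energy
  and decays exponentially on the domain of the generator, hence everywhere because the domain is dense.
  The integrations by parts need that functions in \<open>H\<^sup>1\<close> are antiderivatives of their weak derivatives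
  (du Bois-Reymond); they follow from the smooth case since polynomials are dense in \<open>L\<^sup>2\<close>.
\<close>

section \<open>The \<open>L\<^sup>2\<close> pairing\<close>

text \<open>The pair (s, u3) replaces (v_x, u2_x) because the boundary conditions fit it: s vanishes
  at L and R vanishes at 0, so pairing s_x with R leaves no boundary term. Pairing u3_x with R does
  leave one, since R(L) = \<open>\<alpha>1\<close> v(L) is free. This product is the obstacle,
  because u3(L) is not bounded by the energy norm, and it is the reason for the fourth form. The
  multiplier x d/dx costs the whole energy with no small factor. It is therefore added with a small
  weight fixed beforehand; the second form can then be estimated so that the trace enters with a
  factor small enough to be absorbed by that weight. The trace z(L) produced by the same multiplier
  has the good sign.

  The semigroup is given only through the graph of its generator modulo equality almost everywhere.
  Invariance of the domain and the product rule along orbits are derived from this graph. The whole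
  argument is phrased with bounded real bilinear forms because boundedness alone makes them respect
  that equality, so choices of representatives never matter.\<close>

definition cip :: "real \<Rightarrow> (real \<Rightarrow> complex) \<Rightarrow> (real \<Rightarrow> complex) \<Rightarrow> complex" where
  "cip L f g = (LINT x|intv L. f x * cnj (g x))"

text \<open>The real part makes the pairing symmetric and real bilinear, which suits the energy
  estimates; the complex pairing is kept for antiderivatives.\<close>

definition ip :: "real \<Rightarrow> (real \<Rightarrow> complex) \<Rightarrow> (real \<Rightarrow> complex) \<Rightarrow> real" where
  "ip L f g = Re (cip L f g)"

definition nm :: "real \<Rightarrow> (real \<Rightarrow> complex) \<Rightarrow> real" where
  "nm L f = sqrt (ip L f f)"

lemma finite_measure_intv: "finite_measure (intv L)"
  by (rule finite_measure_lebesgue_on) simp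

lemma L2D: "f \<in> L2 L \<Longrightarrow> f \<in> borel_measurable (intv L)"
  "f \<in> L2 L \<Longrightarrow> integrable (intv L) (\<lambda>x. (cmod (f x))\<^sup>2)"
  by (auto simp: L2_def)

lemma L2_product_integrable:
  assumes f: "f \<in> L2 L" and g: "g \<in> L2 L"
  shows "integrable (intv L) (\<lambda>x. f x * g x)"
proof (rule Bochner_Integration.integrable_bound)
  show "integrable (intv L) (\<lambda>x. (cmod (f x))\<^sup>2 + (cmod (g x))\<^sup>2)"
    using f g by (intro Bochner_Integration.integrable_add L2D)
  show "(\<lambda>x. f x * g x) \<in> borel_measurable (intv L)"
    by (intro borel_measurable_times L2D(1) f g)
  have "cmod (f x * g x) \<le> norm ((cmod (f x))\<^sup>2 + (cmod (g x))\<^sup>2)" for x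
  proof -
    have "2 * (cmod (f x) * cmod (g x)) \<le> (cmod (f x))\<^sup>2 + (cmod (g x))\<^sup>2"
      using sum_squares_bound[of "cmod (f x)" "cmod (g x)"] by (simp add: mult.assoc)
    moreover have "0 \<le> cmod (f x) * cmod (g x)" by simp
    ultimately show ?thesis unfolding norm_mult real_norm_def by linarith
  qed
  then show "AE x in intv L. cmod (f x * g x) \<le> norm ((cmod (f x))\<^sup>2 + (cmod (g x))\<^sup>2)" by simp
qed

lemma borel_measurable_cnj [measurable (raw)]:
  "f \<in> borel_measurable M \<Longrightarrow> (\<lambda>x. cnj (f x)) \<in> borel_measurable M"
  by (rule measurable_compose[OF _ borel_measurable_continuous_onI]) (auto intro: continuous_on_cnj continuous_on_id)

lemma L2_cnj: "f \<in> L2 L \<Longrightarrow> (\<lambda>x. cnj (f x)) \<in> L2 L"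
  by (auto simp: L2_def)

lemma cip_integrable: "f \<in> L2 L \<Longrightarrow> g \<in> L2 L \<Longrightarrow> integrable (intv L) (\<lambda>x. f x * cnj (g x))"
  using L2_product_integrable L2_cnj by blast

lemma L2_add:
  assumes f: "f \<in> L2 L" and g: "g \<in> L2 L"
  shows "(\<lambda>x. f x + g x) \<in> L2 L"
proof -
  have [measurable]: "f \<in> borel_measurable (intv L)" "g \<in> borel_measurable (intv L)"
    using f g by (auto intro: L2D)
  have "integrable (intv L) (\<lambda>x. (cmod (f x + g x))\<^sup>2)"
  proof (rule Bochner_Integration.integrable_bound)
    show "integrable (intv L) (\<lambda>x. 2 * (cmod (f x))\<^sup>2 + 2 * (cmod (g x))\<^sup>2)"
      using f g by (intro Bochner_Integration.integrable_add integrable_mult_right L2D)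
    have "norm ((cmod (f x + g x))\<^sup>2) \<le> norm (2 * (cmod (f x))\<^sup>2 + 2 * (cmod (g x))\<^sup>2)" for x
    proof -
      have "(cmod (f x + g x))\<^sup>2 \<le> (cmod (f x) + cmod (g x))\<^sup>2"
        by (intro power_mono norm_triangle_ineq) simp
      also have "\<dots> \<le> 2 * (cmod (f x))\<^sup>2 + 2 * (cmod (g x))\<^sup>2"
        using sum_squares_bound[of "cmod (f x)" "cmod (g x)"] by (simp add: power2_sum)
      finally show ?thesis by simp
    qed
    then show "AE x in intv L. norm ((cmod (f x + g x))\<^sup>2) \<le> norm (2 * (cmod (f x))\<^sup>2 + 2 * (cmod (g x))\<^sup>2)"
      by simp
  qed simp
  then show ?thesis by (simp add: L2_def)
qed

lemma L2_scale: "f \<in> L2 L \<Longrightarrow> (\<lambda>x. c * f x) \<in> L2 L"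
  by (auto simp: L2_def norm_mult power_mult_distrib)

lemma L2_uminus: "f \<in> L2 L \<Longrightarrow> (\<lambda>x. - f x) \<in> L2 L"
  by (auto simp: L2_def)

lemma L2_diff: "f \<in> L2 L \<Longrightarrow> g \<in> L2 L \<Longrightarrow> (\<lambda>x. f x - g x) \<in> L2 L"
  using L2_add[OF _ L2_uminus] by fastforce

lemma L2_bounded:
  assumes "f \<in> borel_measurable (intv L)" "\<And>x. x \<in> {0<..<L} \<Longrightarrow> cmod (f x) \<le> B"
  shows "f \<in> L2 L"
proof -
  have "integrable (intv L) (\<lambda>x. (cmod (f x))\<^sup>2)"
    using assms power_mono[OF assms(2) norm_ge_zero]
    by (intro finite_measure.integrable_const_bound[OF finite_measure_intv, of _ "B\<^sup>2"])
       (auto simp: AE_restrict_space_iff)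
  then show ?thesis using assms by (simp add: L2_def)
qed

lemma L2_mult_bounded:
  assumes f: "f \<in> L2 L" and h: "h \<in> borel_measurable (intv L)"
    and b: "\<And>x. x \<in> {0<..<L} \<Longrightarrow> cmod (h x) \<le> B"
  shows "(\<lambda>x. h x * f x) \<in> L2 L"
proof -
  have [measurable]: "f \<in> borel_measurable (intv L)" "h \<in> borel_measurable (intv L)"
    using f h by (auto intro: L2D)
  have "integrable (intv L) (\<lambda>x. (cmod (h x * f x))\<^sup>2)"
  proof (rule Bochner_Integration.integrable_bound)
    show "integrable (intv L) (\<lambda>x. B\<^sup>2 * (cmod (f x))\<^sup>2)"
      using f by (intro integrable_mult_right L2D)
    show "AE x in intv L. norm ((cmod (h x * f x))\<^sup>2) \<le> norm (B\<^sup>2 * (cmod (f x))\<^sup>2)"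
      using power_mono[OF b norm_ge_zero]
      by (auto simp: AE_restrict_space_iff norm_mult power_mult_distrib intro!: mult_right_mono)
  qed simp
  then show ?thesis by (simp add: L2_def)
qed

lemma L2_continuous:
  assumes "continuous_on {0..L} f"
  shows "f \<in> L2 L"
proof -
  have "bounded (f ` {0..L})"
    using assms compact_continuous_image compact_imp_bounded by blast
  then obtain B where B: "\<And>x. x \<in> {0..L} \<Longrightarrow> cmod (f x) \<le> B"
    unfolding bounded_iff by (metis imageI)
  have "f \<in> borel_measurable (intv L)"
    by (rule continuous_imp_measurable_on_sets_lebesgue)
       (auto intro: continuous_on_subset[OF assms])
  then show ?thesis by (rule L2_bounded[where B=B]) (use B in auto)
qed

lemma L2_const: "(\<lambda>x. c) \<in> L2 L"
  by (rule L2_continuous) simp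

lemma L2_integrable: "f \<in> L2 L \<Longrightarrow> integrable (intv L) f"
  using L2_product_integrable[of f L "\<lambda>_. 1"] L2_const by simp

lemma cip_cong_AE:
  assumes "f \<in> L2 L" "f' \<in> L2 L" "g \<in> L2 L" "g' \<in> L2 L"
    "AE x in intv L. f x = f' x" "AE x in intv L. g x = g' x"
  shows "cip L f g = cip L f' g'"
proof -
  have [measurable]: "f \<in> borel_measurable (intv L)" "f' \<in> borel_measurable (intv L)"
    "g \<in> borel_measurable (intv L)" "g' \<in> borel_measurable (intv L)"
    using assms(1-4) by (auto intro: L2D)
  show ?thesis unfolding cip_def
    by (rule integral_cong_AE) (use assms(5,6) in \<open>auto\<close>)
qed

lemma ip_cong_AE:
  "f \<in> L2 L \<Longrightarrow> f' \<in> L2 L \<Longrightarrow> g \<in> L2 L \<Longrightarrow> g' \<in> L2 L \<Longrightarrow>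
    AE x in intv L. f x = f' x \<Longrightarrow> AE x in intv L. g x = g' x \<Longrightarrow> ip L f g = ip L f' g'"
  unfolding ip_def by (subst cip_cong_AE[of f L f' g g']) auto

lemma nm_cong_AE:
  "f \<in> L2 L \<Longrightarrow> f' \<in> L2 L \<Longrightarrow> AE x in intv L. f x = f' x \<Longrightarrow> nm L f = nm L f'"
  unfolding nm_def by (subst ip_cong_AE[of f L f' f f']) auto

lemma cip_add_left: "f \<in> L2 L \<Longrightarrow> g \<in> L2 L \<Longrightarrow> h \<in> L2 L \<Longrightarrow>
    cip L (\<lambda>x. f x + g x) h = cip L f h + cip L g h"
  unfolding cip_def using cip_integrable by (simp add: distrib_right)

lemma cip_diff_left: "f \<in> L2 L \<Longrightarrow> g \<in> L2 L \<Longrightarrow> h \<in> L2 L \<Longrightarrow>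
    cip L (\<lambda>x. f x - g x) h = cip L f h - cip L g h"
  unfolding cip_def using cip_integrable by (simp add: left_diff_distrib)

lemma cip_scale_left: "cip L (\<lambda>x. c * f x) g = c * cip L f g"
  unfolding cip_def by (simp add: mult.assoc)

lemma cip_commute: "cip L g f = cnj (cip L f g)"
  unfolding cip_def Bochner_Integration.integral_cnj[symmetric] by (simp add: mult.commute)

lemma ip_commute: "ip L g f = ip L f g"
  unfolding ip_def by (subst cip_commute) simp

lemma ip_add_left: "f \<in> L2 L \<Longrightarrow> g \<in> L2 L \<Longrightarrow> h \<in> L2 L \<Longrightarrow>
    ip L (\<lambda>x. f x + g x) h = ip L f h + ip L g h"
  by (simp add: ip_def cip_add_left)

lemma ip_diff_left: "f \<in> L2 L \<Longrightarrow> g \<in> L2 L \<Longrightarrow> h \<in> L2 L \<Longrightarrow>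
    ip L (\<lambda>x. f x - g x) h = ip L f h - ip L g h"
  by (simp add: ip_def cip_diff_left)

lemma ip_scale_left: "ip L (\<lambda>x. of_real c * f x) g = c * ip L f g"
  by (simp add: ip_def cip_scale_left)

lemma ip_add_right: "f \<in> L2 L \<Longrightarrow> g \<in> L2 L \<Longrightarrow> h \<in> L2 L \<Longrightarrow>
    ip L h (\<lambda>x. f x + g x) = ip L h f + ip L h g"
  by (simp add: ip_commute[of L h] ip_add_left)

lemma ip_diff_right: "f \<in> L2 L \<Longrightarrow> g \<in> L2 L \<Longrightarrow> h \<in> L2 L \<Longrightarrow>
    ip L h (\<lambda>x. f x - g x) = ip L h f - ip L h g"
  by (simp add: ip_commute[of L h] ip_diff_left)

lemma ip_scale_right: "ip L g (\<lambda>x. of_real c * f x) = c * ip L g f"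
  by (simp add: ip_commute[of L g] ip_scale_left)

lemma ip_self: "ip L f f = (LINT x|intv L. (cmod (f x))\<^sup>2)"
proof -
  have "cip L f f = (LINT x|intv L. complex_of_real ((cmod (f x))\<^sup>2))"
    unfolding cip_def by (simp only: complex_norm_square)
  then show ?thesis unfolding ip_def by (simp only: integral_complex_of_real Re_complex_of_real)
qed

lemma ip_self_nonneg: "ip L f f \<ge> 0"
  unfolding ip_self by (rule integral_nonneg_AE) simp

lemma nm_nonneg: "nm L f \<ge> 0"
  by (simp add: nm_def ip_self_nonneg)

lemma nm_sq: "(nm L f)\<^sup>2 = ip L f f"
  by (simp add: nm_def ip_self_nonneg)

text \<open>Cauchy-Schwarz from the nonnegative quadratic polynomial t -> |f + t g|^2.\<close>

lemma ip_bound: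
  assumes f: "f \<in> L2 L" and g: "g \<in> L2 L"
  shows "\<bar>ip L f g\<bar> \<le> nm L f * nm L g"
proof -
  have q: "ip L f f + 2 * t * ip L f g + t\<^sup>2 * ip L g g \<ge> 0" for t
  proof -
    have "ip L (\<lambda>x. f x + of_real t * g x) (\<lambda>x. f x + of_real t * g x)
      = ip L f f + 2 * t * ip L f g + t\<^sup>2 * ip L g g"
      using f g L2_scale[OF g]
      by (simp add: ip_add_left ip_add_right ip_scale_left ip_scale_right L2_add ip_commute[of L f g]
          algebra_simps power2_eq_square)
    then show ?thesis by (metis ip_self_nonneg)
  qed
  have "(ip L f g)\<^sup>2 \<le> ip L f f * ip L g g"
  proof (cases "ip L g g = 0")
    case True
    have "ip L f g = 0"
    proof (rule ccontr)
      assume n: "ip L f g \<noteq> 0"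
      \<comment> \<open>With vanishing leading coefficient the polynomial is affine in t; at this t
        it would equal -1.\<close>
      have "ip L f f + 2 * (- (ip L f f + 1) / (2 * ip L f g)) * ip L f g \<ge> 0"
        using q[of "- (ip L f f + 1) / (2 * ip L f g)"] True by simp
      with n show False by (simp add: field_simps)
    qed
    then show ?thesis using True by simp
  next
    case False
    then have "ip L g g > 0" using ip_self_nonneg[of L g] by linarith
    \<comment> \<open>The minimiser of the polynomial.\<close>
    with q[of "- ip L f g / ip L g g"] show ?thesis
      by (simp add: field_simps power2_eq_square)
  qed
  then have "(ip L f g)\<^sup>2 \<le> (nm L f * nm L g)\<^sup>2" by (simp add: power_mult_distrib nm_sq)
  then show ?thesis by (metis abs_le_square_iff abs_of_nonneg mult_nonneg_nonneg nm_nonneg)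
qed

lemma nm_scale: "nm L (\<lambda>x. c * f x) = cmod c * nm L f"
  unfolding nm_def ip_self by (simp add: norm_mult power_mult_distrib real_sqrt_mult)

lemma cip_bound:
  assumes f: "f \<in> L2 L" and g: "g \<in> L2 L"
  shows "cmod (cip L f g) \<le> nm L f * nm L g"
proof (cases "cip L f g = 0")
  case False
  \<comment> \<open>Multiplying f by the conjugate phase makes the pairing real and nonnegative, so
    the bound for the real part applies.\<close>
  define c where "c = cnj (sgn (cip L f g))"
  have c: "cmod c = 1" using False by (simp add: c_def norm_sgn)
  have "c * cip L f g = (cip L f g * cnj (cip L f g)) / of_real (cmod (cip L f g))"
    unfolding c_def sgn_eq by simp
  also have "\<dots> = of_real (cmod (cip L f g))"
    using False by (subst complex_norm_square[symmetric]) (simp add: power2_eq_square)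
  finally have "c * cip L f g = of_real (cmod (cip L f g))" .
  then have "cmod (cip L f g) = ip L (\<lambda>x. c * f x) g"
    by (simp add: ip_def cip_scale_left)
  also have "\<dots> \<le> nm L (\<lambda>x. c * f x) * nm L g"
    using ip_bound[OF L2_scale[OF f] g] by (metis abs_le_D1)
  finally show ?thesis by (simp add: nm_scale c)
qed (simp add: nm_nonneg)

lemma nm_triangle:
  assumes f: "f \<in> L2 L" and g: "g \<in> L2 L"
  shows "nm L (\<lambda>x. f x + g x) \<le> nm L f + nm L g"
proof -
  have "(nm L (\<lambda>x. f x + g x))\<^sup>2 = ip L f f + 2 * ip L f g + ip L g g"
    using f g by (simp add: nm_sq ip_add_left ip_add_right L2_add ip_commute[of L f g])
  also have "\<dots> \<le> (nm L f + nm L g)\<^sup>2"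
    using ip_bound[OF f g] by (simp add: power2_sum nm_sq)
  finally show ?thesis by (rule power2_le_imp_le) (simp add: nm_nonneg)
qed

lemma nm_minus_commute: "nm L (\<lambda>x. f x - g x) = nm L (\<lambda>x. g x - f x)"
  unfolding nm_def ip_self by (simp add: norm_minus_commute)

lemma nm_mult_bounded:
  assumes f: "f \<in> L2 L" and h: "h \<in> borel_measurable (intv L)"
    and b: "\<And>x. x \<in> {0<..<L} \<Longrightarrow> cmod (h x) \<le> B" and B: "B \<ge> 0"
  shows "nm L (\<lambda>x. h x * f x) \<le> B * nm L f"
proof -
  have "ip L (\<lambda>x. h x * f x) (\<lambda>x. h x * f x) \<le> (LINT x|intv L. B\<^sup>2 * (cmod (f x))\<^sup>2)"
    unfolding ip_self
  proof (rule integral_mono_AE)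
    show "integrable (intv L) (\<lambda>x. (cmod (h x * f x))\<^sup>2)"
      by (rule L2D) (rule L2_mult_bounded[OF assms(1-3)])
    show "integrable (intv L) (\<lambda>x. B\<^sup>2 * (cmod (f x))\<^sup>2)"
      using f by (intro integrable_mult_right L2D)
    show "AE x in intv L. (cmod (h x * f x))\<^sup>2 \<le> B\<^sup>2 * (cmod (f x))\<^sup>2"
      using power_mono[OF b norm_ge_zero]
      by (auto simp: AE_restrict_space_iff norm_mult power_mult_distrib intro!: mult_right_mono)
  qed
  also have "\<dots> = (B * nm L f)\<^sup>2" by (simp add: power_mult_distrib nm_sq ip_self)
  finally have "(nm L (\<lambda>x. h x * f x))\<^sup>2 \<le> (B * nm L f)\<^sup>2" by (simp only: nm_sq)
  then show ?thesis by (rule power2_le_imp_le) (simp add: B nm_nonneg)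
qed

lemma nm_eq_0_imp_AE:
  assumes "f \<in> L2 L" "nm L f = 0"
  shows "AE x in intv L. f x = 0"
proof -
  have "(LINT x|intv L. (cmod (f x))\<^sup>2) = 0" using assms(2) nm_sq[of L f] by (simp add: ip_self)
  then have "AE x in intv L. (cmod (f x))\<^sup>2 = 0"
    using integral_nonneg_eq_0_iff_AE[OF L2D(2)[OF assms(1)]] by simp
  then show ?thesis by simp
qed

text \<open>Dominated convergence in the form in which it is used for every density argument:
  pointwise convergence plus one square-integrable majorant.\<close>

lemma nm_tendsto_0_bounded:
  assumes s: "\<And>n. s n \<in> borel_measurable (intv L)"
    and lim: "AE x in intv L. (\<lambda>n. s n x) \<longlonglongrightarrow> 0"
    and w: "w \<in> L2 L" and b: "\<And>n. AE x in intv L. cmod (s n x) \<le> cmod (w x)"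
  shows "(\<lambda>n. nm L (s n)) \<longlonglongrightarrow> 0"
proof -
  have [measurable]: "\<And>n. s n \<in> borel_measurable (intv L)" by fact
  have "(\<lambda>n. LINT x|intv L. (cmod (s n x))\<^sup>2) \<longlonglongrightarrow> (LINT x|intv L. 0)"
  proof (rule integral_dominated_convergence[where w="\<lambda>x. (cmod (w x))\<^sup>2"])
    show "AE x in intv L. (\<lambda>n. (cmod (s n x))\<^sup>2) \<longlonglongrightarrow> 0"
      using lim by eventually_elim (auto intro!: tendsto_eq_intros)
    show "AE x in intv L. norm ((cmod (s n x))\<^sup>2) \<le> (cmod (w x))\<^sup>2" for n
      using b[of n] by eventually_elim (auto intro!: power_mono)
  qed (use w in \<open>auto intro: L2D\<close>)
  then have "(\<lambda>n. sqrt (ip L (s n) (s n))) \<longlonglongrightarrow> sqrt 0"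
    by (intro tendsto_real_sqrt) (simp add: ip_self)
  then show ?thesis by (simp add: nm_def)
qed

section \<open>Density of polynomials in \<open>L\<^sup>2\<close>\<close>

lemma cip_tendsto:
  assumes f: "\<And>n. fn n \<in> L2 L" "f \<in> L2 L" "((\<lambda>n. nm L (\<lambda>x. fn n x - f x)) \<longlongrightarrow> 0) F"
    and g: "\<And>n. gn n \<in> L2 L" "g \<in> L2 L" "((\<lambda>n. nm L (\<lambda>x. gn n x - g x)) \<longlongrightarrow> 0) F"
  shows "((\<lambda>n. cip L (fn n) (gn n)) \<longlongrightarrow> cip L f g) F"
proof -
  let ?a = "\<lambda>n. nm L (\<lambda>x. fn n x - f x)" and ?b = "\<lambda>n. nm L (\<lambda>x. gn n x - g x)"
  have "cmod (cip L (fn n) (gn n) - cip L f g) \<le> ?a n * (?b n + nm L g) + nm L f * ?b n" for n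
  proof -
    have 1: "cip L (\<lambda>x. fn n x - f x) (gn n) = cip L (fn n) (gn n) - cip L f (gn n)"
      using f g by (intro cip_diff_left)
    have 2: "cip L f (\<lambda>x. gn n x - g x) = cip L f (gn n) - cip L f g"
      using f g cip_diff_left[of "gn n" L g f] cip_commute[of L f]
      by (metis complex_cnj_diff)
    have "nm L (gn n) \<le> ?b n + nm L g"
      using nm_triangle[OF L2_diff[OF g(1)[of n] g(2)] g(2)] by simp
    then have "cmod (cip L (\<lambda>x. fn n x - f x) (gn n)) \<le> ?a n * (?b n + nm L g)"
      using cip_bound[OF L2_diff[OF f(1)[of n] f(2)] g(1)[of n]]
      by (meson mult_left_mono nm_nonneg order_trans)
    moreover have "cmod (cip L f (\<lambda>x. gn n x - g x)) \<le> nm L f * ?b n"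
      using cip_bound[OF f(2) L2_diff[OF g(1)[of n] g(2)]] .
    moreover have "cip L (fn n) (gn n) - cip L f g =
        cip L (\<lambda>x. fn n x - f x) (gn n) + cip L f (\<lambda>x. gn n x - g x)"
      by (simp add: 1 2)
    ultimately show ?thesis by (simp only: norm_triangle_mono)
  qed
  note bound = this
  have lim: "((\<lambda>n. ?a n * (?b n + nm L g) + nm L f * ?b n) \<longlongrightarrow> 0) F"
    using tendsto_add[OF tendsto_mult[OF f(3) tendsto_add[OF g(3) tendsto_const]] tendsto_mult[OF tendsto_const g(3)]]
    by simp
  have "((\<lambda>n. cip L (fn n) (gn n) - cip L f g) \<longlongrightarrow> 0) F"
    by (rule Lim_null_comparison[OF always_eventually lim]) (use bound in blast)
  then show ?thesis by (simp add: LIM_zero_iff)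
qed

text \<open>For positive L the constant \<open>nm L (\<lambda>_. 1)\<close> is the square root of L.
  It stays symbolic throughout, since the size of the constants is irrelevant.\<close>

lemma nm_mono_bound:
  assumes "f \<in> borel_measurable (intv L)" "\<And>x. x \<in> {0<..<L} \<Longrightarrow> cmod (f x) \<le> B" "B \<ge> 0"
  shows "nm L f \<le> B * nm L (\<lambda>_. 1)"
  using nm_mult_bounded[OF L2_const assms, of 1] by simp

text \<open>Vanishing at both end points costs nothing in the L^2 norm and later makes the
  approximating states satisfy the boundary conditions of the domain.\<close>

definition poly_approx :: "real \<Rightarrow> (real \<Rightarrow> complex) \<Rightarrow> bool" where
  "poly_approx L f \<longleftrightarrow> (\<forall>e>0. \<exists>p. polynomial_function p \<and> p 0 = 0 \<and> p L = 0 \<and>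
     nm L (\<lambda>x. f x - p x) < e)"

lemma poly_L2: "polynomial_function (p :: real \<Rightarrow> complex) \<Longrightarrow> p \<in> L2 L"
  by (intro L2_continuous continuous_on_polymonial_function)

lemma poly_approx_limit:
  assumes f: "f \<in> L2 L"
    and s: "\<And>n. h n \<in> L2 L" "\<And>n. poly_approx L (h n)" "(\<lambda>n. nm L (\<lambda>x. f x - h n x)) \<longlonglongrightarrow> 0"
  shows "poly_approx L f"
  unfolding poly_approx_def
proof (intro allI impI)
  fix e :: real assume e: "e > 0"
  have "eventually (\<lambda>n. nm L (\<lambda>x. f x - h n x) < e / 2) sequentially"
    by (rule order_tendstoD(2)[OF s(3)]) (use e in simp)
  then obtain n where n: "nm L (\<lambda>x. f x - h n x) < e / 2"
    by (auto simp: eventually_sequentially)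
  obtain p where p: "polynomial_function p" "p 0 = 0" "p L = 0" "nm L (\<lambda>x. h n x - p x) < e / 2"
    using s(2)[of n] e unfolding poly_approx_def by (meson half_gt_zero)
  have "nm L (\<lambda>x. (f x - h n x) + (h n x - p x)) \<le> nm L (\<lambda>x. f x - h n x) + nm L (\<lambda>x. h n x - p x)"
    by (intro nm_triangle L2_diff f s poly_L2 p)
  then have "nm L (\<lambda>x. f x - p x) < e" using n p(4) by simp
  then show "\<exists>p. polynomial_function p \<and> p 0 = 0 \<and> p L = 0 \<and> nm L (\<lambda>x. f x - p x) < e"
    using p by blast
qed

lemma poly_approx_poly:
  assumes L: "L > 0" and p: "polynomial_function (p :: real \<Rightarrow> complex)"
  shows "poly_approx L p"
proof -
  define w :: "real \<Rightarrow> real" where "w = (\<lambda>x. 1 - 4 * (x * (L - x)) / L\<^sup>2)"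
  \<comment> \<open>The factors \<open>1 - w\<^sup>n\<close> vanish at the end points and tend to 1 inside, where \<open>0 \<le> w < 1\<close>.\<close>
  define q where "q = (\<lambda>n x. p x - of_real (w x ^ n) * p x)"
  have w: "0 \<le> w x \<and> w x < 1" if "x \<in> {0<..<L}" for x
  proof -
    have "w x = (1 - 2 * x / L)\<^sup>2"
      using L by (simp add: w_def power2_eq_square field_simps)
    moreover have "x * (L - x) > 0" using that by simp
    then have "4 * (x * (L - x)) / L\<^sup>2 > 0" using L by simp
    ultimately show ?thesis unfolding w_def by (metis diff_gt_0_iff_gt diff_diff_eq2 add_diff_cancel_left' zero_le_power2)
  qed
  have wp: "real_polynomial_function w" unfolding w_def
    by (intro real_polynomial_function_diff real_polynomial_function_divide
        real_polynomial_function.intros) (auto intro: bounded_linear_intros)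
  have pq: "polynomial_function (q n)" for n
  proof -
    have "polynomial_function (\<lambda>x. p x - (w x ^ n) *\<^sub>R p x)"
      using wp p by (intro polynomial_function_diff polynomial_function_mult)
        (auto simp: real_polynomial_function_eq[symmetric])
    then show ?thesis by (simp add: q_def scaleR_conv_of_real)
  qed
  have lim: "(\<lambda>n. nm L (\<lambda>x. p x - q (Suc n) x)) \<longlonglongrightarrow> 0"
  proof (rule nm_tendsto_0_bounded[where w=p])
    show "(\<lambda>x. p x - q (Suc n) x) \<in> borel_measurable (intv L)" for n
      by (intro L2D L2_diff poly_L2 p pq)
    show "AE x in intv L. (\<lambda>n. p x - q (Suc n) x) \<longlonglongrightarrow> 0"
    proof (rule AE_I2)
      fix x assume "x \<in> space (intv L)"
      then have "(\<lambda>n. w x ^ Suc n) \<longlonglongrightarrow> 0"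
        using w[of x] by (intro LIMSEQ_Suc LIMSEQ_power_zero) simp
      then have "(\<lambda>n. of_real (w x ^ Suc n) * p x) \<longlonglongrightarrow> of_real 0 * p x"
        by (intro tendsto_intros)
      then show "(\<lambda>n. p x - q (Suc n) x) \<longlonglongrightarrow> 0" by (simp add: q_def)
    qed
    show "AE x in intv L. cmod (p x - q (Suc n) x) \<le> cmod (p x)" for n
    proof (rule AE_I2)
      fix x assume "x \<in> space (intv L)"
      then have "0 \<le> w x ^ Suc n" "w x ^ Suc n \<le> 1"
        using w[of x] by (auto simp del: power_Suc intro!: power_le_one)
      then show "cmod (p x - q (Suc n) x) \<le> cmod (p x)"
        unfolding q_def by (simp del: power_Suc of_real_power add: norm_mult mult_left_le_one_le)
    qed
  qed (rule poly_L2[OF p])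
  show ?thesis unfolding poly_approx_def
  proof (intro allI impI)
    fix e :: real assume e: "e > 0"
    have "eventually (\<lambda>n. nm L (\<lambda>x. p x - q (Suc n) x) < e) sequentially"
      by (rule order_tendstoD(2)[OF lim e])
    then obtain n where n: "nm L (\<lambda>x. p x - q (Suc n) x) < e"
      by (auto simp: eventually_sequentially)
    have "q (Suc n) 0 = 0" "q (Suc n) L = 0" by (simp_all add: q_def w_def)
    with n pq show "\<exists>p'. polynomial_function p' \<and> p' 0 = 0 \<and> p' L = 0 \<and> nm L (\<lambda>x. p x - p' x) < e"
      by blast
  qed
qed

lemma poly_approx_continuous:
  assumes L: "L > 0" and h: "continuous_on {0..L} h"
  shows "poly_approx L h"
proof -
  have "\<exists>p. polynomial_function p \<and> (\<forall>x\<in>{0..L}. cmod (h x - p x) < inverse (real (Suc n)))" for n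
    by (rule Stone_Weierstrass_polynomial_function) (use h in auto)
  then obtain p where p: "\<And>n. polynomial_function (p n)"
    "\<And>n x. x \<in> {0..L} \<Longrightarrow> cmod (h x - p n x) < inverse (real (Suc n))" by metis
  have pn: "p n \<in> L2 L" "poly_approx L (p n)" for n
    using p(1)[of n] by (auto intro: poly_L2 poly_approx_poly[OF L])
  have "nm L (\<lambda>x. h x - p n x) \<le> inverse (real (Suc n)) * nm L (\<lambda>_. 1)" for n
    using p(2)[of _ n] by (intro nm_mono_bound L2D L2_diff L2_continuous[OF h] poly_L2 p)
      (auto intro: less_imp_le)
  then have bound: "norm (nm L (\<lambda>x. h x - p n x)) \<le> inverse (real (Suc n)) * nm L (\<lambda>_. 1)" for n
    by (simp only: real_norm_def abs_of_nonneg[OF nm_nonneg])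
  have lim: "(\<lambda>n. inverse (real (Suc n)) * nm L (\<lambda>_. 1)) \<longlonglongrightarrow> 0"
    using tendsto_mult[OF LIMSEQ_inverse_real_of_nat tendsto_const] by simp
  have "(\<lambda>n. nm L (\<lambda>x. h x - p n x)) \<longlonglongrightarrow> 0"
    by (rule Lim_null_comparison[OF always_eventually lim]) (use bound in blast)
  then show ?thesis
    by (rule poly_approx_limit[OF L2_continuous[OF h] pn])
qed

text \<open>A measurable function is almost everywhere a limit of continuous ones, which need not be
  uniformly bounded. Composing them with the continuous radial retraction onto the disc of radius B
  keeps the limit, because the values of f lie in the disc, and supplies the majorant.\<close>

lemma poly_approx_bounded:
  assumes L: "L > 0" and f: "f \<in> borel_measurable (intv L)" and B: "B > 0" "\<And>x. cmod (f x) \<le> B"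
  shows "poly_approx L f"
proof -
  define clip :: "complex \<Rightarrow> complex" where "clip = (\<lambda>z. of_real (B / max B (cmod z)) * z)"
  have clip_cont: "continuous_on UNIV clip" unfolding clip_def
    using B by (intro continuous_intros) (auto simp: max_def)
  have clip_le: "cmod (clip z) \<le> B" for z
    using B by (auto simp: clip_def norm_mult norm_divide max_def field_simps)
  have clip_id: "clip z = z" if "cmod z \<le> B" for z
    using that B by (simp add: clip_def max_def)
  have "f measurable_on {0<..<L}"
    using f by (simp add: measurable_on_iff_borel_measurable)
  then obtain N g where N: "negligible N" and g: "\<And>n. continuous_on UNIV (g n)"
    and lim: "\<And>x. x \<notin> N \<Longrightarrow> (\<lambda>n::nat. g n x) \<longlonglongrightarrow> (if x \<in> {0<..<L} then f x else 0)"
    unfolding measurable_on_def by blast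
  define h where "h = (\<lambda>n x. clip (g n x))"
  have hc: "continuous_on {0..L} (h n)" for n unfolding h_def
    by (rule continuous_on_compose2[OF clip_cont continuous_on_subset[OF g]]) auto
  have fL: "f \<in> L2 L" by (rule L2_bounded[OF f B(2)])
  show ?thesis
  proof (rule poly_approx_limit[where h=h])
    show "(\<lambda>n. nm L (\<lambda>x. f x - h n x)) \<longlonglongrightarrow> 0"
    proof (rule nm_tendsto_0_bounded[where w="\<lambda>_. of_real (2 * B)"])
      show "(\<lambda>x. f x - h n x) \<in> borel_measurable (intv L)" for n
        by (intro L2D L2_diff fL L2_continuous[OF hc])
      have "AE x in lebesgue. x \<notin> N"
        using N by (simp add: negligible_iff_null_sets AE_not_in)
      then have "AE x in intv L. x \<notin> N"
        by (auto simp: AE_restrict_space_iff)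
      then show "AE x in intv L. (\<lambda>n. f x - h n x) \<longlonglongrightarrow> 0"
      proof (rule AE_mp, intro AE_I2 impI)
        fix x assume x: "x \<in> space (intv L)" "x \<notin> N"
        have "isCont clip (f x)" using clip_cont by (simp add: continuous_on_eq_continuous_at)
        then have "(\<lambda>n. clip (g n x)) \<longlonglongrightarrow> clip (f x)"
          using lim[OF x(2)] x(1) by (intro isCont_tendsto_compose[of _ clip]) auto
        then have "(\<lambda>n. f x - h n x) \<longlonglongrightarrow> f x - f x"
          unfolding h_def clip_id[OF B(2)] by (intro tendsto_intros)
        then show "(\<lambda>n. f x - h n x) \<longlonglongrightarrow> 0" by simp
      qed
      show "AE x in intv L. cmod (f x - h n x) \<le> cmod (of_real (2 * B))" for n
        using norm_triangle_le_diff[OF add_mono[OF B(2) clip_le]] B(1) by (simp add: h_def)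
    qed (rule L2_const)
  qed (use hc fL in \<open>auto intro: poly_approx_continuous[OF L] L2_continuous\<close>)
qed

text \<open>Cutting f off where its modulus exceeds n + 1 reduces to bounded functions, with f
  itself as majorant.\<close>

theorem L2_poly_approx:
  assumes L: "L > 0" and f: "f \<in> L2 L"
  shows "poly_approx L f"
proof -
  define h where "h = (\<lambda>(n::nat) x. if cmod (f x) \<le> real (Suc n) then f x else 0)"
  have [measurable]: "f \<in> borel_measurable (intv L)" by (rule L2D[OF f])
  have hm: "h n \<in> borel_measurable (intv L)" for n unfolding h_def by measurable
  have hb: "cmod (h n x) \<le> real (Suc n)" for n x by (simp add: h_def)
  show ?thesis
  proof (rule poly_approx_limit[where h=h])
    show "(\<lambda>n. nm L (\<lambda>x. f x - h n x)) \<longlonglongrightarrow> 0"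
    proof (rule nm_tendsto_0_bounded[where w=f])
      show "(\<lambda>x. f x - h n x) \<in> borel_measurable (intv L)" for n
        using hm[of n] by measurable
      show "AE x in intv L. (\<lambda>n. f x - h n x) \<longlonglongrightarrow> 0"
      proof (rule AE_I2)
        fix x
        obtain m where "cmod (f x) \<le> real m" using real_arch_simple by blast
        then have "f x - h n x = 0" if "n \<ge> m" for n using that by (simp add: h_def)
        then show "(\<lambda>n. f x - h n x) \<longlonglongrightarrow> 0"
          by (intro tendsto_eventually) (auto simp: eventually_sequentially)
      qed
      show "AE x in intv L. cmod (f x - h n x) \<le> cmod (f x)" for n
        by (simp add: h_def)
    qed (rule f)
    show "h n \<in> L2 L" for n by (rule L2_bounded[OF hm hb])
    show "poly_approx L (h n)" for n
      by (rule poly_approx_bounded[OF L hm _ hb]) simp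
  qed (rule f)
qed

lemma L2_poly_sequence:
  assumes L: "L > 0" and f: "f \<in> L2 L"
  obtains p :: "nat \<Rightarrow> real \<Rightarrow> complex" where "\<And>n. polynomial_function (p n)" "\<And>n. p n 0 = 0" "\<And>n. p n L = 0"
    "(\<lambda>n. nm L (\<lambda>x. p n x - f x)) \<longlonglongrightarrow> 0"
proof -
  have "\<exists>p. polynomial_function p \<and> p 0 = 0 \<and> p L = 0 \<and> nm L (\<lambda>x. f x - p x) < inverse (real (Suc n))" for n
    using L2_poly_approx[OF L f] unfolding poly_approx_def by simp
  then obtain p where p: "\<And>n::nat. polynomial_function (p n) \<and> p n 0 = 0 \<and> p n L = 0 \<and>
      nm L (\<lambda>x. f x - p n x) < inverse (real (Suc n))" by metis
  have "(\<lambda>n. nm L (\<lambda>x. p n x - f x)) \<longlonglongrightarrow> 0"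
  proof (rule Lim_null_comparison[OF _ LIMSEQ_inverse_real_of_nat])
    have "norm (nm L (\<lambda>x. p n x - f x)) \<le> inverse (real (Suc n))" for n
      using p[of n] nm_minus_commute[of L "p n" f] by (simp add: nm_nonneg less_imp_le)
    then show "\<forall>\<^sub>F n in sequentially. norm (nm L (\<lambda>x. p n x - f x)) \<le> inverse (real (Suc n))" by simp
  qed
  then show ?thesis using that p by blast
qed

section \<open>Antiderivatives and integration by parts\<close>

text \<open>Antiderivatives are written as \<open>L\<^sup>2\<close> pairings, so that by the Cauchy-Schwarz inequality they depend
  continuously on the integrand, uniformly in the upper end point.\<close>

definition prim :: "real \<Rightarrow> complex \<Rightarrow> (real \<Rightarrow> complex) \<Rightarrow> real \<Rightarrow> complex" where
  "prim L c g x = c + cip L g (indicator {..<x})"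

lemma indicator_L2: "indicator {..<x} \<in> L2 L"
proof (rule L2_bounded[where B=1])
  have "indicator {..<x} \<in> borel_measurable borel" by measurable
  then show "(indicator {..<x} :: real \<Rightarrow> complex) \<in> borel_measurable (intv L)"
    by (intro measurable_restrict_space1 measurable_completion) simp
qed (simp add: indicator_def)

lemma nm_indicator_le: "nm L (indicator {..<x}) \<le> nm L (\<lambda>_. 1)"
proof -
  have "nm L (indicator {..<x}) \<le> 1 * nm L (\<lambda>_. 1)"
    by (rule nm_mono_bound[OF L2D(1)[OF indicator_L2]]) (auto simp: indicator_def)
  then show ?thesis by simp
qed

lemma prim_diff_bound:
  assumes "f \<in> L2 L" "g \<in> L2 L"
  shows "cmod (prim L c f x - prim L c g x) \<le> nm L (\<lambda>x. f x - g x) * nm L (\<lambda>_. 1)"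
proof -
  have "prim L c f x - prim L c g x = cip L (\<lambda>x. f x - g x) (indicator {..<x})"
    using assms indicator_L2 by (simp add: prim_def cip_diff_left)
  also have "cmod \<dots> \<le> nm L (\<lambda>x. f x - g x) * nm L (indicator {..<x})"
    using assms by (intro cip_bound L2_diff indicator_L2)
  also have "\<dots> \<le> nm L (\<lambda>x. f x - g x) * nm L (\<lambda>_. 1)"
    by (intro mult_left_mono nm_indicator_le nm_nonneg)
  finally show ?thesis .
qed

lemma LINT_intv_continuous:
  fixes f :: "real \<Rightarrow> complex"
  assumes "continuous_on {0..L} f"
  shows "(LINT x|intv L. f x) = integral {0..L} f"
  using lebesgue_integral_eq_integral[OF L2_integrable[OF L2_continuous[OF assms]]]
  by (simp add: integral_open_interval_real)

lemma prim_continuous_eq: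
  assumes g: "continuous_on {0..L} g" and x: "x \<in> {0..L}"
  shows "prim L c g x = c + integral {0..x} g"
proof -
  have "cip L g (indicator {..<x}) = (LINT y|intv L. g y * cnj (indicator {..<x} y))"
    by (simp add: cip_def)
  also have "\<dots> = integral {0<..<L} (\<lambda>y. g y * cnj (indicator {..<x} y))"
    using cip_integrable[OF L2_continuous[OF g] indicator_L2]
    by (intro lebesgue_integral_eq_integral) auto
  also have "(\<lambda>y. g y * cnj (indicator {..<x} y)) = (\<lambda>y. if y \<in> {..<x} then g y else 0)"
    by (auto simp: indicator_def)
  also have "integral {0<..<L} (\<lambda>y. if y \<in> {..<x} then g y else 0) = integral ({..<x} \<inter> {0<..<L}) g"
    by (rule integral_restrict_Int)
  also have "{..<x} \<inter> {0<..<L} = {0<..<x}" using x by auto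
  also have "integral {0<..<x} g = integral {0..x} g" by (rule integral_open_interval_real[symmetric])
  finally show ?thesis by (simp add: prim_def)
qed

lemma prim_0: "prim L c g 0 = c"
proof -
  have "cip L g (indicator {..<0}) = (LINT y|intv L. 0)" unfolding cip_def
    by (rule Bochner_Integration.integral_cong) (auto simp: indicator_def)
  then show ?thesis by (simp add: prim_def)
qed

lemma prim_has_vector_derivative:
  assumes g: "continuous_on {0..L} g" and x: "x \<in> {0..L}"
  shows "(prim L c g has_vector_derivative g x) (at x within {0..L})"
proof (rule has_vector_derivative_transform[OF x])
  show "((\<lambda>x. c + integral {0..x} g) has_vector_derivative g x) (at x within {0..L})"
    using has_vector_derivative_add[OF has_vector_derivative_const[of c] integral_has_vector_derivative[OF g x]]
    by simp
qed (rule prim_continuous_eq[OF g])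

lemma prim_continuous_smooth: "continuous_on {0..L} g \<Longrightarrow> continuous_on {0..L} (prim L c g)"
  using prim_has_vector_derivative has_vector_derivative_continuous continuous_on_eq_continuous_within
  by blast

lemma prim_of_C1:
  assumes "continuous_on {0..L} g" and G: "\<And>x. x \<in> {0..L} \<Longrightarrow> (G has_vector_derivative g x) (at x within {0..L})"
    and x: "x \<in> {0..L}"
  shows "prim L (G 0) g x = G x"
proof -
  have "(g has_integral (G x - G 0)) {0..x}"
  proof (rule fundamental_theorem_of_calculus)
    show "(G has_vector_derivative g y) (at y within {0..x})" if "y \<in> {0..x}" for y
      by (rule has_vector_derivative_within_subset[OF G]) (use that x in auto)
  qed (use x in auto)
  then show ?thesis using prim_continuous_eq[OF assms(1) x, of "G 0"] by (simp add: integral_unique)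
qed

lemma prim_continuous:
  assumes L: "L > 0" and g: "g \<in> L2 L"
  shows "continuous_on {0..L} (prim L c g)"
proof -
  obtain p :: "nat \<Rightarrow> real \<Rightarrow> complex" where p: "\<And>n. polynomial_function (p n)"
    and lim: "(\<lambda>n. nm L (\<lambda>x. p n x - g x)) \<longlonglongrightarrow> 0"
    using L2_poly_sequence[OF L g] by metis
  have "uniform_limit {0..L} (\<lambda>n. prim L c (p n)) (prim L c g) sequentially"
  proof (rule uniform_limitI)
    fix e :: real assume e: "e > 0"
    have "(\<lambda>n. nm L (\<lambda>x. p n x - g x) * nm L (\<lambda>_. 1)) \<longlonglongrightarrow> 0"
      using tendsto_mult[OF lim tendsto_const] by simp
    then have "\<forall>\<^sub>F n in sequentially. nm L (\<lambda>x. p n x - g x) * nm L (\<lambda>_. 1) < e"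
      by (rule order_tendstoD(2)[OF _ e])
    then show "\<forall>\<^sub>F n in sequentially. \<forall>x\<in>{0..L}. dist (prim L c (p n) x) (prim L c g x) < e"
    proof eventually_elim
      case (elim n)
      show ?case using prim_diff_bound[OF poly_L2[OF p] g, of c n] elim
        by (auto simp: dist_norm intro: le_less_trans)
    qed
  qed
  then show ?thesis
    by (rule uniform_limit_theorem[OF always_eventually, rotated])
       (simp_all add: prim_continuous_smooth[OF continuous_on_polymonial_function[OF p]])
qed

lemma prim_L2: "L > 0 \<Longrightarrow> g \<in> L2 L \<Longrightarrow> prim L c g \<in> L2 L"
  by (rule L2_continuous) (rule prim_continuous)

lemma nm_prim_diff_le:
  assumes L: "L > 0" and "f \<in> L2 L" "g \<in> L2 L"
  shows "nm L (\<lambda>x. prim L c f x - prim L c g x) \<le> nm L (\<lambda>x. f x - g x) * nm L (\<lambda>_. 1) * nm L (\<lambda>_. 1)"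
  by (rule nm_mono_bound) (auto intro!: L2D L2_diff prim_L2 assms prim_diff_bound mult_nonneg_nonneg nm_nonneg)

text \<open>The fundamental theorem of calculus for the product of the weight, one antiderivative
  and the conjugate of the other. The weight is later 1 or x.\<close>

lemma prim_by_parts_smooth:
  fixes w :: "real \<Rightarrow> real"
  assumes L: "L > 0" and g: "continuous_on {0..L} g" and k: "continuous_on {0..L} k"
    and w: "\<And>x. (w has_real_derivative w' x) (at x)" "continuous_on {0..L} w'"
  shows "cip L (\<lambda>x. of_real (w x) * g x) (prim L d k) + cip L (\<lambda>x. of_real (w x) * prim L c g x) k
      + cip L (\<lambda>x. of_real (w' x) * prim L c g x) (prim L d k)
    = of_real (w L) * prim L c g L * cnj (prim L d k L) - of_real (w 0) * c * cnj d"
proof -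
  let ?G = "prim L c g" and ?K = "prim L d k"
  note cG = prim_continuous_smooth[OF g, of c] and cK = prim_continuous_smooth[OF k, of d]
  have cw: "continuous_on {0..L} w"
    using w(1) by (meson DERIV_isCont continuous_at_imp_continuous_on)
  have i1: "cip L f h = integral {0..L} (\<lambda>x. f x * cnj (h x))" if "continuous_on {0..L} f" "continuous_on {0..L} h" for f h
    unfolding cip_def by (rule LINT_intv_continuous) (intro continuous_intros that)
  have i2: "(\<lambda>x. f x * cnj (h x)) integrable_on {0..L}" if "continuous_on {0..L} f" "continuous_on {0..L} h" for f h
    by (rule integrable_continuous_real) (intro continuous_intros that)
  have c1: "continuous_on {0..L} (\<lambda>x. of_real (w x) * g x)"
    "continuous_on {0..L} (\<lambda>x. of_real (w x) * ?G x)" "continuous_on {0..L} (\<lambda>x. of_real (w' x) * ?G x)"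
    by (intro continuous_intros cw g w(2) cG)+
  have "cip L (\<lambda>x. of_real (w x) * g x) ?K + cip L (\<lambda>x. of_real (w x) * ?G x) k
      + cip L (\<lambda>x. of_real (w' x) * ?G x) ?K
    = integral {0..L} (\<lambda>x. of_real (w x) * g x * cnj (?K x) + of_real (w x) * ?G x * cnj (k x)
        + of_real (w' x) * ?G x * cnj (?K x))"
    unfolding i1[OF c1(1) cK] i1[OF c1(2) k] i1[OF c1(3) cK]
    by (simp add: integral_add integrable_add i2[OF c1(1) cK] i2[OF c1(2) k] i2[OF c1(3) cK])
  also have "((\<lambda>x. of_real (w x) * g x * cnj (?K x) + of_real (w x) * ?G x * cnj (k x)
        + of_real (w' x) * ?G x * cnj (?K x)) has_integral
      (of_real (w L) * ?G L * cnj (?K L) - of_real (w 0) * ?G 0 * cnj (?K 0))) {0..L}"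
  proof (rule fundamental_theorem_of_calculus)
    fix x assume x: "x \<in> {0..L}"
    note dG = prim_has_vector_derivative[OF g x, of c] and dK = prim_has_vector_derivative[OF k x, of d]
    have dw: "((\<lambda>x. complex_of_real (w x)) has_vector_derivative of_real (w' x)) (at x within {0..L})"
      using has_vector_derivative_of_real[of w "w' x" "at x within {0..L}"]
        has_field_derivative_at_within[OF w(1)[of x]]
      by (simp add: has_real_derivative_iff_has_vector_derivative)
    have dKc: "((\<lambda>x. cnj (?K x)) has_vector_derivative cnj (k x)) (at x within {0..L})"
      by (rule bounded_linear.has_vector_derivative[OF bounded_linear_cnj dK])
    show "((\<lambda>x. of_real (w x) * ?G x * cnj (?K x)) has_vector_derivative
        of_real (w x) * g x * cnj (?K x) + of_real (w x) * ?G x * cnj (k x)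
        + of_real (w' x) * ?G x * cnj (?K x)) (at x within {0..L})"
      using has_vector_derivative_mult[OF has_vector_derivative_mult[OF dw dG] dKc]
      by (simp add: algebra_simps)
  qed (use L in simp)
  then have "integral {0..L} (\<lambda>x. of_real (w x) * g x * cnj (?K x) + of_real (w x) * ?G x * cnj (k x)
        + of_real (w' x) * ?G x * cnj (?K x)) =
      of_real (w L) * ?G L * cnj (?K L) - of_real (w 0) * ?G 0 * cnj (?K 0)"
    by (rule integral_unique)
  finally show ?thesis by (simp add: prim_0)
qed

lemma nm_weight_tendsto:
  fixes w :: "real \<Rightarrow> real"
  assumes w: "continuous_on {0..L} w" and f: "\<And>n. fn n \<in> L2 L" "f \<in> L2 L"
    and lim: "((\<lambda>n. nm L (\<lambda>x. fn n x - f x)) \<longlongrightarrow> 0) F"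
  shows "((\<lambda>n. nm L (\<lambda>x. of_real (w x) * fn n x - of_real (w x) * f x)) \<longlongrightarrow> 0) F"
proof -
  have "bounded (w ` {0..L})"
    using w compact_continuous_image compact_imp_bounded by blast
  then obtain B where B: "\<And>x. x \<in> {0..L} \<Longrightarrow> \<bar>w x\<bar> \<le> B"
    unfolding bounded_iff by (metis imageI real_norm_def)
  have m: "(\<lambda>x. complex_of_real (w x)) \<in> borel_measurable (intv L)"
    by (rule L2D(1), rule L2_continuous) (intro continuous_intros w)
  have "nm L (\<lambda>x. of_real (w x) * fn n x - of_real (w x) * f x) \<le> max B 0 * nm L (\<lambda>x. fn n x - f x)" for n
    unfolding right_diff_distrib[symmetric]
    by (rule nm_mult_bounded[OF L2_diff[OF f(1)[of n] f(2)] m]) (simp_all add: B le_max_iff_disj)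
  then have bound: "norm (nm L (\<lambda>x. of_real (w x) * fn n x - of_real (w x) * f x)) \<le> max B 0 * nm L (\<lambda>x. fn n x - f x)" for n
    by (simp only: real_norm_def abs_of_nonneg[OF nm_nonneg])
  have lim: "((\<lambda>n. max B 0 * nm L (\<lambda>x. fn n x - f x)) \<longlongrightarrow> 0) F"
    using tendsto_mult[OF tendsto_const lim] by simp
  show ?thesis
    by (rule Lim_null_comparison[OF always_eventually lim]) (use bound in blast)
qed

lemma L2_weight:
  fixes w :: "real \<Rightarrow> real"
  assumes "continuous_on {0..L} w" "f \<in> L2 L"
  shows "(\<lambda>x. of_real (w x) * f x) \<in> L2 L"
proof -
  have "bounded (w ` {0..L})"
    using assms compact_continuous_image compact_imp_bounded by blast
  then obtain B where B: "\<And>x. x \<in> {0..L} \<Longrightarrow> \<bar>w x\<bar> \<le> B"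
    unfolding bounded_iff by (metis imageI real_norm_def)
  have m: "(\<lambda>x. complex_of_real (w x)) \<in> borel_measurable (intv L)"
    by (rule L2D(1), rule L2_continuous) (intro continuous_intros assms)
  show ?thesis
    by (rule L2_mult_bounded[OF assms(2) m, where B=B]) (use B in auto)
qed

theorem prim_by_parts:
  fixes w :: "real \<Rightarrow> real"
  assumes L: "L > 0" and g: "g \<in> L2 L" and k: "k \<in> L2 L"
    and w: "\<And>x. (w has_real_derivative w' x) (at x)" "continuous_on {0..L} w'"
  shows "cip L (\<lambda>x. of_real (w x) * g x) (prim L d k) + cip L (\<lambda>x. of_real (w x) * prim L c g x) k
      + cip L (\<lambda>x. of_real (w' x) * prim L c g x) (prim L d k)
    = of_real (w L) * prim L c g L * cnj (prim L d k L) - of_real (w 0) * c * cnj d"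
proof -
  obtain p :: "nat \<Rightarrow> real \<Rightarrow> complex" where p: "\<And>n. polynomial_function (p n)"
    and plim: "(\<lambda>n. nm L (\<lambda>x. p n x - g x)) \<longlonglongrightarrow> 0"
    using L2_poly_sequence[OF L g] by metis
  obtain q :: "nat \<Rightarrow> real \<Rightarrow> complex" where q: "\<And>n. polynomial_function (q n)"
    and qlim: "(\<lambda>n. nm L (\<lambda>x. q n x - k x)) \<longlonglongrightarrow> 0"
    using L2_poly_sequence[OF L k] by metis
  have cw: "continuous_on {0..L} w"
    using w(1) by (meson DERIV_isCont continuous_at_imp_continuous_on)
  note pL = poly_L2[OF p] and qL = poly_L2[OF q]
  \<comment> \<open>Convergence of the integrands yields both modes of convergence needed: in L^2
    for the pairings, at the point L for the boundary term.\<close>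
  have conv: "(\<lambda>n. nm L (\<lambda>x. prim L c' (f n) x - prim L c' f' x)) \<longlonglongrightarrow> 0 \<and>
     (\<lambda>n. prim L c' (f n) L) \<longlonglongrightarrow> prim L c' f' L"
    if f: "\<And>n. f n \<in> L2 L" "f' \<in> L2 L" and lim: "(\<lambda>n. nm L (\<lambda>x. f n x - f' x)) \<longlonglongrightarrow> 0" for f f' c'
  proof
    have l1: "(\<lambda>n. nm L (\<lambda>x. f n x - f' x) * nm L (\<lambda>_. 1) * nm L (\<lambda>_. 1)) \<longlonglongrightarrow> 0"
      and l2: "(\<lambda>n. nm L (\<lambda>x. f n x - f' x) * nm L (\<lambda>_. 1)) \<longlonglongrightarrow> 0"
      using tendsto_mult[OF lim tendsto_const, of "nm L (\<lambda>_. 1)"]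
        tendsto_mult[OF tendsto_mult[OF lim tendsto_const, of "nm L (\<lambda>_. 1)"] tendsto_const, of "nm L (\<lambda>_. 1)"]
      by simp_all
    have b1: "norm (nm L (\<lambda>x. prim L c' (f n) x - prim L c' f' x)) \<le> nm L (\<lambda>x. f n x - f' x) * nm L (\<lambda>_. 1) * nm L (\<lambda>_. 1)" for n
      using nm_prim_diff_le[OF L f(1)[of n] f(2), of c'] by (simp only: real_norm_def abs_of_nonneg[OF nm_nonneg])
    show "(\<lambda>n. nm L (\<lambda>x. prim L c' (f n) x - prim L c' f' x)) \<longlonglongrightarrow> 0"
      by (rule Lim_null_comparison[OF always_eventually l1]) (use b1 in blast)
    have "(\<lambda>n. prim L c' (f n) L - prim L c' f' L) \<longlonglongrightarrow> 0"
      by (rule Lim_null_comparison[OF always_eventually l2]) (use prim_diff_bound[OF f(1) f(2)] in blast)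
    then show "(\<lambda>n. prim L c' (f n) L) \<longlonglongrightarrow> prim L c' f' L" by (simp add: LIM_zero_iff)
  qed
  note P = conv[OF pL g plim, of c] and Q = conv[OF qL k qlim, of d]
  note PL = prim_L2[OF L pL] and QL = prim_L2[OF L qL] and GL = prim_L2[OF L g] and KL = prim_L2[OF L k]
  have "(\<lambda>n. cip L (\<lambda>x. of_real (w x) * p n x) (prim L d (q n)) + cip L (\<lambda>x. of_real (w x) * prim L c (p n) x) (q n)
      + cip L (\<lambda>x. of_real (w' x) * prim L c (p n) x) (prim L d (q n)))
    \<longlonglongrightarrow> cip L (\<lambda>x. of_real (w x) * g x) (prim L d k) + cip L (\<lambda>x. of_real (w x) * prim L c g x) k
      + cip L (\<lambda>x. of_real (w' x) * prim L c g x) (prim L d k)"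
    by (intro tendsto_add cip_tendsto nm_weight_tendsto[OF cw] nm_weight_tendsto[OF w(2)] L2_weight[OF cw] L2_weight[OF w(2)]
        pL qL g k PL QL GL KL plim qlim conjunct1[OF P] conjunct1[OF Q])
  moreover have "cip L (\<lambda>x. of_real (w x) * p n x) (prim L d (q n)) + cip L (\<lambda>x. of_real (w x) * prim L c (p n) x) (q n)
      + cip L (\<lambda>x. of_real (w' x) * prim L c (p n) x) (prim L d (q n)) =
     of_real (w L) * prim L c (p n) L * cnj (prim L d (q n) L) - of_real (w 0) * c * cnj d" for n
    by (rule prim_by_parts_smooth[OF L _ _ w]) (intro continuous_on_polymonial_function p q)+
  moreover have "(\<lambda>n. of_real (w L) * prim L c (p n) L * cnj (prim L d (q n) L) - of_real (w 0) * c * cnj d) \<longlonglongrightarrow>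
     of_real (w L) * prim L c g L * cnj (prim L d k L) - of_real (w 0) * c * cnj d"
    by (intro tendsto_diff tendsto_mult tendsto_cnj tendsto_const conjunct2[OF P] conjunct2[OF Q])
  ultimately show ?thesis
    by (simp only: LIMSEQ_unique)
qed

section \<open>Test functions and weak derivatives\<close>

text \<open>The numerator \<open>p\<close> and the exponent \<open>k\<close> make this class closed under differentiation.\<close>

definition bump :: "real \<Rightarrow> real \<Rightarrow> real \<Rightarrow> (real \<Rightarrow> real) \<Rightarrow> nat \<Rightarrow> real \<Rightarrow> real" where
  "bump a b c p k x = (if a < x \<and> x < b
     then p x / ((x - a) * (b - x)) ^ k * exp (- c / ((x - a) * (b - x))) else 0)"

lemma power_le_fact_exp:
  fixes t :: real
  assumes "t \<ge> 0"
  shows "t ^ n \<le> fact n * exp t"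
proof -
  have "(\<Sum>i\<in>{n}. t ^ i /\<^sub>R fact i) \<le> (\<Sum>i. t ^ i /\<^sub>R fact i)"
    by (rule sum_le_suminf[OF summable_exp_generic]) (use assms in auto)
  then have "t ^ n / fact n \<le> exp t" by (simp add: exp_def field_simps)
  then show ?thesis by (simp add: field_simps)
qed

text \<open>The power k + 2 of the exponential bound cancels w^k and leaves a spare factor w^2, the
  quadratic flatness at the edge of a bump.\<close>

lemma exp_flat_bound:
  fixes c w :: real
  assumes "c > 0" "w > 0"
  shows "exp (- c / w) / w ^ k \<le> fact (k + 2) / c ^ (k + 2) * w\<^sup>2"
proof -
  have "(c / w) ^ (k + 2) \<le> fact (k + 2) * exp (c / w)"
    using assms by (intro power_le_fact_exp) simp
  then have "exp (- (c / w)) * (c / w) ^ (k + 2) \<le> exp (- (c / w)) * (fact (k + 2) * exp (c / w))"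
    by (rule mult_left_mono) simp
  also have "\<dots> = fact (k + 2)" by (simp add: exp_minus)
  finally have "exp (- (c / w)) * (c ^ (k + 2) / w ^ (k + 2)) \<le> fact (k + 2)"
    by (simp only: power_divide)
  then have "exp (- (c / w)) / w ^ (k + 2) \<le> fact (k + 2) / c ^ (k + 2)"
    using assms by (simp add: field_simps del: fact_Suc)
  then have "exp (- (c / w)) / w ^ (k + 2) * w\<^sup>2 \<le> fact (k + 2) / c ^ (k + 2) * w\<^sup>2"
    by (rule mult_right_mono) simp
  moreover have "exp (- (c / w)) / w ^ (k + 2) * w\<^sup>2 = exp (- c / w) / w ^ k"
    using assms by (simp add: power_add power2_eq_square field_simps)
  ultimately show ?thesis by simp
qed

text \<open>The product (x - a)(b - x) is at most b - a times the distance to either edge, so its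
  square gives flatness of second order at both.\<close>

lemma bump_flat_bound:
  assumes ab: "a < b" and c: "c > 0" and p: "real_polynomial_function p"
  obtains C where "\<And>x. \<bar>bump a b c p k x\<bar> \<le> C * (x - a)\<^sup>2" "\<And>x. \<bar>bump a b c p k x\<bar> \<le> C * (x - b)\<^sup>2"
proof -
  have "bounded (p ` {a..b})"
    using p by (intro compact_imp_bounded compact_continuous_image continuous_on_polymonial_function)
      (auto simp: real_polynomial_function_eq)
  then obtain P where P: "\<And>x. x \<in> {a..b} \<Longrightarrow> \<bar>p x\<bar> \<le> P" unfolding bounded_iff by (metis imageI real_norm_def)
  have P0: "P \<ge> 0" using P[of a] ab by auto
  define K where "K = fact (k + 2) / c ^ (k + 2)"
  have K: "K \<ge> 0" using c by (simp add: K_def)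
  have main: "\<bar>bump a b c p k x\<bar> \<le> P * K * ((x - a) * (b - x))\<^sup>2" for x
  proof (cases "a < x \<and> x < b")
    case True
    let ?w = "(x - a) * (b - x)"
    have w: "?w > 0" using True by simp
    have "\<bar>bump a b c p k x\<bar> = \<bar>p x\<bar> * (exp (- c / ?w) / ?w ^ k)"
      unfolding bump_def if_P[OF True] abs_mult abs_divide using w by (simp add: abs_of_pos)
    also have "\<dots> \<le> P * (K * ?w\<^sup>2)" unfolding K_def
      by (rule mult_mono[OF P exp_flat_bound[OF c w] P0]) (use True w in auto)
    finally show ?thesis by (simp only: mult.assoc)
  qed (auto simp: bump_def P0 K)
  have cut: "((x - a) * (b - x))\<^sup>2 \<le> (b - a)\<^sup>2 * (x - a)\<^sup>2 \<and> ((x - a) * (b - x))\<^sup>2 \<le> (b - a)\<^sup>2 * (x - b)\<^sup>2"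
    if "a < x" "x < b" for x
  proof -
    have "(b - x)\<^sup>2 \<le> (b - a)\<^sup>2" "(x - a)\<^sup>2 \<le> (b - a)\<^sup>2" using that by (auto intro!: power_mono)

    then have "(x - a)\<^sup>2 * (b - x)\<^sup>2 \<le> (x - a)\<^sup>2 * (b - a)\<^sup>2" "(x - a)\<^sup>2 * (b - x)\<^sup>2 \<le> (b - a)\<^sup>2 * (b - x)\<^sup>2"
      by (auto intro!: mult_left_mono mult_right_mono)
    then show ?thesis unfolding power_mult_distrib power2_commute[of x b]
      by (simp add: mult.commute)
  qed
  have "\<bar>bump a b c p k x\<bar> \<le> P * K * (b - a)\<^sup>2 * (x - a)\<^sup>2 \<and> \<bar>bump a b c p k x\<bar> \<le> P * K * (b - a)\<^sup>2 * (x - b)\<^sup>2" for x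
  proof (cases "a < x \<and> x < b")
    case True
    have PK: "P * K \<ge> 0" using P0 K by simp
    show ?thesis using main[of x] mult_left_mono[OF conjunct1[OF cut] PK, of x] mult_left_mono[OF conjunct2[OF cut] PK, of x] True
      by (simp only: mult.assoc) (meson order_trans)
  qed (auto simp: bump_def P0 K)
  then show ?thesis using that by blast
qed

text \<open>The bound at \<open>a\<close> itself forces f to vanish there, and then the difference
  quotient is at most C |y - a|.\<close>

lemma DERIV_0_of_quadratic_bound:
  fixes f :: "real \<Rightarrow> real"
  assumes "\<And>x. \<bar>f x\<bar> \<le> C * (x - a)\<^sup>2"
  shows "(f has_real_derivative 0) (at a)"
  unfolding has_field_derivative_iff
proof (rule Lim_null_comparison)
  have fa: "f a = 0" using assms[of a] by simp
  show "\<forall>\<^sub>F y in at a. norm ((f y - f a) / (y - a)) \<le> C * \<bar>y - a\<bar>"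
    unfolding eventually_at_filter
  proof (rule always_eventually, intro allI impI)
    fix y assume "y \<noteq> a"
    then have "\<bar>y - a\<bar> > 0" by simp
    then show "norm ((f y - f a) / (y - a)) \<le> C * \<bar>y - a\<bar>"
      using assms[of y] by (simp add: fa abs_divide divide_le_eq power2_eq_square[of "\<bar>y - a\<bar>", symmetric] mult.assoc)
        (simp add: power2_eq_square mult.assoc)
  qed
  have "((\<lambda>y. C * \<bar>y - a\<bar>) \<longlongrightarrow> C * \<bar>a - a\<bar>) (at a)"
    by (intro tendsto_intros)
  then show "((\<lambda>y. C * \<bar>y - a\<bar>) \<longlongrightarrow> 0) (at a)" by simp
qed

lemma bump_has_derivative:
  assumes ab: "a < b" and c: "c > 0" and p: "real_polynomial_function p"
  shows "\<exists>q. real_polynomial_function q \<and>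
    (\<forall>x. (bump a b c p k has_real_derivative bump a b c q (k + 2) x) (at x))"
proof -
  obtain p' where p': "real_polynomial_function p'" "\<And>x. (p has_real_derivative p' x) (at x)"
    using has_real_derivative_polynomial_function[OF p] by blast
  define w where "w = (\<lambda>x. (x - a) * (b - x))"
  define w' where "w' = (\<lambda>x. a + b - 2 * x)"
  \<comment> \<open>Differentiating p w^(-k) exp(-c/w) and taking out w^(-k-2) exp(-c/w) leaves this
    polynomial.\<close>
  define q where "q = (\<lambda>x. p' x * (w x)\<^sup>2 - real k * (p x * (w' x * w x)) + c * (p x * w' x))"
  have lin: "real_polynomial_function (\<lambda>x::real. x)"
    by (rule real_polynomial_function.intros(1)[OF bounded_linear_ident])
  have wp: "real_polynomial_function w" "real_polynomial_function w'"
    unfolding w_def w'_def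
    by (intro real_polynomial_function.intros(4) real_polynomial_function_diff real_polynomial_function.intros(3)
        real_polynomial_function.intros(2) lin)+
  have q: "real_polynomial_function q" unfolding q_def
    by (intro real_polynomial_function.intros(4) real_polynomial_function_diff real_polynomial_function.intros(3)
        real_polynomial_function.intros(2) real_polynomial_function_power wp p p')
  have "(bump a b c p k has_real_derivative bump a b c q (k + 2) x) (at x)" for x
  proof -
    consider "x < a" | "x > b" | "a < x" "x < b" | "x = a" | "x = b" by linarith
    then show ?thesis
    proof cases
      case 1
      have "(bump a b c p k has_real_derivative 0) (at x)"
        by (rule has_field_derivative_transform_within_open[where S="{..<a}" and f="\<lambda>_. 0"])
           (use 1 in \<open>auto simp: bump_def\<close>)
      then show ?thesis using 1 by (simp add: bump_def)
    next
      case 2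
      have "(bump a b c p k has_real_derivative 0) (at x)"
        by (rule has_field_derivative_transform_within_open[where S="{b<..}" and f="\<lambda>_. 0"])
           (use 2 in \<open>auto simp: bump_def\<close>)
      then show ?thesis using 2 by (simp add: bump_def)
    next
      case 3
      have w: "w x > 0" using 3 by (simp add: w_def)
      have dw: "(w has_real_derivative w' x) (at x)" unfolding w_def w'_def
        by (auto intro!: derivative_eq_intros simp: algebra_simps)
      have e: "exp (- c / w x) = exp (- (c / w x))" by simp
      have "((\<lambda>x. p x / w x ^ k * exp (- c / w x)) has_real_derivative
          q x / w x ^ (k + 2) * exp (- c / w x)) (at x)"
      \<comment> \<open>The power rule contains k - 1 in natural numbers, so k = 0 is treated
        apart.\<close>
      proof (cases k)
        case 0
        show ?thesis unfolding 0 q_def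
          by (rule derivative_eq_intros refl p'(2) dw | use w in force)+
             (use w in \<open>simp add: field_simps power2_eq_square\<close>)
      next
        case (Suc m)
        show ?thesis unfolding Suc q_def
          by (rule derivative_eq_intros refl p'(2) dw | use w in force)+
             (use w in \<open>simp add: field_simps power2_eq_square\<close>)
      qed
      then have "(bump a b c p k has_real_derivative q x / w x ^ (k + 2) * exp (- c / w x)) (at x)"
        by (rule has_field_derivative_transform_within_open[where S="{a<..<b}"])
           (use 3 in \<open>auto simp: bump_def w_def\<close>)
      then show ?thesis using 3 by (simp add: bump_def w_def)
    next
      case 4
      obtain C where "\<And>x. \<bar>bump a b c p k x\<bar> \<le> C * (x - a)\<^sup>2" by (rule bump_flat_bound[OF assms]) blast
      from DERIV_0_of_quadratic_bound[OF this] show ?thesis unfolding 4 by (simp add: bump_def[of _ _ _ q])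
    next
      case 5
      obtain C where "\<And>x. \<bar>bump a b c p k x\<bar> \<le> C * (x - b)\<^sup>2" by (rule bump_flat_bound[OF assms]) blast
      from DERIV_0_of_quadratic_bound[OF this] show ?thesis unfolding 5 by (simp add: bump_def[of _ _ _ q])
    qed
  qed
  with q show ?thesis by blast
qed

text \<open>A class of functions closed under differentiation consists of smooth functions, so no
  formula for higher derivatives is required.\<close>

lemma iterated_deriv_differentiable:
  fixes S :: "(real \<Rightarrow> real) set"
  assumes S: "\<And>f. f \<in> S \<Longrightarrow> \<exists>f'\<in>S. \<forall>x. (f has_real_derivative f' x) (at x)" and f: "f \<in> S"
  shows "(deriv ^^ n) f differentiable_on UNIV"
proof -
  have "(deriv ^^ n) f \<in> S"
  proof (induction n)
    case (Suc n)
    obtain f' where f': "f' \<in> S" "\<forall>x. ((deriv ^^ n) f has_real_derivative f' x) (at x)"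
      using S[OF Suc] by blast
    then have "deriv ((deriv ^^ n) f) = f'" by (intro ext DERIV_imp_deriv) simp
    then show ?case using f' by simp
  qed (simp add: f)
  then obtain f' where "\<forall>x. ((deriv ^^ n) f has_real_derivative f' x) (at x)"
    using S by meson
  then have "(deriv ^^ n) f differentiable (at x)" for x
    using real_differentiable_def by blast
  then show ?thesis by (simp add: differentiable_on_def)
qed

text \<open>Two bumps are needed because a test function with mean zero is obtained by subtracting a multiple
  of a fixed bump.\<close>

definition bump2 :: "real \<Rightarrow> real \<Rightarrow> real \<Rightarrow> real \<Rightarrow> real \<Rightarrow> real \<Rightarrow> (real \<Rightarrow> real) set" where
  "bump2 a b c a' b' c' = {\<lambda>x. bump a b c p k x + bump a' b' c' q m x | p k q m.
     real_polynomial_function p \<and> real_polynomial_function q}"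

lemma bump2_deriv:
  assumes "a < b" "c > 0" "a' < b'" "c' > 0" and f: "f \<in> bump2 a b c a' b' c'"
  shows "\<exists>f'\<in>bump2 a b c a' b' c'. \<forall>x. (f has_real_derivative f' x) (at x)"
proof -
  obtain p k q m where pq: "real_polynomial_function p" "real_polynomial_function q"
    and f: "f = (\<lambda>x. bump a b c p k x + bump a' b' c' q m x)" using f by (auto simp: bump2_def)
  obtain p' where p': "real_polynomial_function p'"
    "\<And>x. (bump a b c p k has_real_derivative bump a b c p' (k + 2) x) (at x)"
    using bump_has_derivative[OF assms(1,2) pq(1)] by blast
  obtain q' where q': "real_polynomial_function q'"
    "\<And>x. (bump a' b' c' q m has_real_derivative bump a' b' c' q' (m + 2) x) (at x)"
    using bump_has_derivative[OF assms(3,4) pq(2)] by blast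
  show ?thesis
  proof (intro bexI allI)
    show "(f has_real_derivative bump a b c p' (k + 2) x + bump a' b' c' q' (m + 2) x) (at x)" for x
      unfolding f by (intro DERIV_add p' q')
    show "(\<lambda>x. bump a b c p' (k + 2) x + bump a' b' c' q' (m + 2) x) \<in> bump2 a b c a' b' c'"
      unfolding bump2_def using p'(1) q'(1) by blast
  qed
qed

lemma support_subset:
  fixes f :: "real \<Rightarrow> real"
  assumes "0 < a" "b < L" "\<And>x. x \<notin> {a..b} \<Longrightarrow> f x = 0"
  shows "closure {x. f x \<noteq> 0} \<subseteq> {0<..<L}"
proof -
  have "closure {x. f x \<noteq> 0} \<subseteq> {a..b}"
    by (rule closure_minimal) (use assms(3) in \<open>blast, simp\<close>)
  then show ?thesis using assms(1,2) by force
qed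

lemma real_polynomial_function_zero: "real_polynomial_function (\<lambda>x. 0)"
  by (rule real_polynomial_function.intros(2))

lemma bump_test_function:
  assumes "0 < a" "a < b" "b < L" "c > 0" "real_polynomial_function p"
  shows "test_function L (bump a b c p k)"
proof -
  \<comment> \<open>A second bump with zero numerator places a single bump in the class of sums of
    two.\<close>
  have "(\<lambda>x. bump a b c p k x + bump a b c (\<lambda>_. 0) k x) \<in> bump2 a b c a b c"
    unfolding bump2_def using assms(5) real_polynomial_function_zero by blast
  moreover have "(\<lambda>x. bump a b c p k x + bump a b c (\<lambda>_. 0) k x) = bump a b c p k"
    by (auto simp: bump_def)
  ultimately have "bump a b c p k \<in> bump2 a b c a b c" by simp
  then have "\<forall>n. (deriv ^^ n) (bump a b c p k) differentiable_on UNIV"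
    using iterated_deriv_differentiable[OF bump2_deriv] assms by blast
  moreover have "closure {x. bump a b c p k x \<noteq> 0} \<subseteq> {0<..<L}"
    by (rule support_subset) (use assms in \<open>auto simp: bump_def\<close>)
  ultimately show ?thesis by (simp add: test_function_def)
qed

lemma test_functionD:
  assumes "test_function L \<phi>"
  shows "(\<phi> has_real_derivative deriv \<phi> x) (at x)" "continuous_on S (deriv \<phi>)" "continuous_on S \<phi>"
    "x \<notin> {0<..<L} \<Longrightarrow> \<phi> x = 0"
proof -
  have d: "(deriv ^^ n) \<phi> differentiable_on UNIV" for n using assms by (simp add: test_function_def)
  have "\<phi> differentiable (at x)" using d[of 0] by (simp add: differentiable_on_def)
  then show "(\<phi> has_real_derivative deriv \<phi> x) (at x)"
    using DERIV_deriv_iff_real_differentiable by blast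
  show "continuous_on S (deriv \<phi>)"
    using differentiable_imp_continuous_on[OF d[of 1]] continuous_on_subset by fastforce
  show "continuous_on S \<phi>"
    using differentiable_imp_continuous_on[OF d[of 0]] continuous_on_subset by fastforce
  show "\<phi> x = 0" if "x \<notin> {0<..<L}"
    using assms that closure_subset[of "{x. \<phi> x \<noteq> 0}"] unfolding test_function_def by blast
qed

section \<open>The fundamental lemma of the calculus of variations and the du Bois-Reymond
  lemma\<close>

lemma L2_of_real_poly: "real_polynomial_function p \<Longrightarrow> (\<lambda>x. complex_of_real (p x)) \<in> L2 L"
  by (intro L2_continuous continuous_on_of_real continuous_on_polymonial_function)
     (simp add: real_polynomial_function_eq)

text \<open>Bumps with numerator p converge to p in L^2, so orthogonality passes to real
  polynomials, then to complex ones by real and imaginary parts, and by density to k itself, whose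
  norm is therefore 0. Testing only with the explicit bumps is essential for du Bois-Reymond, where
  antiderivatives are constructed for that class.\<close>

lemma fundamental_lemma:
  assumes L: "L > 0" and k: "k \<in> L2 L"
    and z: "\<And>a b c p. 0 < a \<Longrightarrow> a < b \<Longrightarrow> b < L \<Longrightarrow> c > 0 \<Longrightarrow> real_polynomial_function p \<Longrightarrow>
      (LINT x|intv L. k x * of_real (bump a b c p 0 x)) = 0"
  shows "AE x in intv L. k x = 0"
proof -
  have real: "cip L k (\<lambda>x. of_real (p x)) = 0" if p: "real_polynomial_function p" for p
  proof -
    \<comment> \<open>The shift by 3 keeps 2 d below L already at n = 0, so every support interval
      is nondegenerate.\<close>
    define d where "d = (\<lambda>n. L / real (n + 3))"
    \<comment> \<open>As the support exhausts the interval and \<open>c\<close> tends to 0, the factor \<open>exp (- c / w)\<close> tends to 1.\<close>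
    define \<phi> where "\<phi> = (\<lambda>n. bump (d n) (L - d n) (inverse (real (Suc n))) p 0)"
    have d: "0 < d n" "d n < L - d n" for n
    proof -
      show "0 < d n" using L by (simp add: d_def)
      have "2 * L < L * real (n + 3)" using L by simp
      then have "2 * (L / real (n + 3)) < L" by (simp add: pos_divide_less_eq)
      then show "d n < L - d n" by (simp add: d_def)
    qed
    have d0: "d \<longlonglongrightarrow> 0" unfolding d_def
      using LIMSEQ_ignore_initial_segment[OF lim_const_over_n[of L], of 3] by simp
    have t: "test_function L (\<phi> n)" for n unfolding \<phi>_def
      by (rule bump_test_function) (use d[of n] p in auto)
    have cL: "(\<lambda>x. complex_of_real (\<phi> n x)) \<in> L2 L" for n
      by (rule L2_continuous) (intro continuous_intros test_functionD(3)[OF t])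
    note pL = L2_of_real_poly[OF p, of L]
    have lim: "(\<lambda>n. nm L (\<lambda>x. of_real (\<phi> n x) - of_real (p x))) \<longlonglongrightarrow> 0"
    proof (rule nm_tendsto_0_bounded[where w="\<lambda>x. of_real (p x)"])
      show "(\<lambda>x. complex_of_real (\<phi> n x) - complex_of_real (p x)) \<in> borel_measurable (intv L)" for n
        by (rule L2D(1)) (rule L2_diff[OF cL pL])
      show "AE x in intv L. (\<lambda>n. complex_of_real (\<phi> n x) - complex_of_real (p x)) \<longlonglongrightarrow> 0"
      proof (rule AE_I2)
        fix x assume "x \<in> space (intv L)"
        then have x: "0 < x" "x < L" by auto
        have ev: "\<forall>\<^sub>F n in sequentially. d n < x" "\<forall>\<^sub>F n in sequentially. d n < L - x"
          by (rule order_tendstoD(2)[OF d0], use x in simp)+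
        have ev2: "\<forall>\<^sub>F n in sequentially. p x * exp (- inverse (real (Suc n)) / ((x - d n) * (L - d n - x))) = \<phi> n x"
          using ev by eventually_elim (simp add: \<phi>_def bump_def)
        have "(\<lambda>n. - inverse (real (Suc n)) / ((x - d n) * (L - d n - x))) \<longlonglongrightarrow> - 0 / ((x - 0) * (L - 0 - x))"
          by (intro tendsto_divide tendsto_minus tendsto_mult tendsto_diff tendsto_const d0 LIMSEQ_inverse_real_of_nat)
             (use x in simp)
        then have "(\<lambda>n. p x * exp (- inverse (real (Suc n)) / ((x - d n) * (L - d n - x)))) \<longlonglongrightarrow> p x * exp 0"
          by (intro tendsto_mult tendsto_const tendsto_exp) simp
        then have "(\<lambda>n. \<phi> n x) \<longlonglongrightarrow> p x * exp 0"
          by (rule Lim_transform_eventually[OF _ ev2])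
        then have "(\<lambda>n. complex_of_real (\<phi> n x) - complex_of_real (p x)) \<longlonglongrightarrow> complex_of_real (p x * exp 0) - complex_of_real (p x)"
          by (intro tendsto_diff tendsto_const tendsto_of_real)
        then show "(\<lambda>n. complex_of_real (\<phi> n x) - complex_of_real (p x)) \<longlonglongrightarrow> 0" by simp
      qed
      show "AE x in intv L. cmod (complex_of_real (\<phi> n x) - complex_of_real (p x)) \<le> cmod (complex_of_real (p x))" for n
      proof (rule AE_I2)
        fix x
        have *: "cmod (complex_of_real (p x * r) - complex_of_real (p x)) \<le> cmod (complex_of_real (p x))" if "0 \<le> r" "r \<le> 1" for r
        proof -
          have "complex_of_real (p x * r) - complex_of_real (p x) = of_real (p x * (r - 1))"
            by (simp add: algebra_simps)
          then have "cmod (complex_of_real (p x * r) - complex_of_real (p x)) = \<bar>p x\<bar> * \<bar>r - 1\<bar>"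
            by (simp only: norm_of_real abs_mult)
          also have "\<dots> \<le> \<bar>p x\<bar> * 1" by (rule mult_left_mono) (use that in auto)
          finally show ?thesis by simp
        qed
        show "cmod (complex_of_real (\<phi> n x) - complex_of_real (p x)) \<le> cmod (complex_of_real (p x))"
        proof (cases "d n < x \<and> x < L - d n")
          case True
          then have "0 < (x - d n) * (L - d n - x)" by simp
          then have "exp (- inverse (real (Suc n)) / ((x - d n) * (L - d n - x))) \<le> 1"
            by (simp add: divide_nonpos_pos del: mult_pos_pos)
          then show ?thesis using *[of "exp (- inverse (real (Suc n)) / ((x - d n) * (L - d n - x)))"] True
            by (simp add: \<phi>_def bump_def del: of_real_mult)
        next
          case False
          then have "\<phi> n x = 0" unfolding \<phi>_def bump_def by (rule if_not_P)
          then show ?thesis by simp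
        qed
      qed
    qed (rule pL)
    have "(\<lambda>n. cip L k (\<lambda>x. of_real (\<phi> n x))) \<longlonglongrightarrow> cip L k (\<lambda>x. of_real (p x))"
      by (rule cip_tendsto[OF k k _ cL pL lim]) (simp add: nm_def ip_self)
    moreover have "cip L k (\<lambda>x. of_real (\<phi> n x)) = 0" for n
      unfolding cip_def \<phi>_def complex_cnj_complex_of_real
      by (rule z) (use d[of n] p in auto)
    ultimately show ?thesis by (simp add: LIMSEQ_const_iff)
  qed
  have poly: "cip L p k = 0" if p: "polynomial_function p" for p :: "real \<Rightarrow> complex"
  proof -
    have r: "real_polynomial_function (\<lambda>x. Re (p x))" "real_polynomial_function (\<lambda>x. Im (p x))"
      using p bounded_linear_Re bounded_linear_Im unfolding polynomial_function_def o_def by blast+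
    have l: "(\<lambda>x. complex_of_real (Re (p x))) \<in> L2 L" "(\<lambda>x. complex_of_real (Im (p x))) \<in> L2 L"
      by (rule L2_of_real_poly[OF r(1)], rule L2_of_real_poly[OF r(2)])
    have "cip L p k = cip L (\<lambda>x. of_real (Re (p x)) + \<i> * of_real (Im (p x))) k"
      by (simp only: complex_eq[symmetric])
    also have "\<dots> = cip L (\<lambda>x. of_real (Re (p x))) k + \<i> * cip L (\<lambda>x. of_real (Im (p x))) k"
      using l k by (simp add: cip_add_left L2_scale cip_scale_left)
    also have "\<dots> = 0"
      using real[OF r(1)] real[OF r(2)] by (subst (1 2) cip_commute) simp
    finally show ?thesis .
  qed
  obtain p :: "nat \<Rightarrow> real \<Rightarrow> complex" where p: "\<And>n. polynomial_function (p n)"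
    and plim: "(\<lambda>n. nm L (\<lambda>x. p n x - k x)) \<longlonglongrightarrow> 0"
    using L2_poly_sequence[OF L k] by metis
  have "(\<lambda>n. cip L (p n) k) \<longlonglongrightarrow> cip L k k"
    by (rule cip_tendsto[OF poly_L2[OF p] k plim k k]) (simp add: nm_def ip_self)
  then have "cip L k k = 0" by (simp add: poly[OF p] LIMSEQ_const_iff)
  then have "nm L k = 0" by (simp add: nm_def ip_def)
  then show ?thesis by (rule nm_eq_0_imp_AE[OF k])
qed

text \<open>The antiderivative is the integral from 0. For each x the window of radius |x| + 1 has
  both 0 and x in its interior, so the derivative within the window is a two-sided one.\<close>

lemma ex_antiderivative:
  fixes h :: "real \<Rightarrow> real"
  assumes "continuous_on UNIV h"
  shows "\<exists>F. \<forall>x. (F has_real_derivative h x) (at x)"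
proof (intro exI allI)
  fix x :: real
  have "((\<lambda>u. LBINT y=0..u. h y) has_vector_derivative h x) (at x within {- (\<bar>x\<bar> + 1)..\<bar>x\<bar> + 1})"
    using interval_integral_FTC2[where a="- (\<bar>x\<bar> + 1)" and b="\<bar>x\<bar> + 1" and c=0 and f=h and x=x]
      continuous_on_subset[OF assms] by (simp add: zero_ereal_def)
  moreover have "at x within {- (\<bar>x\<bar> + 1)..\<bar>x\<bar> + 1} = at x"
    by (rule at_within_Icc_at) auto
  ultimately show "((\<lambda>u. LBINT y=0..u. h y) has_real_derivative h x) (at x)"
    by (simp add: has_real_derivative_iff_has_vector_derivative)
qed

text \<open>An antiderivative is constant on each side of the supports, and mean zero makes the two
  constants agree; subtracting their common value gives compact support.\<close>

lemma bump_pair_antiderivative: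
  assumes ab: "0 < a" "a < b" "b < L" "c > 0" and ab': "0 < a'" "a' < b'" "b' < L" "c' > 0"
    and pq: "real_polynomial_function p" "real_polynomial_function q"
    and h: "h = (\<lambda>x. bump a b c p 0 x + bump a' b' c' q 0 x)" and z: "integral {0..L} h = 0"
  shows "\<exists>\<phi>. test_function L \<phi> \<and> (\<forall>x. deriv \<phi> x = h x)"
proof -
  have hB: "h \<in> bump2 a b c a' b' c'" unfolding h bump2_def using pq by blast
  have B: "\<exists>f'\<in>bump2 a b c a' b' c'. \<forall>x. (f has_real_derivative f' x) (at x)" if "f \<in> bump2 a b c a' b' c'" for f
    by (rule bump2_deriv[OF ab(2,4) ab'(2,4) that])
  have "continuous_on UNIV h" using B[OF hB] by (meson DERIV_isCont continuous_at_imp_continuous_on)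
  then obtain F where F: "\<And>x. (F has_real_derivative h x) (at x)" using ex_antiderivative by blast
  define m where "m = min a a'"
  define M where "M = max b b'"
  have mM: "0 < m" "M < L" "m < M" using ab ab' by (auto simp: m_def M_def)
  have h0: "h x = 0" if "x \<le> m \<or> x \<ge> M" for x
    using that ab ab' by (auto simp: h bump_def m_def M_def)
  have const: "F v = F u" if "u < v" "v \<le> m \<or> u \<ge> M" for u v
  proof -
    obtain z where z: "u < z" "z < v" "F v - F u = (v - u) * h z"
      using MVT2[OF \<open>u < v\<close> F] by blast
    then have "h z = 0" using h0[of z] that(2) by linarith
    then show ?thesis using z by simp
  qed
  have "(h has_integral (F L - F 0)) {0..L}"
    by (rule fundamental_theorem_of_calculus)
       (use mM F in \<open>auto simp: has_real_derivative_iff_has_vector_derivative intro: has_vector_derivative_at_within\<close>)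
  then have FL: "F L = F 0" using z by (simp add: integral_unique)
  define \<phi> where "\<phi> = (\<lambda>x. F x - F 0)"
  have d\<phi>: "(\<phi> has_real_derivative h x) (at x)" for x
    unfolding \<phi>_def using DERIV_diff[OF F DERIV_const] by simp
  have zero: "\<phi> x = 0" if "x \<notin> {m..M}" for x
  proof -
    have "x < m \<or> x > M" using that by auto
    then consider "x < m" | "x > M" by blast
    then show ?thesis
    proof cases
      case 1
      have "F x = F 0"
      proof (cases x "0::real" rule: linorder_cases)
        case less then show ?thesis using const[OF less] mM by simp
      next
        case greater then show ?thesis using const[OF greater] 1 by simp
      qed simp
      then show ?thesis by (simp add: \<phi>_def)
    next
      case 2
      have "F x = F L"
      proof (cases x L rule: linorder_cases)
        case less then show ?thesis using const[OF less] 2 by simp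
      next
        case greater then show ?thesis using const[OF greater] mM by simp
      qed simp
      then show ?thesis using FL by (simp add: \<phi>_def)
    qed
  qed
  have "test_function L \<phi>" unfolding test_function_def
  proof
    show "\<forall>n. (deriv ^^ n) \<phi> differentiable_on UNIV"
    proof
      show "(deriv ^^ n) \<phi> differentiable_on UNIV" for n
      \<comment> \<open>Adding one antiderivative of a member keeps the class closed under
        differentiation.\<close>
      proof (rule iterated_deriv_differentiable[where S="insert \<phi> (bump2 a b c a' b' c')"])
        fix f assume "f \<in> insert \<phi> (bump2 a b c a' b' c')"
        then show "\<exists>f'\<in>insert \<phi> (bump2 a b c a' b' c'). \<forall>x. (f has_real_derivative f' x) (at x)"
          using d\<phi> hB B by blast
      qed simp
    qed
    show "closure {x. \<phi> x \<noteq> 0} \<subseteq> {0<..<L}"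
      by (rule support_subset[OF mM(1,2) zero])
  qed
  moreover have "\<forall>x. deriv \<phi> x = h x" using d\<phi> DERIV_imp_deriv by blast
  ultimately show ?thesis by blast
qed

lemma L2_test:
  assumes "test_function L \<phi>"
  shows "(\<lambda>x. complex_of_real (\<phi> x)) \<in> L2 L" "(\<lambda>x. complex_of_real (deriv \<phi> x)) \<in> L2 L"
  by (intro L2_continuous continuous_on_of_real test_functionD[OF assms])+

text \<open>Every bump becomes the derivative of a test function once a multiple of the reference
  bump \<open>\<psi>\<close> is subtracted to make its mean zero. Hence k acts on bumps like a
  constant, namely its average weighted by \<open>\<psi>\<close>, and the fundamental lemma applies
  to the difference.\<close>

theorem du_Bois_Reymond:
  assumes L: "L > 0" and k: "k \<in> L2 L"
    and z: "\<And>\<phi>. test_function L \<phi> \<Longrightarrow> (LINT x|intv L. k x * of_real (deriv \<phi> x)) = 0"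
  shows "\<exists>c. AE x in intv L. k x = c"
proof -
  define \<psi> where "\<psi> = bump (L/3) (2*L/3) 1 (\<lambda>_. 1) 0"
  have pol: "real_polynomial_function (\<lambda>_::real. r)" for r :: real by (rule real_polynomial_function.intros(2))
  have t\<psi>: "test_function L \<psi>" unfolding \<psi>_def
    by (rule bump_test_function) (use L pol in auto)
  define I where "I = integral {0..L} \<psi>"
  have "I \<noteq> 0"
  proof
    assume "I = 0"
    then have "\<forall>x\<in>{0..L}. \<psi> x = 0" unfolding I_def
      by (subst (asm) integral_eq_0_iff) (use L test_functionD(3)[OF t\<psi>] in \<open>auto simp: \<psi>_def bump_def\<close>)
    then have "\<psi> (L/2) = 0" using L by simp
    then show False using L by (simp add: \<psi>_def bump_def)
  qed
  define c where "c = (LINT x|intv L. k x * of_real (\<psi> x)) / of_real I"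
  have "AE x in intv L. k x - c = 0"
  proof (rule fundamental_lemma[OF L L2_diff[OF k L2_const]])
    fix a b e :: real and p :: "real \<Rightarrow> real" assume abe: "0 < a" "a < b" "b < L" "e > 0" and p: "real_polynomial_function p"
    let ?w = "bump a b e p 0"
    have tw: "test_function L ?w" by (rule bump_test_function[OF abe p])
    \<comment> \<open>The ratio of the two integrals, so that the combination h below has mean
      zero.\<close>
    define t where "t = integral {0..L} ?w / I"
    define h where "h = (\<lambda>x. ?w x + bump (L/3) (2*L/3) 1 (\<lambda>_. - t) 0 x)"
    have h_eq: "h = (\<lambda>x. ?w x - t * \<psi> x)" by (auto simp: h_def \<psi>_def bump_def)
    have "integral {0..L} h = integral {0..L} ?w - t * integral {0..L} \<psi>"
      unfolding h_eq by (subst integral_diff)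
        (auto intro!: integrable_continuous_real continuous_intros test_functionD[OF tw] test_functionD[OF t\<psi>])
    then have "integral {0..L} h = 0" using \<open>I \<noteq> 0\<close> by (simp add: t_def I_def)
    then obtain \<phi> where \<phi>: "test_function L \<phi>" "\<And>x. deriv \<phi> x = h x"
      using bump_pair_antiderivative[OF abe _ _ _ _ p pol h_def] L by auto
    have i1: "integrable (intv L) (\<lambda>x. k x * of_real (?w x))" "integrable (intv L) (\<lambda>x. k x * of_real (\<psi> x))"
      by (intro L2_product_integrable k L2_test tw t\<psi>)+
    have i2: "integrable (intv L) (\<lambda>x. complex_of_real (?w x))"
      by (intro L2_integrable L2_test tw)
    have "0 = (LINT x|intv L. k x * of_real (?w x) - of_real t * (k x * of_real (\<psi> x)))"
      using z[OF \<phi>(1)] by (simp add: \<phi>(2) h_eq algebra_simps)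
    also have "\<dots> = (LINT x|intv L. k x * of_real (?w x)) - of_real t * (LINT x|intv L. k x * of_real (\<psi> x))"
      using i1 by simp
    finally have 1: "(LINT x|intv L. k x * of_real (?w x)) = of_real t * (c * of_real I)"
      using \<open>I \<noteq> 0\<close> by (simp add: c_def)
    have "(LINT x|intv L. complex_of_real (?w x)) = integral {0..L} (\<lambda>x. complex_of_real (?w x))"
      by (intro LINT_intv_continuous continuous_on_of_real test_functionD[OF tw])
    also have "\<dots> = of_real (integral {0..L} ?w)"
      using integral_linear[OF integrable_continuous_real[OF test_functionD(3)[OF tw]] bounded_linear_of_real]
      by (simp add: o_def)
    finally have 2: "(LINT x|intv L. complex_of_real (?w x)) = of_real (t * I)"
      using \<open>I \<noteq> 0\<close> by (simp add: t_def)
    have "(LINT x|intv L. (k x - c) * of_real (?w x)) =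
        (LINT x|intv L. k x * of_real (?w x)) - c * (LINT x|intv L. complex_of_real (?w x))"
      using i1 i2 by (simp add: left_diff_distrib)
    then show "(LINT x|intv L. (k x - c) * of_real (?w x)) = 0" unfolding 1 2 by simp
  qed
  then show ?thesis by auto
qed

section \<open>Weak derivatives characterised by antiderivatives\<close>

lemma prim_test:
  assumes L: "L > 0" and t: "test_function L \<phi>" and x: "x \<in> {0..L}"
  shows "prim L 0 (\<lambda>x. of_real (deriv \<phi> x)) x = of_real (\<phi> x)"
proof -
  have "prim L (complex_of_real (\<phi> 0)) (\<lambda>x. of_real (deriv \<phi> x)) x = of_real (\<phi> x)"
  proof (rule prim_of_C1[OF _ _ x, where G="\<lambda>x. complex_of_real (\<phi> x)"])
    show "continuous_on {0..L} (\<lambda>x. complex_of_real (deriv \<phi> x))"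
      by (intro continuous_on_of_real test_functionD[OF t])
    show "((\<lambda>x. complex_of_real (\<phi> x)) has_vector_derivative complex_of_real (deriv \<phi> y)) (at y within {0..L})" for y
      using has_vector_derivative_of_real[of \<phi> "deriv \<phi> y" "at y within {0..L}"]
        has_field_derivative_at_within[OF test_functionD(1)[OF t, of y]]
      by (simp add: has_real_derivative_iff_has_vector_derivative)
  qed
  then show ?thesis using test_functionD(4)[OF t, of 0] by simp
qed

lemma prim_has_weak_deriv:
  assumes L: "L > 0" and g: "g \<in> L2 L"
  shows "has_weak_deriv L (prim L c g) g"
  unfolding has_weak_deriv_def
proof (intro allI impI)
  fix \<phi> assume t: "test_function L \<phi>"
  let ?d = "\<lambda>x. complex_of_real (deriv \<phi> x)"
  \<comment> \<open>The test function is the antiderivative of its derivative starting from d = 0;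
    its vanishing at both ends removes the boundary terms.\<close>
  note one = prim_by_parts[OF L g L2_test(2)[OF t], where w="\<lambda>_. 1" and w'="\<lambda>_. 0" and c=c and d=0]
  have "cip L g (prim L 0 ?d) + cip L (prim L c g) ?d = prim L c g L * cnj (prim L 0 ?d L)"
    using one by (simp add: cip_def)
  also have "\<dots> = 0" using prim_test[OF L t, of L] test_functionD(4)[OF t, of L] L by simp
  finally have "cip L (prim L c g) ?d = - cip L g (prim L 0 ?d)" by (simp add: eq_neg_iff_add_eq_0 add.commute)
  moreover have "cip L g (prim L 0 ?d) = (LINT x|intv L. g x * of_real (\<phi> x))"
    unfolding cip_def by (rule Bochner_Integration.integral_cong) (use prim_test[OF L t] in auto)
  ultimately show "(LINT x|intv L. prim L c g x * of_real (deriv \<phi> x)) = - (LINT x|intv L. g x * of_real (\<phi> x))"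
    by (simp add: cip_def)
qed

lemma has_weak_deriv_cong:
  assumes "f \<in> L2 L" "f' \<in> L2 L" "AE x in intv L. f x = f' x"
  shows "has_weak_deriv L f g \<longleftrightarrow> has_weak_deriv L f' g"
proof -
  have "(LINT x|intv L. f x * of_real (deriv \<phi> x)) = (LINT x|intv L. f' x * of_real (deriv \<phi> x))"
    if "test_function L \<phi>" for \<phi>
    using cip_cong_AE[OF assms(1,2) L2_test(2)[OF that] L2_test(2)[OF that] assms(3)] by (simp add: cip_def)
  then show ?thesis by (simp add: has_weak_deriv_def)
qed

text \<open>The difference of f and the antiderivative of g is annihilated by all derivatives of
  test functions, hence constant. This turns the distributional definition into an explicit formula
  from which values, sums and integrations by parts are read off.\<close>

theorem has_weak_deriv_iff_prim:
  assumes L: "L > 0" and f: "f \<in> L2 L" and g: "g \<in> L2 L"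
  shows "has_weak_deriv L f g \<longleftrightarrow> (\<exists>c. AE x in intv L. f x = prim L c g x)"
proof
  assume w: "has_weak_deriv L f g"
  have "\<exists>c. AE x in intv L. f x - prim L 0 g x = c"
  proof (rule du_Bois_Reymond[OF L L2_diff[OF f prim_L2[OF L g]]])
    fix \<phi> assume t: "test_function L \<phi>"
    have "integrable (intv L) (\<lambda>x. f x * complex_of_real (deriv \<phi> x))"
      "integrable (intv L) (\<lambda>x. prim L 0 g x * complex_of_real (deriv \<phi> x))"
      by (intro L2_product_integrable f prim_L2 L g L2_test t)+
    then show "(LINT x|intv L. (f x - prim L 0 g x) * of_real (deriv \<phi> x)) = 0"
      using w prim_has_weak_deriv[OF L g, of 0] t by (simp add: has_weak_deriv_def left_diff_distrib)
  qed
  then obtain c where "AE x in intv L. f x - prim L 0 g x = c" by blast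
  then have "AE x in intv L. f x = prim L c g x"
    by eventually_elim (simp add: prim_def algebra_simps)
  then show "\<exists>c. AE x in intv L. f x = prim L c g x" by blast
next
  assume "\<exists>c. AE x in intv L. f x = prim L c g x"
  then show "has_weak_deriv L f g"
    using has_weak_deriv_cong[OF f prim_L2[OF L g]] prim_has_weak_deriv[OF L g] by blast
qed

lemma has_weak_deriv_unique:
  assumes L: "L > 0" and g: "g \<in> L2 L" "g' \<in> L2 L" and w: "has_weak_deriv L f g" "has_weak_deriv L f g'"
  shows "AE x in intv L. g x = g' x"
proof -
  have "AE x in intv L. g x - g' x = 0"
  proof (rule fundamental_lemma[OF L L2_diff[OF g]])
    fix a b e :: real and p :: "real \<Rightarrow> real" assume abe: "0 < a" "a < b" "b < L" "e > 0" and p: "real_polynomial_function p"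
    note t = bump_test_function[OF abe p, of 0]
    have "integrable (intv L) (\<lambda>x. g x * complex_of_real (bump a b e p 0 x))"
      "integrable (intv L) (\<lambda>x. g' x * complex_of_real (bump a b e p 0 x))"
      by (intro L2_product_integrable g L2_test t)+
    then show "(LINT x|intv L. (g x - g' x) * of_real (bump a b e p 0 x)) = 0"
      using w t unfolding has_weak_deriv_def by (simp add: left_diff_distrib)
  qed
  then show ?thesis by simp
qed

text \<open>The squared distance is continuous and nonnegative with integral 0, so it vanishes on
  the closed interval, end points included. This is the uniqueness behind the definite description
  in \<open>val\<close>.\<close>

lemma continuous_AE_eq:
  assumes L: "L > 0" and f: "continuous_on {0..L} f" and g: "continuous_on {0..L} g"
    and ae: "AE x in intv L. f x = g x" and x: "x \<in> {0..L}"
  shows "f x = (g x :: complex)"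
proof -
  let ?h = "\<lambda>x. (cmod (f x - g x))\<^sup>2"
  have c: "continuous_on {0..L} (\<lambda>x. f x - g x)" by (intro continuous_intros f g)
  have "nm L (\<lambda>x. f x - g x) = nm L (\<lambda>x. 0)"
    by (rule nm_cong_AE[OF L2_continuous[OF c] L2_const]) (use ae in auto)
  then have "(LINT x|intv L. (cmod (f x - g x))\<^sup>2) = 0" by (simp add: nm_def ip_self)
  then have "integral {0<..<L} ?h = 0"
    using lebesgue_integral_eq_integral[OF L2D(2)[OF L2_continuous[OF c]]] by simp
  then have "integral {0..L} ?h = 0" by (simp add: integral_open_interval_real)
  then have "\<forall>x\<in>{0..L}. ?h x = 0"
    by (subst (asm) integral_eq_0_iff) (use L in \<open>auto intro!: continuous_intros f g\<close>)
  then show ?thesis using x by simp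
qed

lemma val_eq:
  assumes L: "L > 0" and F: "continuous_on {0..L} F" and ae: "AE y in intv L. f y = F y" and x: "x \<in> {0..L}"
  shows "val L f x = F x"
  unfolding val_def
proof (rule the_equality)
  show "\<exists>g. continuous_on {0..L} g \<and> (AE y in intv L. f y = g y) \<and> g x = F x" using F ae by blast
  fix c assume "\<exists>g. continuous_on {0..L} g \<and> (AE y in intv L. f y = g y) \<and> g x = c"
  then obtain g where g: "continuous_on {0..L} g" "AE y in intv L. f y = g y" "g x = c" by blast
  have "AE y in intv L. g y = F y" using ae g(2) by auto
  then show "c = F x" using continuous_AE_eq[OF L g(1) F _ x] g(3) by simp
qed

section \<open>The space \<open>H\<^sup>1\<close>\<close>

lemma H1_L2: "f \<in> H1 L \<Longrightarrow> f \<in> L2 L"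
  by (simp add: H1_def)

lemma H1I: "f \<in> L2 L \<Longrightarrow> g \<in> L2 L \<Longrightarrow> has_weak_deriv L f g \<Longrightarrow> f \<in> H1 L"
  by (auto simp: H1_def)

lemma wd_weak:
  assumes "f \<in> H1 L"
  shows "wd L f \<in> L2 L" "has_weak_deriv L f (wd L f)"
proof -
  have "\<exists>g. g \<in> L2 L \<and> has_weak_deriv L f g" using assms by (auto simp: H1_def)
  from someI_ex[OF this] show "wd L f \<in> L2 L" "has_weak_deriv L f (wd L f)"
    unfolding wd_def by auto
qed

lemma wd_AE_eq:
  assumes "L > 0" "f \<in> L2 L" "g \<in> L2 L" "has_weak_deriv L f g"
  shows "AE x in intv L. wd L f x = g x"
  using has_weak_deriv_unique[OF assms(1) wd_weak(1) assms(3) wd_weak(2) assms(4)] H1I[OF assms(2-4)]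
  by blast

lemma val_prim_eq:
  assumes L: "L > 0" and g: "g \<in> L2 L" and ae: "AE x in intv L. f x = prim L c g x" and x: "x \<in> {0..L}"
  shows "val L f x = prim L c g x"
  by (rule val_eq[OF L prim_continuous[OF L g] ae x])

lemma H1_prim:
  assumes L: "L > 0" and f: "f \<in> H1 L"
  shows "AE x in intv L. f x = prim L (val L f 0) (wd L f) x"
    "x \<in> {0..L} \<Longrightarrow> val L f x = prim L (val L f 0) (wd L f) x"
proof -
  obtain c where c: "AE x in intv L. f x = prim L c (wd L f) x"
    using has_weak_deriv_iff_prim[OF L H1_L2[OF f] wd_weak(1)[OF f]] wd_weak(2)[OF f] by blast
  note v = val_prim_eq[OF L wd_weak(1)[OF f] c]
  have "val L f 0 = c" using v[of 0] L by (simp add: prim_0)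
  with c v show "AE x in intv L. f x = prim L (val L f 0) (wd L f) x"
    "x \<in> {0..L} \<Longrightarrow> val L f x = prim L (val L f 0) (wd L f) x" by auto
qed

text \<open>One representation as an antiderivative gives membership, weak derivative and point
  values together; the algebra of the space rests on it.\<close>

lemma H1_of_prim:
  assumes L: "L > 0" and g: "g \<in> L2 L" and f: "f \<in> L2 L" and ae: "AE x in intv L. f x = prim L c g x"
  shows "f \<in> H1 L" "AE x in intv L. wd L f x = g x" "x \<in> {0..L} \<Longrightarrow> val L f x = prim L c g x"
proof -
  have w: "has_weak_deriv L f g" using has_weak_deriv_iff_prim[OF L f g] ae by blast
  show "f \<in> H1 L" by (rule H1I[OF f g w])
  show "AE x in intv L. wd L f x = g x" by (rule wd_AE_eq[OF L f g w])
  show "x \<in> {0..L} \<Longrightarrow> val L f x = prim L c g x" by (rule val_prim_eq[OF L g ae])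
qed

lemma prim_add:
  "f \<in> L2 L \<Longrightarrow> g \<in> L2 L \<Longrightarrow> prim L (c + d) (\<lambda>x. f x + g x) x = prim L c f x + prim L d g x"
  by (simp add: prim_def cip_add_left indicator_L2)

lemma prim_scale: "prim L (k * c) (\<lambda>x. k * f x) x = k * prim L c f x"
  by (simp add: prim_def cip_scale_left algebra_simps)

lemma H1_add:
  assumes L: "L > 0" and f: "f \<in> H1 L" and g: "g \<in> H1 L"
  shows "(\<lambda>x. f x + g x) \<in> H1 L" "AE x in intv L. wd L (\<lambda>x. f x + g x) x = wd L f x + wd L g x"
    "x \<in> {0..L} \<Longrightarrow> val L (\<lambda>x. f x + g x) x = val L f x + val L g x"
proof -
  have ae: "AE x in intv L. f x + g x = prim L (val L f 0 + val L g 0) (\<lambda>x. wd L f x + wd L g x) x"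
    using H1_prim(1)[OF L f] H1_prim(1)[OF L g]
    by eventually_elim (simp add: prim_add wd_weak f g)
  note * = H1_of_prim[OF L L2_add[OF wd_weak(1)[OF f] wd_weak(1)[OF g]] L2_add[OF H1_L2[OF f] H1_L2[OF g]] ae]
  show "(\<lambda>x. f x + g x) \<in> H1 L" "AE x in intv L. wd L (\<lambda>x. f x + g x) x = wd L f x + wd L g x"
    by (fact *)+
  show "x \<in> {0..L} \<Longrightarrow> val L (\<lambda>x. f x + g x) x = val L f x + val L g x"
    using *(3)[of x] H1_prim(2)[OF L f, of x] H1_prim(2)[OF L g, of x] by (simp add: prim_add wd_weak f g)
qed

lemma H1_scale:
  assumes L: "L > 0" and f: "f \<in> H1 L"
  shows "(\<lambda>x. k * f x) \<in> H1 L" "AE x in intv L. wd L (\<lambda>x. k * f x) x = k * wd L f x"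
    "x \<in> {0..L} \<Longrightarrow> val L (\<lambda>x. k * f x) x = k * val L f x"
proof -
  have ae: "AE x in intv L. k * f x = prim L (k * val L f 0) (\<lambda>x. k * wd L f x) x"
    using H1_prim(1)[OF L f] by eventually_elim (simp add: prim_scale)
  note * = H1_of_prim[OF L L2_scale[OF wd_weak(1)[OF f]] L2_scale[OF H1_L2[OF f]] ae]
  show "(\<lambda>x. k * f x) \<in> H1 L" "AE x in intv L. wd L (\<lambda>x. k * f x) x = k * wd L f x"
    by (fact *)+
  show "x \<in> {0..L} \<Longrightarrow> val L (\<lambda>x. k * f x) x = k * val L f x"
    using *(3)[of x] H1_prim(2)[OF L f, of x] by (simp add: prim_scale)
qed

lemma H1_diff:
  assumes L: "L > 0" and f: "f \<in> H1 L" and g: "g \<in> H1 L"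
  shows "(\<lambda>x. f x - g x) \<in> H1 L" "AE x in intv L. wd L (\<lambda>x. f x - g x) x = wd L f x - wd L g x"
    "x \<in> {0..L} \<Longrightarrow> val L (\<lambda>x. f x - g x) x = val L f x - val L g x"
proof -
  note s = H1_scale[OF L g, where k="-1"] and a = H1_add[OF L f H1_scale(1)[OF L g, where k="-1"]]
  show "(\<lambda>x. f x - g x) \<in> H1 L" using a(1) by simp
  show "val L (\<lambda>x. f x - g x) x = val L f x - val L g x" if "x \<in> {0..L}"
    using a(3)[OF that] s(3)[OF that] by simp
  show "AE x in intv L. wd L (\<lambda>x. f x - g x) x = wd L f x - wd L g x"
    using a(2) s(2) by eventually_elim simp
qed

text \<open>The weak derivatives agree as functions, not merely almost everywhere: \<open>wd\<close>
  chooses from the set of weak derivatives, and that set is the same for both arguments.\<close>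

lemma H1_cong:
  assumes f: "f \<in> H1 L" and f': "f' \<in> L2 L" and ae: "AE x in intv L. f x = f' x"
  shows "f' \<in> H1 L" "wd L f' = wd L f" "val L f' x = val L f x"
proof -
  have w: "has_weak_deriv L f' = has_weak_deriv L f"
    using has_weak_deriv_cong[OF H1_L2[OF f] f' ae] by blast
  show "f' \<in> H1 L" using f f' by (simp add: H1_def w)
  show "wd L f' = wd L f" by (simp add: wd_def w)
  have "(AE y in intv L. f' y = g y) \<longleftrightarrow> (AE y in intv L. f y = g y)" for g
    using ae by (intro eventually_subst) (auto elim!: eventually_mono)
  then show "val L f' x = val L f x" by (simp add: val_def)
qed

lemma H1_C1:
  assumes L: "L > 0" and g: "continuous_on {0..L} g"
    and G: "\<And>x. x \<in> {0..L} \<Longrightarrow> (G has_vector_derivative g x) (at x within {0..L})"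
  shows "G \<in> H1 L" "AE x in intv L. wd L G x = g x" "x \<in> {0..L} \<Longrightarrow> val L G x = G x"
proof -
  have c: "continuous_on {0..L} G"
    using G has_vector_derivative_continuous continuous_on_eq_continuous_within by blast
  have ae: "AE x in intv L. G x = prim L (G 0) g x"
    using prim_of_C1[OF g G] by (intro AE_I2) simp
  note * = H1_of_prim[OF L L2_continuous[OF g] L2_continuous[OF c] ae]
  show "G \<in> H1 L" "AE x in intv L. wd L G x = g x" by (fact *)+
  show "x \<in> {0..L} \<Longrightarrow> val L G x = G x" using *(3) prim_of_C1[OF g G] by simp
qed

text \<open>Cauchy-Schwarz for the antiderivative starting at 0. The pointwise bound at L later
  controls the trace of the potential.\<close>

lemma poincare:
  assumes L: "L > 0" and f: "f \<in> H1 L" and z: "val L f 0 = 0"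
  shows "nm L f \<le> (nm L (\<lambda>_. 1))\<^sup>2 * nm L (wd L f)" "x \<in> {0..L} \<Longrightarrow> cmod (val L f x) \<le> nm L (\<lambda>_. 1) * nm L (wd L f)"
proof -
  have ae: "AE x in intv L. f x = prim L 0 (wd L f) x" using H1_prim(1)[OF L f] z by simp
  have b: "cmod (prim L 0 (wd L f) x) \<le> nm L (\<lambda>_. 1) * nm L (wd L f)" for x
    using prim_diff_bound[OF wd_weak(1)[OF f] L2_const[of 0], of 0 x]
      cip_scale_left[of L 0 "\<lambda>_. 0" "indicator {..<x}"]
    by (simp add: prim_def mult.commute)
  have "nm L f = nm L (prim L 0 (wd L f))"
    by (rule nm_cong_AE[OF H1_L2[OF f] prim_L2[OF L wd_weak(1)[OF f]] ae])
  also have "\<dots> \<le> nm L (\<lambda>_. 1) * nm L (wd L f) * nm L (\<lambda>_. 1)"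
    by (rule nm_mono_bound[OF L2D(1)[OF prim_L2[OF L wd_weak(1)[OF f]]]]) (auto simp: b nm_nonneg)
  finally show "nm L f \<le> (nm L (\<lambda>_. 1))\<^sup>2 * nm L (wd L f)" by (simp add: power2_eq_square mult_ac)
  show "x \<in> {0..L} \<Longrightarrow> cmod (val L f x) \<le> nm L (\<lambda>_. 1) * nm L (wd L f)"
    using H1_prim(2)[OF L f, of x] b[of x] z by simp
qed

lemma H1_by_parts:
  fixes w :: "real \<Rightarrow> real"
  assumes L: "L > 0" and f: "f \<in> H1 L" and g: "g \<in> H1 L"
    and w: "\<And>x. (w has_real_derivative w' x) (at x)" "continuous_on {0..L} w'"
  shows "ip L (\<lambda>x. of_real (w x) * wd L f x) g + ip L (\<lambda>x. of_real (w x) * f x) (wd L g)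
      + ip L (\<lambda>x. of_real (w' x) * f x) g
    = w L * Re (val L f L * cnj (val L g L)) - w 0 * Re (val L f 0 * cnj (val L g 0))"
proof -
  let ?F = "prim L (val L f 0) (wd L f)" and ?G = "prim L (val L g 0) (wd L g)"
  have cw: "continuous_on {0..L} w"
    using w(1) by (meson DERIV_isCont continuous_at_imp_continuous_on)
  note fL = H1_L2[OF f] H1_L2[OF g] wd_weak(1)[OF f] wd_weak(1)[OF g]
  note pL = prim_L2[OF L fL(3)] prim_L2[OF L fL(4)]
  note ae = H1_prim(1)[OF L f] H1_prim(1)[OF L g]
  have 1: "ip L (\<lambda>x. of_real (w x) * wd L f x) g = ip L (\<lambda>x. of_real (w x) * wd L f x) ?G"
    by (rule ip_cong_AE[OF L2_weight[OF cw fL(3)] L2_weight[OF cw fL(3)] fL(2) pL(2) _ ae(2)]) simp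
  have 2: "ip L (\<lambda>x. of_real (w x) * f x) (wd L g) = ip L (\<lambda>x. of_real (w x) * ?F x) (wd L g)"
    by (rule ip_cong_AE[OF L2_weight[OF cw fL(1)] L2_weight[OF cw pL(1)] fL(4) fL(4)]) (use ae(1) in auto)
  have 3: "ip L (\<lambda>x. of_real (w' x) * f x) g = ip L (\<lambda>x. of_real (w' x) * ?F x) ?G"
    by (rule ip_cong_AE[OF L2_weight[OF w(2) fL(1)] L2_weight[OF w(2) pL(1)] fL(2) pL(2) _ ae(2)]) (use ae(1) in auto)
  have "L \<in> {0..L}" using L by simp
  then have "?F L = val L f L" "?G L = val L g L"
    using H1_prim(2)[OF L f] H1_prim(2)[OF L g] by metis+
  then show ?thesis unfolding 1 2 3 unfolding ip_def
    using arg_cong[OF prim_by_parts[OF L fL(3,4) w, of "val L g 0" "val L f 0"], of Re]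
    by (simp add: mult.assoc)
qed

lemma H1_by_parts_1:
  assumes L: "L > 0" and f: "f \<in> H1 L" and g: "g \<in> H1 L"
  shows "ip L (wd L f) g + ip L f (wd L g)
    = Re (val L f L * cnj (val L g L)) - Re (val L f 0 * cnj (val L g 0))"
  using H1_by_parts[OF assms, of "\<lambda>_. 1" "\<lambda>_. 0"] by (simp add: ip_def cip_def)

text \<open>The weight vanishes at 0, so uncontrolled traces at the left end never appear.\<close>

lemma H1_by_parts_x:
  assumes L: "L > 0" and f: "f \<in> H1 L" and g: "g \<in> H1 L"
  shows "ip L (\<lambda>x. of_real x * wd L f x) g + ip L (\<lambda>x. of_real x * f x) (wd L g) + ip L f g
    = L * Re (val L f L * cnj (val L g L))"
  using H1_by_parts[OF assms, of "\<lambda>x. x" "\<lambda>_. 1"] by simp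

section \<open>Bounded forms on the energy space\<close>

definition st_v :: "state \<Rightarrow> real \<Rightarrow> complex" where "st_v U = fst U"
definition st_z :: "state \<Rightarrow> real \<Rightarrow> complex" where "st_z U = fst (snd U)"
definition st_u1 :: "state \<Rightarrow> real \<Rightarrow> complex" where "st_u1 U = fst (snd (snd U))"
definition st_u2 :: "state \<Rightarrow> real \<Rightarrow> complex" where "st_u2 U = fst (snd (snd (snd U)))"
definition st_u3 :: "state \<Rightarrow> real \<Rightarrow> complex" where "st_u3 U = snd (snd (snd (snd U)))"

lemmas comp_defs = st_v_def st_z_def st_u1_def st_u2_def st_u3_def

lemma comp_tuple [simp]:
  "st_v (v, z, u1, u2, u3) = v" "st_z (v, z, u1, u2, u3) = z" "st_u1 (v, z, u1, u2, u3) = u1"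
  "st_u2 (v, z, u1, u2, u3) = u2" "st_u3 (v, z, u1, u2, u3) = u3"
  by (simp_all add: comp_defs)

lemma comp_minus [simp]:
  "st_v (U - V) = (\<lambda>x. st_v U x - st_v V x)" "st_z (U - V) = (\<lambda>x. st_z U x - st_z V x)"
  "st_u1 (U - V) = (\<lambda>x. st_u1 U x - st_u1 V x)" "st_u2 (U - V) = (\<lambda>x. st_u2 U x - st_u2 V x)"
  "st_u3 (U - V) = (\<lambda>x. st_u3 U x - st_u3 V x)"
  by (simp_all add: comp_defs fun_diff_def)

lemma comp_plus [simp]:
  "st_v (U + V) = (\<lambda>x. st_v U x + st_v V x)" "st_z (U + V) = (\<lambda>x. st_z U x + st_z V x)"
  "st_u1 (U + V) = (\<lambda>x. st_u1 U x + st_u1 V x)" "st_u2 (U + V) = (\<lambda>x. st_u2 U x + st_u2 V x)"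
  "st_u3 (U + V) = (\<lambda>x. st_u3 U x + st_u3 V x)"
  by (simp_all add: comp_defs plus_fun_def)

lemma comp_scale [simp]:
  "st_v (scale k U) = (\<lambda>x. k * st_v U x)" "st_z (scale k U) = (\<lambda>x. k * st_z U x)"
  "st_u1 (scale k U) = (\<lambda>x. k * st_u1 U x)" "st_u2 (scale k U) = (\<lambda>x. k * st_u2 U x)"
  "st_u3 (scale k U) = (\<lambda>x. k * st_u3 U x)"
  by (cases U; simp add: comp_defs)+

lemma state_eq_comp: "state_eq L U V \<longleftrightarrow> (AE x in intv L. st_v U x = st_v V x) \<and> (AE x in intv L. st_z U x = st_z V x)
    \<and> (AE x in intv L. st_u1 U x = st_u1 V x) \<and> (AE x in intv L. st_u2 U x = st_u2 V x) \<and> (AE x in intv L. st_u3 U x = st_u3 V x)"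
  by (cases U; cases V; simp add: comp_defs AE_conj_iff)

lemma state_eq_refl [simp]: "state_eq L U U" by (simp add: state_eq_comp)

lemma state_eq_sym: "state_eq L U V \<Longrightarrow> state_eq L V U"
  by (simp add: state_eq_comp eq_commute)

lemma state_eq_AE: "state_eq L U V \<longleftrightarrow> (AE x in intv L. st_v U x = st_v V x \<and> st_z U x = st_z V x
    \<and> st_u1 U x = st_u1 V x \<and> st_u2 U x = st_u2 V x \<and> st_u3 U x = st_u3 V x)"
  by (cases U; cases V) (simp add: comp_defs)

lemma state_eq_trans [trans]:
  assumes "state_eq L U V" "state_eq L V W" shows "state_eq L U W"
  using assms unfolding state_eq_AE by (rule eventually_elim2) simp

lemma state_eq_minus:
  assumes "state_eq L U U'" "state_eq L V V'" shows "state_eq L (U - V) (U' - V')"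
  using assms unfolding state_eq_AE comp_minus by (rule eventually_elim2) simp

lemma state_eq_plus:
  assumes "state_eq L U U'" "state_eq L V V'" shows "state_eq L (U + V) (U' + V')"
  using assms unfolding state_eq_AE comp_plus by (rule eventually_elim2) simp

lemma state_eq_scale:
  assumes "state_eq L U U'" shows "state_eq L (scale k U) (scale k U')"
  using assms unfolding state_eq_AE comp_scale by (rule eventually_mono) simp

lemma state_minus_scale: "U - V = U + scale (-1) V"
  by (cases U; cases V) (auto simp: minus_prod_def plus_prod_def fun_eq_iff)

section \<open>The energy space and its norm\<close>

locale piezo_beam =
  fixes L \<rho> \<alpha> \<gamma> \<xi> \<epsilon>\<^sub>3 \<mu> a :: real
  assumes pos: "L > 0" "\<rho> > 0" "\<alpha> > 0" "\<gamma> > 0" "\<xi> > 0" "\<epsilon>\<^sub>3 > 0" "\<mu> > 0" "a > 0"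
begin

abbreviation X :: "state set" where "X \<equiv> energy_space L \<gamma> \<xi> \<epsilon>\<^sub>3"
abbreviation N :: "state \<Rightarrow> real" where "N \<equiv> energy_norm L \<rho> \<alpha> \<xi> \<epsilon>\<^sub>3 \<mu>"
abbreviation eqv :: "state \<Rightarrow> state \<Rightarrow> bool" where "eqv \<equiv> state_eq L"
abbreviation D :: "state set" where "D \<equiv> op_dom L \<alpha> \<gamma> \<xi> \<epsilon>\<^sub>3"
abbreviation G :: "state \<Rightarrow> state" where "G \<equiv> op_A_damped L \<rho> \<alpha> \<gamma> \<xi> \<epsilon>\<^sub>3 \<mu> a 0 0"

lemma X_iff: "U \<in> X \<longleftrightarrow> st_v U \<in> H1 L \<and> val L (st_v U) 0 = 0 \<and> st_z U \<in> L2 L \<and> st_u1 U \<in> L2 L \<and>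
    st_u2 U \<in> H1 L \<and> val L (st_u2 U) 0 = 0 \<and> val L (st_u2 U) L = 0 \<and> st_u3 U \<in> L2 L \<and>
    (AE x in intv L. of_real \<xi> * wd L (st_u2 U) x - st_u3 U x + of_real (\<gamma> / \<epsilon>\<^sub>3) * wd L (st_v U) x = 0)"
  by (cases U) (simp add: energy_space_def H1_left_def H1_zero_def comp_defs)

lemma X_D:
  assumes "U \<in> X"
  shows "st_v U \<in> H1 L" "val L (st_v U) 0 = 0" "st_v U \<in> L2 L" "wd L (st_v U) \<in> L2 L" "st_z U \<in> L2 L" "st_u1 U \<in> L2 L"
    "st_u2 U \<in> H1 L" "st_u2 U \<in> L2 L" "val L (st_u2 U) 0 = 0" "val L (st_u2 U) L = 0" "st_u3 U \<in> L2 L"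
    "AE x in intv L. of_real \<xi> * wd L (st_u2 U) x - st_u3 U x + of_real (\<gamma> / \<epsilon>\<^sub>3) * wd L (st_v U) x = 0"
  using assms unfolding X_iff by (auto intro: H1_L2 wd_weak)

text \<open>Linearity is demanded only almost everywhere, because \<open>wd\<close> selects
  representatives by choice and is not linear as a map on functions.\<close>

definition bounded_map :: "(state \<Rightarrow> real \<Rightarrow> complex) \<Rightarrow> bool" where
  "bounded_map l \<longleftrightarrow> (\<forall>U\<in>X. l U \<in> L2 L) \<and>
     (\<forall>U\<in>X. \<forall>V\<in>X. AE x in intv L. l (U - V) x = l U x - l V x) \<and>
     (\<forall>U\<in>X. \<forall>k. AE x in intv L. l (scale k U) x = k * l U x) \<and>
     (\<exists>K. \<forall>U\<in>X. nm L (l U) \<le> K * N U)"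

lemma zero_le [simp]: "0 \<in> {0..L}" and L_le [simp]: "L \<in> {0..L}"
  using pos by auto

lemma X_diff: assumes U: "U \<in> X" and V: "V \<in> X" shows "U - V \<in> X"
proof -
  note a = H1_diff[OF pos(1) X_D(1)[OF U] X_D(1)[OF V]] H1_diff[OF pos(1) X_D(7)[OF U] X_D(7)[OF V]]
  have "AE x in intv L. of_real \<xi> * wd L (st_u2 (U - V)) x - st_u3 (U - V) x + of_real (\<gamma> / \<epsilon>\<^sub>3) * wd L (st_v (U - V)) x = 0"
    using a(2) a(5) X_D(12)[OF U] X_D(12)[OF V] proof eventually_elim
    case (elim x)
    have "of_real \<xi> * wd L (st_u2 (U - V)) x - st_u3 (U - V) x + of_real (\<gamma> / \<epsilon>\<^sub>3) * wd L (st_v (U - V)) x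
      = (of_real \<xi> * wd L (st_u2 U) x - st_u3 U x + of_real (\<gamma> / \<epsilon>\<^sub>3) * wd L (st_v U) x)
       - (of_real \<xi> * wd L (st_u2 V) x - st_u3 V x + of_real (\<gamma> / \<epsilon>\<^sub>3) * wd L (st_v V) x)"
      unfolding comp_minus elim(1,2) by (simp add: algebra_simps)
    then show ?case by (simp only: elim(3,4) diff_zero)
  qed
  then show ?thesis unfolding X_iff comp_minus
    using a(1,4) a(3)[OF zero_le] a(6)[OF zero_le] a(6)[OF L_le] X_D[OF U] X_D[OF V] by (simp add: L2_diff)
qed

lemma X_scale: assumes U: "U \<in> X" shows "scale k U \<in> X"
proof -
  note a = H1_scale[OF pos(1) X_D(1)[OF U], where k=k] H1_scale[OF pos(1) X_D(7)[OF U], where k=k]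
  have "AE x in intv L. of_real \<xi> * wd L (st_u2 (scale k U)) x - st_u3 (scale k U) x + of_real (\<gamma> / \<epsilon>\<^sub>3) * wd L (st_v (scale k U)) x = 0"
    using a(2) a(5) X_D(12)[OF U]
  proof eventually_elim
    case (elim x)
    have "of_real \<xi> * wd L (st_u2 (scale k U)) x - st_u3 (scale k U) x + of_real (\<gamma> / \<epsilon>\<^sub>3) * wd L (st_v (scale k U)) x
      = k * (of_real \<xi> * wd L (st_u2 U) x - st_u3 U x + of_real (\<gamma> / \<epsilon>\<^sub>3) * wd L (st_v U) x)"
      unfolding comp_scale elim(1,2) by (simp add: algebra_simps)
    then show ?case using elim(3) by simp
  qed
  then show ?thesis unfolding X_iff comp_scale
    using a(1,4) a(3)[OF zero_le] a(6)[OF zero_le] a(6)[OF L_le] X_D[OF U] by (simp add: L2_scale)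
qed

text \<open>The real part of the energy inner product on the energy space, split into separate
  pairings so that it is visibly a sum of bounded forms.\<close>

definition Q :: "state \<Rightarrow> state \<Rightarrow> real" where
  "Q U V = \<alpha> * ip L (wd L (st_v U)) (wd L (st_v V)) + \<rho> * ip L (st_z U) (st_z V) + \<mu> * ip L (st_u1 U) (st_u1 V)
     + \<xi> * \<epsilon>\<^sub>3 * ip L (st_u2 U) (st_u2 V) + \<epsilon>\<^sub>3 * ip L (st_u3 U) (st_u3 V)"

lemma Q_nonneg: "Q U U \<ge> 0"
  unfolding Q_def using pos by (intro add_nonneg_nonneg mult_nonneg_nonneg ip_self_nonneg) auto

lemma N_eq: assumes U: "U \<in> X" shows "N U = sqrt (Q U U)"
proof -
  note u = X_D[OF U]
  let ?f = "\<lambda>x. of_real \<alpha> * wd L (st_v U) x * cnj (wd L (st_v U) x) + of_real \<rho> * st_z U x * cnj (st_z U x)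
        + of_real \<mu> * st_u1 U x * cnj (st_u1 U x) + of_real (\<xi> * \<epsilon>\<^sub>3) * st_u2 U x * cnj (st_u2 U x)
        + of_real \<epsilon>\<^sub>3 * st_u3 U x * cnj (st_u3 U x)"
  have i: "integrable (intv L) (\<lambda>x. of_real c * f x * cnj (f x))" if "f \<in> L2 L" for f c
    using cip_integrable[OF L2_scale[OF that] that] by simp
  have e: "Re (LINT x|intv L. of_real c * f x * cnj (f x)) = c * ip L f f" if "f \<in> L2 L" for f c
    by (simp add: ip_def cip_def mult.assoc)
  have "energy_inner L \<rho> \<alpha> \<xi> \<epsilon>\<^sub>3 \<mu> U U = (LINT x|intv L. ?f x)"
    by (cases U) (simp add: comp_defs)
  moreover have "Re (LINT x|intv L. ?f x) = Q U U"
    unfolding Q_def e[OF u(4), symmetric] e[OF u(5), symmetric] e[OF u(6), symmetric] e[OF u(8), symmetric] e[OF u(11), symmetric]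
    using i[OF u(4)] i[OF u(5)] i[OF u(6)] i[OF u(8)] i[OF u(11)]
    by (simp only: Bochner_Integration.integral_add Bochner_Integration.integrable_add plus_complex.simps)
  ultimately show ?thesis
    by (simp add: energy_norm_def)
qed

lemma N_sq: "U \<in> X \<Longrightarrow> (N U)\<^sup>2 = Q U U"
  by (simp add: N_eq Q_nonneg)

lemma N_nonneg: "U \<in> X \<Longrightarrow> N U \<ge> 0"
  by (simp add: N_eq Q_nonneg)

lemma N_cong:
  assumes U: "U \<in> X" and V: "V \<in> X" and e: "eqv U V"
  shows "N U = N V"
proof -
  note u = X_D[OF U] and v = X_D[OF V]
  have e: "AE x in intv L. st_v U x = st_v V x" "AE x in intv L. st_z U x = st_z V x"
    "AE x in intv L. st_u1 U x = st_u1 V x" "AE x in intv L. st_u2 U x = st_u2 V x" "AE x in intv L. st_u3 U x = st_u3 V x"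
    using e by (auto simp: state_eq_comp)
  have "wd L (st_v V) = wd L (st_v U)" by (rule H1_cong(2)[OF u(1) v(3) e(1)])
  then have "Q U U = Q V V" unfolding Q_def
    using ip_cong_AE[OF u(5) v(5) u(5) v(5) e(2) e(2)] ip_cong_AE[OF u(6) v(6) u(6) v(6) e(3) e(3)]
      ip_cong_AE[OF u(8) v(8) u(8) v(8) e(4) e(4)] ip_cong_AE[OF u(11) v(11) u(11) v(11) e(5) e(5)]
    by simp
  then show ?thesis using U V by (simp add: N_eq)
qed

section \<open>Bounded linear maps into L^2 and the forms built from them\<close>

lemma bounded_mapI:
  assumes "\<And>U. U \<in> X \<Longrightarrow> l U \<in> L2 L"
    "\<And>U V. U \<in> X \<Longrightarrow> V \<in> X \<Longrightarrow> AE x in intv L. l (U - V) x = l U x - l V x"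
    "\<And>U k. U \<in> X \<Longrightarrow> AE x in intv L. l (scale k U) x = k * l U x"
    "\<And>U. U \<in> X \<Longrightarrow> nm L (l U) \<le> K * N U"
  shows "bounded_map l"
  unfolding bounded_map_def using assms by blast

lemma bounded_map_bound: "bounded_map l \<Longrightarrow> \<exists>K. \<forall>U\<in>X. nm L (l U) \<le> K * N U"
  by (simp add: bounded_map_def)

lemma bounded_map_L2: "bounded_map l \<Longrightarrow> U \<in> X \<Longrightarrow> l U \<in> L2 L"
  by (simp add: bounded_map_def)

lemma nm_le_N:
  assumes c: "c > 0" and U: "U \<in> X" and le: "c * ip L f f \<le> Q U U"
  shows "nm L f \<le> 1 / sqrt c * N U"
proof -
  have "ip L f f \<le> Q U U / c" using c le by (simp add: field_simps)
  then have "nm L f \<le> sqrt (Q U U / c)" unfolding nm_def by (rule real_sqrt_le_mono)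
  then show ?thesis using U by (simp add: N_eq real_sqrt_divide)
qed

lemma Q_terms:
  "\<alpha> * ip L (wd L (st_v U)) (wd L (st_v U)) \<ge> 0" "\<rho> * ip L (st_z U) (st_z U) \<ge> 0" "\<mu> * ip L (st_u1 U) (st_u1 U) \<ge> 0"
  "(\<xi> * \<epsilon>\<^sub>3) * ip L (st_u2 U) (st_u2 U) \<ge> 0" "\<epsilon>\<^sub>3 * ip L (st_u3 U) (st_u3 U) \<ge> 0"
  using pos by (auto intro!: mult_nonneg_nonneg ip_self_nonneg)

lemma nm_comp_le:
  assumes U: "U \<in> X"
  shows "nm L (wd L (st_v U)) \<le> 1 / sqrt \<alpha> * N U" "nm L (st_z U) \<le> 1 / sqrt \<rho> * N U"
    "nm L (st_u1 U) \<le> 1 / sqrt \<mu> * N U" "nm L (st_u2 U) \<le> 1 / sqrt (\<xi> * \<epsilon>\<^sub>3) * N U"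
    "nm L (st_u3 U) \<le> 1 / sqrt \<epsilon>\<^sub>3 * N U"
  using Q_terms[of U] by (intro nm_le_N[OF _ U]; simp only: Q_def pos mult_pos_pos; linarith)+

lemma bounded_map_comp: "bounded_map (\<lambda>U. wd L (st_v U))" "bounded_map st_z" "bounded_map st_u1" "bounded_map st_u2" "bounded_map st_u3"
proof -
  show "bounded_map (\<lambda>U. wd L (st_v U))"
  proof (rule bounded_mapI[OF _ _ _ nm_comp_le(1)])
    show "AE x in intv L. wd L (st_v (U - V)) x = wd L (st_v U) x - wd L (st_v V) x" if "U \<in> X" "V \<in> X" for U V
      unfolding comp_minus by (rule H1_diff(2)[OF pos(1) X_D(1) X_D(1)]) fact+
    show "AE x in intv L. wd L (st_v (scale k U)) x = k * wd L (st_v U) x" if "U \<in> X" for U k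
      unfolding comp_scale by (rule H1_scale(2)[OF pos(1) X_D(1)]) fact
  qed (rule X_D(4))
  show "bounded_map st_z" by (rule bounded_mapI[OF _ _ _ nm_comp_le(2)]) (simp_all add: X_D)
  show "bounded_map st_u1" by (rule bounded_mapI[OF _ _ _ nm_comp_le(3)]) (simp_all add: X_D)
  show "bounded_map st_u2" by (rule bounded_mapI[OF _ _ _ nm_comp_le(4)]) (simp_all add: X_D)
  show "bounded_map st_u3" by (rule bounded_mapI[OF _ _ _ nm_comp_le(5)]) (simp_all add: X_D)
qed

lemma bounded_map_v: "bounded_map st_v"
proof -
  obtain K where K: "\<And>U. U \<in> X \<Longrightarrow> nm L (wd L (st_v U)) \<le> K * N U"
    using bounded_map_bound[OF bounded_map_comp(1)] by blast
  show ?thesis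
  proof (rule bounded_mapI)
    fix U assume U: "U \<in> X"
    have "nm L (st_v U) \<le> (nm L (\<lambda>_. 1))\<^sup>2 * nm L (wd L (st_v U))"
      by (rule poincare(1)[OF pos(1) X_D(1,2)[OF U]])
    also have "\<dots> \<le> (nm L (\<lambda>_. 1))\<^sup>2 * (K * N U)"
      by (rule mult_left_mono[OF K[OF U]]) simp
    finally show "nm L (st_v U) \<le> (nm L (\<lambda>_. 1))\<^sup>2 * K * N U" by (simp only: mult.assoc)
  qed (simp_all add: X_D)
qed

lemma bounded_map_add:
  assumes "bounded_map l" "bounded_map m" shows "bounded_map (\<lambda>U x. l U x + m U x)"
proof -
  obtain K where K: "\<And>U. U \<in> X \<Longrightarrow> nm L (l U) \<le> K * N U" using bounded_map_bound[OF assms(1)] by blast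
  obtain K' where K': "\<And>U. U \<in> X \<Longrightarrow> nm L (m U) \<le> K' * N U" using bounded_map_bound[OF assms(2)] by blast
  show ?thesis
  proof (rule bounded_mapI)
    fix U assume U: "U \<in> X"
    show "(\<lambda>x. l U x + m U x) \<in> L2 L" by (intro L2_add bounded_map_L2[OF assms(1)] bounded_map_L2[OF assms(2)] U)
    show "nm L (\<lambda>x. l U x + m U x) \<le> (K + K') * N U"
      using nm_triangle[OF bounded_map_L2[OF assms(1) U] bounded_map_L2[OF assms(2) U]] K[OF U] K'[OF U]
      by (simp add: distrib_right)
    fix k
    have "AE x in intv L. l (scale k U) x = k * l U x" "AE x in intv L. m (scale k U) x = k * m U x"
      using assms U unfolding bounded_map_def by blast+
    then show "AE x in intv L. l (scale k U) x + m (scale k U) x = k * (l U x + m U x)"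
      by eventually_elim (simp add: distrib_left)
  next
    fix U V assume "U \<in> X" "V \<in> X"
    then have "AE x in intv L. l (U - V) x = l U x - l V x" "AE x in intv L. m (U - V) x = m U x - m V x"
      using assms unfolding bounded_map_def by blast+
    then show "AE x in intv L. l (U - V) x + m (U - V) x = l U x + m U x - (l V x + m V x)"
      by eventually_elim simp
  qed
qed

lemma bounded_map_weight:
  fixes w :: "real \<Rightarrow> real"
  assumes l: "bounded_map l" and w: "continuous_on {0..L} w" shows "bounded_map (\<lambda>U x. of_real (w x) * l U x)"
proof -
  obtain K where K: "\<And>U. U \<in> X \<Longrightarrow> nm L (l U) \<le> K * N U" using bounded_map_bound[OF l] by blast
  have "bounded (w ` {0..L})"
    using w compact_continuous_image compact_imp_bounded by blast
  then obtain B where B: "\<And>x. x \<in> {0..L} \<Longrightarrow> \<bar>w x\<bar> \<le> B"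
    unfolding bounded_iff by (metis imageI real_norm_def)
  have m: "(\<lambda>x. complex_of_real (w x)) \<in> borel_measurable (intv L)"
    by (rule L2D(1), rule L2_continuous) (intro continuous_intros w)
  show ?thesis
  proof (rule bounded_mapI)
    fix U assume U: "U \<in> X"
    show "(\<lambda>x. of_real (w x) * l U x) \<in> L2 L" by (intro L2_weight w bounded_map_L2[OF l] U)
    have "nm L (\<lambda>x. of_real (w x) * l U x) \<le> max B 0 * nm L (l U)"
      by (rule nm_mult_bounded[OF bounded_map_L2[OF l U] m]) (simp_all add: B le_max_iff_disj)
    also have "\<dots> \<le> max B 0 * (K * N U)" by (rule mult_left_mono[OF K[OF U]]) simp
    finally show "nm L (\<lambda>x. of_real (w x) * l U x) \<le> (max B 0 * K) * N U" by (simp only: mult.assoc)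
    fix k
    have "AE x in intv L. l (scale k U) x = k * l U x" using l U unfolding bounded_map_def by blast
    then show "AE x in intv L. of_real (w x) * l (scale k U) x = k * (of_real (w x) * l U x)"
      by eventually_elim simp
  next
    fix U V assume "U \<in> X" "V \<in> X"
    then have "AE x in intv L. l (U - V) x = l U x - l V x" using l unfolding bounded_map_def by blast
    then show "AE x in intv L. of_real (w x) * l (U - V) x = of_real (w x) * l U x - of_real (w x) * l V x"
      by eventually_elim (simp add: right_diff_distrib)
  qed
qed

lemma bounded_map_scale: "bounded_map l \<Longrightarrow> bounded_map (\<lambda>U x. of_real c * l U x)"
  by (rule bounded_map_weight[where w="\<lambda>_. c"]) auto

text \<open>Real homogeneity suffices, since difference quotients in time involve only the real
  factor 1/h. Symmetry is not imposed: the auxiliary forms pair different components.\<close>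

definition bounded_form :: "(state \<Rightarrow> state \<Rightarrow> real) \<Rightarrow> bool" where
  "bounded_form B \<longleftrightarrow> (\<forall>U\<in>X. \<forall>V\<in>X. \<forall>W\<in>X. B (U - V) W = B U W - B V W \<and> B W (U - V) = B W U - B W V) \<and>
     (\<forall>U\<in>X. \<forall>W\<in>X. \<forall>r. B (scale (of_real r) U) W = r * B U W \<and> B W (scale (of_real r) U) = r * B W U) \<and>
     (\<exists>K\<ge>0. \<forall>U\<in>X. \<forall>W\<in>X. \<bar>B U W\<bar> \<le> K * N U * N W)"

lemma bounded_formI:
  assumes "\<And>U V W. U \<in> X \<Longrightarrow> V \<in> X \<Longrightarrow> W \<in> X \<Longrightarrow> B (U - V) W = B U W - B V W"
    "\<And>U V W. U \<in> X \<Longrightarrow> V \<in> X \<Longrightarrow> W \<in> X \<Longrightarrow> B W (U - V) = B W U - B W V"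
    "\<And>U W r. U \<in> X \<Longrightarrow> W \<in> X \<Longrightarrow> B (scale (of_real r) U) W = r * B U W"
    "\<And>U W r. U \<in> X \<Longrightarrow> W \<in> X \<Longrightarrow> B W (scale (of_real r) U) = r * B W U"
    "K \<ge> 0" "\<And>U W. U \<in> X \<Longrightarrow> W \<in> X \<Longrightarrow> \<bar>B U W\<bar> \<le> K * N U * N W"
  shows "bounded_form B"
  unfolding bounded_form_def by (intro conjI ballI allI exI[of _ K]) (simp_all only: assms)

lemma bounded_form_bound: "bounded_form B \<Longrightarrow> \<exists>K\<ge>0. \<forall>U\<in>X. \<forall>W\<in>X. \<bar>B U W\<bar> \<le> K * N U * N W"
  by (simp add: bounded_form_def)

lemma bounded_form_ip:
  assumes l: "bounded_map l" and m: "bounded_map m" shows "bounded_form (\<lambda>U V. ip L (l U) (m V))"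
proof -
  obtain K where K: "\<And>U. U \<in> X \<Longrightarrow> nm L (l U) \<le> K * N U" using bounded_map_bound[OF l] by blast
  obtain K' where K': "\<And>U. U \<in> X \<Longrightarrow> nm L (m U) \<le> K' * N U" using bounded_map_bound[OF m] by blast
  have bd: "\<bar>ip L (l U) (m W)\<bar> \<le> \<bar>K * K'\<bar> * N U * N W" if "U \<in> X" "W \<in> X" for U W
  proof -
    have "\<bar>ip L (l U) (m W)\<bar> \<le> nm L (l U) * nm L (m W)" by (intro ip_bound bounded_map_L2[OF l] bounded_map_L2[OF m] that)
    also have "\<dots> \<le> (K * N U) * (K' * N W)"
      by (intro mult_mono K K' that nm_nonneg order_trans[OF nm_nonneg K])
    also have "\<dots> = (K * K') * (N U * N W)" by (simp add: mult_ac)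
    also have "\<dots> \<le> \<bar>K * K'\<bar> * (N U * N W)"
      by (intro mult_right_mono mult_nonneg_nonneg N_nonneg that) simp
    finally show ?thesis by (simp add: mult.assoc)
  qed
  have ad: "ip L (l (U - V)) (m W) = ip L (l U) (m W) - ip L (l V) (m W)"
    "ip L (l W) (m (U - V)) = ip L (l W) (m U) - ip L (l W) (m V)" if X: "U \<in> X" "V \<in> X" "W \<in> X" for U V W
  proof -
    have "AE x in intv L. l (U - V) x = l U x - l V x" "AE x in intv L. m (U - V) x = m U x - m V x"
      using l m X unfolding bounded_map_def by blast+
    then have "ip L (l (U - V)) (m W) = ip L (\<lambda>x. l U x - l V x) (m W)"
      "ip L (l W) (m (U - V)) = ip L (l W) (\<lambda>x. m U x - m V x)"
      by (auto intro!: ip_cong_AE L2_diff bounded_map_L2[OF l] bounded_map_L2[OF m] X X_diff)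
    then show "ip L (l (U - V)) (m W) = ip L (l U) (m W) - ip L (l V) (m W)"
      "ip L (l W) (m (U - V)) = ip L (l W) (m U) - ip L (l W) (m V)"
      using X l m by (simp_all add: ip_diff_left ip_diff_right bounded_map_L2)
  qed
  have sc: "ip L (l (scale (of_real r) U)) (m W) = r * ip L (l U) (m W)"
    "ip L (l W) (m (scale (of_real r) U)) = r * ip L (l W) (m U)" if X: "U \<in> X" "W \<in> X" for U W r
  proof -
    have "AE x in intv L. l (scale (of_real r) U) x = of_real r * l U x" "AE x in intv L. m (scale (of_real r) U) x = of_real r * m U x"
      using l m X unfolding bounded_map_def by blast+
    then have "ip L (l (scale (of_real r) U)) (m W) = ip L (\<lambda>x. of_real r * l U x) (m W)"
      "ip L (l W) (m (scale (of_real r) U)) = ip L (l W) (\<lambda>x. of_real r * m U x)"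
      by (auto intro!: ip_cong_AE L2_scale bounded_map_L2[OF l] bounded_map_L2[OF m] X X_scale)
    then show "ip L (l (scale (of_real r) U)) (m W) = r * ip L (l U) (m W)"
      "ip L (l W) (m (scale (of_real r) U)) = r * ip L (l W) (m U)"
      by (simp_all add: ip_scale_left ip_scale_right)
  qed
  show ?thesis by (rule bounded_formI[OF ad sc abs_ge_zero bd])
qed

lemma bounded_form_add:
  assumes "bounded_form B" "bounded_form C" shows "bounded_form (\<lambda>U V. B U V + C U V)"
proof -
  obtain K where K: "K \<ge> 0" "\<And>U V. U \<in> X \<Longrightarrow> V \<in> X \<Longrightarrow> \<bar>B U V\<bar> \<le> K * N U * N V"
    using bounded_form_bound[OF assms(1)] by blast
  obtain K' where K': "K' \<ge> 0" "\<And>U V. U \<in> X \<Longrightarrow> V \<in> X \<Longrightarrow> \<bar>C U V\<bar> \<le> K' * N U * N V"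
    using bounded_form_bound[OF assms(2)] by blast
  have "\<bar>B U V + C U V\<bar> \<le> (K + K') * N U * N V" if "U \<in> X" "V \<in> X" for U V
    using K(2)[OF that] K'(2)[OF that] by (simp add: distrib_right)
  moreover have "K + K' \<ge> 0" using K K' by simp
  ultimately have "\<exists>K\<ge>0. \<forall>U\<in>X. \<forall>W\<in>X. \<bar>B U W + C U W\<bar> \<le> K * N U * N W" by blast
  then show ?thesis using assms unfolding bounded_form_def by (simp add: distrib_left)
qed

lemma bounded_form_cmult:
  assumes "bounded_form B" shows "bounded_form (\<lambda>U V. c * B U V)"
proof -
  obtain K where K: "K \<ge> 0" "\<And>U V. U \<in> X \<Longrightarrow> V \<in> X \<Longrightarrow> \<bar>B U V\<bar> \<le> K * N U * N V"
    using bounded_form_bound[OF assms] by blast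
  have "\<bar>c * B U V\<bar> \<le> (\<bar>c\<bar> * K) * N U * N V" if "U \<in> X" "V \<in> X" for U V
    using mult_left_mono[OF K(2)[OF that], of "\<bar>c\<bar>"] by (simp add: abs_mult mult.assoc)
  moreover have "\<bar>c\<bar> * K \<ge> 0" using K by simp
  ultimately have "\<exists>K\<ge>0. \<forall>U\<in>X. \<forall>W\<in>X. \<bar>c * B U W\<bar> \<le> K * N U * N W" by blast
  then show ?thesis using assms unfolding bounded_form_def by (simp add: right_diff_distrib mult.left_commute)
qed

lemma bounded_form_Q: "bounded_form Q"
  unfolding Q_def[abs_def] by (intro bounded_form_add bounded_form_cmult bounded_form_ip bounded_map_comp)

lemma N_diff_self: "U \<in> X \<Longrightarrow> N (U - U) = 0"
proof -
  assume U: "U \<in> X"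
  have "Q (U - U) (U - U) = Q U (U - U) - Q U (U - U)"
    using bounded_form_Q U X_diff[OF U U] unfolding bounded_form_def by blast
  then have "Q (U - U) (U - U) = 0" by linarith
  then show "N (U - U) = 0" using N_eq[OF X_diff[OF U U]] by (simp only: real_sqrt_zero)
qed

lemma N_diff_eqv:
  assumes "U \<in> X" "V \<in> X" "eqv U V" shows "N (U - V) = 0"
proof -
  have "eqv (U - V) (V - V)" using assms by (intro state_eq_minus) auto
  then have "N (U - V) = N (V - V)" using assms by (intro N_cong X_diff)
  then show ?thesis using N_diff_self assms by simp
qed

text \<open>The difference of two equivalent states has norm 0, and the bound then makes the form
  vanish on it. Semigroup laws that hold only modulo \<open>eqv\<close> can thus be substituted into
  forms.\<close>

lemma bounded_form_cong:
  assumes B: "bounded_form B" and U: "U \<in> X" "U' \<in> X" "eqv U U'" and V: "V \<in> X" "V' \<in> X" "eqv V V'"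
  shows "B U V = B U' V'"
proof -
  obtain K where K: "\<And>U V. U \<in> X \<Longrightarrow> V \<in> X \<Longrightarrow> \<bar>B U V\<bar> \<le> K * N U * N V"
    using bounded_form_bound[OF B] by blast
  have "B (U - U') V = 0" using K[OF X_diff[OF U(1,2)] V(1)] N_diff_eqv[OF U] by simp
  moreover have "B U' (V - V') = 0" using K[OF U(2) X_diff[OF V(1,2)]] N_diff_eqv[OF V] by simp
  moreover have "B (U - U') V = B U V - B U' V" "B U' (V - V') = B U' V - B U' V'"
    using B U V unfolding bounded_form_def by blast+
  ultimately show ?thesis by simp
qed

end

section \<open>Decay along the semigroup\<close>

text \<open>The generator only provides right derivatives of the orbits.\<close>

lemma right_derivative_nonpos_imp_le:
  fixes g :: "real \<Rightarrow> real"
  assumes b: "0 \<le> b" and cont: "continuous_on {0..b} g"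
    and deriv: "\<And>t. 0 \<le> t \<Longrightarrow> t < b \<Longrightarrow> \<exists>d\<le>0. (g has_real_derivative d) (at_right t)"
  shows "g b \<le> g 0"
proof -
  \<comment> \<open>The slack e t leaves strict room: a right derivative at most 0 lies below e, so
    the inequality at any time before b survives a little longer.\<close>
  have main: "g b \<le> g 0 + e * b" if e: "e > 0" for e
  proof -
    define S where "S = {t \<in> {0..b}. g t - e * t \<le> g 0}"
    have "closed S" unfolding S_def
    proof -
      have "continuous_on {0..b} (\<lambda>t. g t - e * t)" by (intro continuous_intros cont)
      from continuous_closed_preimage[OF this, of "{..g 0}"]
      show "closed {t \<in> {0..b}. g t - e * t \<le> g 0}" by (simp add: vimage_def Int_def)
    qed
    have bdd: "bdd_above S" unfolding S_def by (auto intro: bdd_aboveI[of _ b])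
    have ne: "0 \<in> S" using b by (simp add: S_def)
    \<comment> \<open>The last time at which the relaxed inequality holds; continuity attains it,
      and s < b would contradict maximality.\<close>
    define s where "s = Sup S"
    have sS: "s \<in> S" unfolding s_def using closed_contains_Sup[OF _ bdd \<open>closed S\<close>] ne by blast
    have "s = b"
    proof (rule ccontr)
      assume "s \<noteq> b"
      then have s: "0 \<le> s" "s < b" using sS by (auto simp: S_def)
      obtain d where d: "d \<le> 0" "(g has_real_derivative d) (at_right s)" using deriv[OF s] by blast
      have "((\<lambda>y. (g y - g s) / (y - s)) \<longlongrightarrow> d) (at_right s)"
        using d(2) by (simp add: has_field_derivative_iff)
      then have "\<forall>\<^sub>F y in at_right s. (g y - g s) / (y - s) < e"
        by (rule order_tendstoD(2)) (use d e in simp)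
      moreover have "\<forall>\<^sub>F y in at_right s. y \<in> {s<..<b}"
        by (rule eventually_at_right_real[OF s(2)])
      ultimately have "\<forall>\<^sub>F y in at_right s. (g y - g s) / (y - s) < e \<and> y \<in> {s<..<b}"
        by (rule eventually_conj)
      then obtain y where y: "(g y - g s) / (y - s) < e" "s < y" "y < b"
        using eventually_happens'[OF trivial_limit_at_right_real] by auto
      then have "g y - g s < e * (y - s)" by (simp add: divide_less_eq)
      then have "g y - e * y \<le> g 0" using sS by (simp add: S_def algebra_simps)
      then have "y \<in> S" using y s by (simp add: S_def)
      then have "y \<le> s" unfolding s_def by (rule cSup_upper[OF _ bdd])
      with y show False by simp
    qed
    then show ?thesis using sS by (simp add: S_def)
  qed
  show ?thesis
  proof (cases "b = 0")
    case False
    show ?thesis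
    proof (rule field_le_epsilon)
      fix e :: real assume "e > 0"
      then show "g b \<le> g 0 + e" using main[of "e / b"] b False by simp
    qed
  qed simp
qed

text \<open>Gronwall's argument: after multiplication by exp(e t) the right derivative is
  nonpositive.\<close>

lemma right_derivative_decay:
  fixes f :: "real \<Rightarrow> real"
  assumes b: "0 \<le> b" and cont: "continuous_on {0..b} f"
    and deriv: "\<And>t. 0 \<le> t \<Longrightarrow> t < b \<Longrightarrow> \<exists>d. d \<le> - e * f t \<and> (f has_real_derivative d) (at_right t)"
  shows "f b \<le> exp (- e * b) * f 0"
proof -
  have "exp (e * b) * f b \<le> exp (e * 0) * f 0"
  proof (rule right_derivative_nonpos_imp_le[OF b])
    show "continuous_on {0..b} (\<lambda>t. exp (e * t) * f t)" by (intro continuous_intros cont)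
    fix t assume t: "0 \<le> t" "t < b"
    obtain d where d: "d \<le> - e * f t" "(f has_real_derivative d) (at_right t)" using deriv[OF t] by blast
    have "((\<lambda>t. exp (e * t)) has_real_derivative exp (e * t) * e) (at_right t)"
      by (auto intro!: derivative_eq_intros)
    from DERIV_mult[OF this d(2)]
    have "((\<lambda>t. exp (e * t) * f t) has_real_derivative exp (e * t) * (e * f t + d)) (at_right t)"
      by (simp add: algebra_simps)
    moreover have "exp (e * t) * (e * f t + d) \<le> 0"
      using d(1) by (intro mult_nonneg_nonpos) auto
    ultimately show "\<exists>d\<le>0. ((\<lambda>t. exp (e * t) * f t) has_real_derivative d) (at_right t)" by blast
  qed
  then have "exp (- e * b) * (exp (e * b) * f b) \<le> exp (- e * b) * f 0"
    by (intro mult_left_mono) auto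
  then show ?thesis by (simp add: exp_minus field_simps)
qed

section \<open>Invariance of the domain and the product rule along orbits\<close>

locale piezo_semigroup = piezo_beam +
  fixes T :: "real \<Rightarrow> state \<Rightarrow> state"
  assumes C0: "C0_contraction_semigroup X eqv N T" and gen: "generates X eqv N D G T"
begin

lemmas semigroup_laws = C0[unfolded C0_contraction_semigroup_def]

lemmas T_X = semigroup_laws[THEN conjunct1, rule_format]
lemmas T_add = semigroup_laws[THEN conjunct2, THEN conjunct2, THEN conjunct1, rule_format]
lemmas T_scale = semigroup_laws[THEN conjunct2, THEN conjunct2, THEN conjunct2, THEN conjunct1, rule_format]
lemmas T_0 = semigroup_laws[THEN conjunct2, THEN conjunct2, THEN conjunct2, THEN conjunct2, THEN conjunct1, rule_format]
lemmas T_T = semigroup_laws[THEN conjunct2, THEN conjunct2, THEN conjunct2, THEN conjunct2, THEN conjunct2, THEN conjunct1, rule_format]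
lemmas T_lim = semigroup_laws[THEN conjunct2, THEN conjunct2, THEN conjunct2, THEN conjunct2, THEN conjunct2, THEN conjunct2, THEN conjunct1, rule_format]
lemmas T_contr = semigroup_laws[THEN conjunct2, THEN conjunct2, THEN conjunct2, THEN conjunct2, THEN conjunct2, THEN conjunct2, THEN conjunct2, rule_format]

lemma D_X: "U \<in> D \<Longrightarrow> U \<in> X"
  using gen[unfolded generates_def, THEN conjunct1] by (rule subsetD)

lemma G_X: "U \<in> D \<Longrightarrow> G U \<in> X"
  using gen[unfolded generates_def, THEN conjunct2, THEN conjunct1] by (rule subsetD[OF _ imageI])

lemmas gen_iff = gen[unfolded generates_def, THEN conjunct2, THEN conjunct2, rule_format]

lemma T_diff:
  assumes t: "t \<ge> 0" and U: "U \<in> X" and V: "V \<in> X"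
  shows "eqv (T t (U - V)) (T t U - T t V)"
proof -
  have "eqv (T t (U + scale (-1) V)) (T t U + T t (scale (-1) V))"
    by (intro T_add t U X_scale V)
  also have "eqv \<dots> (T t U + scale (-1) (T t V))"
    by (intro state_eq_plus T_scale t V) simp
  finally show ?thesis by (simp add: state_minus_scale)
qed

lemma N_T_diff:
  assumes t: "t \<ge> 0" and U: "U \<in> X" and V: "V \<in> X"
  shows "N (T t U - T t V) \<le> N (U - V)"
proof -
  have "N (T t U - T t V) = N (T t (U - V))"
    by (intro N_cong X_diff T_X t U V state_eq_sym[OF T_diff])
  also have "\<dots> \<le> N (U - V)" by (intro T_contr t X_diff U V)
  finally show ?thesis .
qed

text \<open>Contractivity transports the increment from time 0 to any later time, so continuity at 0
  becomes uniform in the base time.\<close>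

lemma N_increment:
  assumes "s \<ge> 0" "h \<ge> 0" and U: "U \<in> X"
  shows "N (T (s + h) U - T s U) \<le> N (T h U - U)"
proof -
  have "N (T (s + h) U - T s U) = N (T s (T h U) - T s U)"
    by (intro N_cong X_diff T_X add_nonneg_nonneg assms state_eq_minus T_T) simp
  also have "\<dots> \<le> N (T h U - U)" by (intro N_T_diff assms T_X)
  finally show ?thesis .
qed

text \<open>The operator T t commutes with the difference quotient of the orbit and is a
  contraction, so the quotient at T t U converges to T t (G U). Membership then follows because
  \<open>generates\<close> is an equivalence: convergence of the quotient forces the state into the
  domain.\<close>

lemma T_D:
  assumes t: "t \<ge> 0" and U: "U \<in> D"
  shows "T t U \<in> D"
proof -
  note UX = D_X[OF U] and GX = G_X[OF U]
  have lim: "((\<lambda>h. N (scale (of_real (1 / h)) (T h U - U) - G U)) \<longlongrightarrow> 0) (at_right 0)"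
    using gen_iff[OF UX GX] U by simp
  have "((\<lambda>h. N (scale (of_real (1 / h)) (T h (T t U) - T t U) - T t (G U))) \<longlongrightarrow> 0) (at_right 0)"
  proof (rule Lim_null_comparison[OF _ lim])
    show "\<forall>\<^sub>F h in at_right 0. norm (N (scale (of_real (1 / h)) (T h (T t U) - T t U) - T t (G U)))
        \<le> N (scale (of_real (1 / h)) (T h U - U) - G U)"
    proof (rule eventually_at_rightI[of 0 1])
      fix h :: real assume "h \<in> {0<..<1}"
      then have h: "h \<ge> 0" by simp
      let ?k = "complex_of_real (1 / h)"
      have hX: "T h U \<in> X" "T h U - U \<in> X" "scale ?k (T h U - U) \<in> X"
        "scale ?k (T h (T t U) - T t U) - T t (G U) \<in> X"
        by (intro T_X X_diff X_scale h t UX GX)+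
      have e1: "eqv (T h (T t U)) (T t (T h U))"
      proof -
        have "eqv (T h (T t U)) (T (h + t) U)" by (intro state_eq_sym[OF T_T] h t UX)
        also have "eqv \<dots> (T t (T h U))" using T_T[OF t h UX] by (simp add: add.commute)
        finally show ?thesis .
      qed
      have "eqv (T h (T t U) - T t U) (T t (T h U) - T t U)"
        by (intro state_eq_minus e1) simp
      also have "eqv \<dots> (T t (T h U - U))" by (intro state_eq_sym[OF T_diff] t hX UX)
      finally have "eqv (scale ?k (T h (T t U) - T t U)) (scale ?k (T t (T h U - U)))"
        by (rule state_eq_scale)
      also have "eqv \<dots> (T t (scale ?k (T h U - U)))"
        by (intro state_eq_sym[OF T_scale] t hX)
      finally have "eqv (scale ?k (T h (T t U) - T t U) - T t (G U)) (T t (scale ?k (T h U - U)) - T t (G U))"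
        by (rule state_eq_minus) simp
      then have "N (scale ?k (T h (T t U) - T t U) - T t (G U)) = N (T t (scale ?k (T h U - U)) - T t (G U))"
        by (intro N_cong) (intro hX X_diff T_X t GX)+
      also have "\<dots> \<le> N (scale ?k (T h U - U) - G U)"
        by (intro N_T_diff t hX GX)
      finally show "norm (N (scale ?k (T h (T t U) - T t U) - T t (G U))) \<le> N (scale ?k (T h U - U) - G U)"
        using N_nonneg[OF hX(4)] by simp
    qed simp
  qed
  then show ?thesis using gen_iff[OF T_X[OF t UX] T_X[OF t GX]] by simp
qed

text \<open>The product rule. With the difference quotient W h the error splits into B(W h - G U, T
  h U), B(G U, T h U - U) and B(U, W h - G U), each small by boundedness.\<close>

lemma bounded_form_right_derivative:
  assumes B: "bounded_form B" and U: "U \<in> D"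
  shows "((\<lambda>h. (B (T h U) (T h U) - B U U) / h) \<longlongrightarrow> B (G U) U + B U (G U)) (at_right 0)"
proof -
  note UX = D_X[OF U] and GX = G_X[OF U]
  obtain K where K: "K \<ge> 0" "\<And>U V. U \<in> X \<Longrightarrow> V \<in> X \<Longrightarrow> \<bar>B U V\<bar> \<le> K * N U * N V"
    using bounded_form_bound[OF B] by blast
  define W where "W = (\<lambda>h. scale (of_real (1 / h)) (T h U - U))"
  have l1: "((\<lambda>h. N (W h - G U)) \<longlongrightarrow> 0) (at_right 0)"
    using gen_iff[OF UX GX] U by (simp add: W_def)
  note l2 = T_lim[OF UX]
  have "((\<lambda>h. K * N (W h - G U) * N U + K * N (G U) * N (T h U - U) + K * N U * N (W h - G U))
      \<longlongrightarrow> K * 0 * N U + K * N (G U) * 0 + K * N U * 0) (at_right 0)"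
    by (intro tendsto_add tendsto_mult tendsto_const l1 l2)
  then have l3: "((\<lambda>h. K * N (W h - G U) * N U + K * N (G U) * N (T h U - U) + K * N U * N (W h - G U))
      \<longlongrightarrow> 0) (at_right 0)" by simp
  have "((\<lambda>h. (B (T h U) (T h U) - B U U) / h - (B (G U) U + B U (G U))) \<longlongrightarrow> 0) (at_right 0)"
  proof (rule Lim_null_comparison[OF _ l3])
    show "\<forall>\<^sub>F h in at_right 0. norm ((B (T h U) (T h U) - B U U) / h - (B (G U) U + B U (G U)))
        \<le> K * N (W h - G U) * N U + K * N (G U) * N (T h U - U) + K * N U * N (W h - G U)"
    proof (rule eventually_at_rightI[of 0 1])
      fix h :: real assume "h \<in> {0<..<1}"
      then have h: "h > 0" "h \<ge> 0" by simp_all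
      have X: "T h U \<in> X" "T h U - U \<in> X" "W h \<in> X" "W h - G U \<in> X"
        unfolding W_def by (intro T_X X_diff X_scale h UX GX)+
      have s: "B (W h) V = (B (T h U) V - B U V) / h" "B V (W h) = (B V (T h U) - B V U) / h" if V: "V \<in> X" for V
      proof -
        have "B (W h) V = 1 / h * B (T h U - U) V" "B V (W h) = 1 / h * B V (T h U - U)"
          using B X(2) V unfolding bounded_form_def W_def by blast+
        moreover have "B (T h U - U) V = B (T h U) V - B U V" "B V (T h U - U) = B V (T h U) - B V U"
          using B X(1) UX V unfolding bounded_form_def by blast+
        ultimately show "B (W h) V = (B (T h U) V - B U V) / h" "B V (W h) = (B V (T h U) - B V U) / h" by simp_all
      qed
      have a: "B (W h - G U) (T h U) = B (W h) (T h U) - B (G U) (T h U)"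
        "B (G U) (T h U - U) = B (G U) (T h U) - B (G U) U"
        "B U (W h - G U) = B U (W h) - B U (G U)"
        using B X UX GX unfolding bounded_form_def by blast+
      have "(B (T h U) (T h U) - B U U) / h - (B (G U) U + B U (G U)) =
          B (W h - G U) (T h U) + B (G U) (T h U - U) + B U (W h - G U)"
        unfolding a s[OF X(1)] s[OF UX] by (simp add: diff_divide_distrib)
      also have "\<bar>\<dots>\<bar> \<le> K * N (W h - G U) * N (T h U) + K * N (G U) * N (T h U - U) + K * N U * N (W h - G U)"
        using K(2)[OF X(4,1)] K(2)[OF GX X(2)] K(2)[OF UX X(4)] by linarith
      also have "\<dots> \<le> K * N (W h - G U) * N U + K * N (G U) * N (T h U - U) + K * N U * N (W h - G U)"
        using mult_left_mono[OF T_contr[OF h(2) UX] mult_nonneg_nonneg[OF K(1) N_nonneg[OF X(4)]]]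
        by (simp only: add_le_cancel_right)
      finally show "norm ((B (T h U) (T h U) - B U U) / h - (B (G U) U + B U (G U)))
        \<le> K * N (W h - G U) * N U + K * N (G U) * N (T h U - U) + K * N U * N (W h - G U)" by simp
    qed simp
  qed
  then show ?thesis by (simp add: LIM_zero_iff)
qed

text \<open>The increment between two times is measured from the earlier one, so right continuity at
  0 gives two-sided continuity at all later times.\<close>

lemma bounded_form_continuous:
  assumes B: "bounded_form B" and U: "U \<in> X"
  shows "continuous_on {0..} (\<lambda>t. B (T t U) (T t U))"
proof -
  obtain K where K: "K \<ge> 0" "\<And>U V. U \<in> X \<Longrightarrow> V \<in> X \<Longrightarrow> \<bar>B U V\<bar> \<le> K * N U * N V"
    using bounded_form_bound[OF B] by blast
  have inc: "\<bar>B (T (s + h) U) (T (s + h) U) - B (T s U) (T s U)\<bar> \<le> 2 * K * N U * N (T h U - U)"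
    if sh: "s \<ge> 0" "h \<ge> 0" for s h
  proof -
    let ?V = "T (s + h) U" and ?W = "T s U"
    have sh': "s + h \<ge> 0" using sh by simp
    note X = T_X[OF sh' U] T_X[OF sh(1) U]
    note XD = X_diff[OF X] and nn = N_nonneg[OF U] N_nonneg[OF X_diff[OF X]]
    have "B ?V ?V - B ?W ?W = B (?V - ?W) ?V + B ?W (?V - ?W)"
      using B X unfolding bounded_form_def by simp
    also have "\<bar>\<dots>\<bar> \<le> K * N (?V - ?W) * N ?V + K * N ?W * N (?V - ?W)"
      using K(2)[OF XD X(1)] K(2)[OF X(2) XD] by linarith
    also have "\<dots> \<le> K * N (?V - ?W) * N U + K * N U * N (?V - ?W)"
      using T_contr[OF sh' U] T_contr[OF sh(1) U] K(1) nn
      by (intro add_mono mult_left_mono mult_right_mono) auto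
    also have "\<dots> = 2 * K * N U * N (?V - ?W)" by (simp add: algebra_simps)
    also have "\<dots> \<le> 2 * K * N U * N (T h U - U)"
      using N_increment[OF sh U] K(1) nn by (intro mult_left_mono) auto
    finally show ?thesis .
  qed
  have "((\<lambda>t. 2 * K * N U * N (T t U - U)) \<longlongrightarrow> 2 * K * N U * 0) (at_right 0)"
    by (intro tendsto_mult tendsto_const T_lim U)
  then have lim: "((\<lambda>t. 2 * K * N U * N (T t U - U)) \<longlongrightarrow> 0) (at_right 0)" by simp
  show ?thesis unfolding continuous_on_iff
  proof (intro ballI allI impI)
    fix s e :: real assume s: "s \<in> {0..}" and e: "e > 0"
    have "\<forall>\<^sub>F h in at_right 0. 2 * K * N U * N (T h U - U) < e"
      by (rule order_tendstoD(2)[OF lim e])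
    then obtain d where d: "d > 0" "\<And>h. 0 < h \<Longrightarrow> h < d \<Longrightarrow> 2 * K * N U * N (T h U - U) < e"
      unfolding eventually_at_right_field by auto
    show "\<exists>d>0. \<forall>t\<in>{0..}. dist t s < d \<longrightarrow> dist (B (T t U) (T t U)) (B (T s U) (T s U)) < e"
    proof (intro exI conjI ballI impI)
      fix t assume t: "t \<in> {0..}" "dist t s < d"
      show "dist (B (T t U) (T t U)) (B (T s U) (T s U)) < e"
      proof (cases t s rule: linorder_cases)
        case less
        then show ?thesis using inc[of t "s - t"] d(2)[of "s - t"] t s by (simp add: dist_real_def)
      next
        case greater
        then show ?thesis using inc[of s "t - s"] d(2)[of "t - s"] t s by (simp add: dist_real_def)
      qed (use e in simp)
    qed (rule d(1))
  qed
qed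

theorem lyapunov_decay:
  assumes B: "bounded_form B" and dec: "\<And>U. U \<in> D \<Longrightarrow> B (G U) U + B U (G U) \<le> - e * B U U"
    and U: "U \<in> D" and t: "t \<ge> 0"
  shows "B (T t U) (T t U) \<le> exp (- e * t) * B U U"
proof -
  note UX = D_X[OF U]
  let ?f = "\<lambda>t. B (T t U) (T t U)"
  have "?f t \<le> exp (- e * t) * ?f 0"
  proof (rule right_derivative_decay[OF t])
    show "continuous_on {0..t} ?f"
      by (rule continuous_on_subset[OF bounded_form_continuous[OF B UX]]) auto
    fix s assume s: "0 \<le> s" "s < t"
    let ?V = "T s U"
    have V: "?V \<in> D" by (rule T_D[OF s(1) U])
    have "((\<lambda>h. (B (T h ?V) (T h ?V) - B ?V ?V) / h) \<longlongrightarrow> B (G ?V) ?V + B ?V (G ?V)) (at_right 0)"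
      by (rule bounded_form_right_derivative[OF B V])
    then have "((\<lambda>h. (?f (h + s) - ?f s) / h) \<longlongrightarrow> B (G ?V) ?V + B ?V (G ?V)) (at_right 0)"
    proof (rule Lim_transform_eventually)
      show "\<forall>\<^sub>F h in at_right 0. (B (T h ?V) (T h ?V) - B ?V ?V) / h = (?f (h + s) - ?f s) / h"
      proof (rule eventually_at_rightI[of 0 1])
        fix h :: real assume "h \<in> {0<..<1}"
        then have h: "h \<ge> 0" by simp
        have "B (T h ?V) (T h ?V) = ?f (h + s)"
          by (intro bounded_form_cong[OF B] T_X h s UX add_nonneg_nonneg state_eq_sym[OF T_T])
        then show "(B (T h ?V) (T h ?V) - B ?V ?V) / h = (?f (h + s) - ?f s) / h" by simp
      qed simp
    qed
    then have "(?f has_real_derivative B (G ?V) ?V + B ?V (G ?V)) (at_right s)"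
      unfolding has_field_derivative_iff by (subst filterlim_at_right_to_0) simp
    then show "\<exists>d. d \<le> - e * ?f s \<and> (?f has_real_derivative d) (at_right s)"
      using dec[OF V] by blast
  qed
  also have "?f 0 = B U U" by (intro bounded_form_cong[OF B] T_X UX T_0) simp_all
  finally show ?thesis .
qed

end

context piezo_beam begin

section \<open>Multiplier identities\<close>

text \<open>The effective stiffness: eliminating u3 by the constraint turns the stress into
  \<alpha>1 v_x + \<gamma> \<xi> u2_x.\<close>

definition \<alpha>1 :: real where "\<alpha>1 = \<alpha> + \<gamma>\<^sup>2 / \<epsilon>\<^sub>3"
abbreviation v_x :: "state \<Rightarrow> real \<Rightarrow> complex" where "v_x U \<equiv> wd L (st_v U)"
definition stress :: "state \<Rightarrow> real \<Rightarrow> complex" where "stress U = (\<lambda>x. of_real \<alpha> * v_x U x + of_real \<gamma> * st_u3 U x)"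
text \<open>On the energy space \<open>u2_x U\<close> is the weak derivative of \<open>u2\<close>, expressed through the constraint. Unlike
  \<^const>\<open>wd\<close> it is linear everywhere, not only almost everywhere.\<close>

definition u2_x :: "state \<Rightarrow> real \<Rightarrow> complex" where
  "u2_x U = (\<lambda>x. of_real (1 / \<xi>) * st_u3 U x + of_real (- (\<gamma> / (\<xi> * \<epsilon>\<^sub>3))) * v_x U x)"
text \<open>The coefficients are chosen such that \<open>potential U\<close> is an antiderivative of \<open>stress U\<close>.\<close>

definition potential :: "state \<Rightarrow> real \<Rightarrow> complex" where "potential U = (\<lambda>x. of_real (\<gamma> * \<xi>) * st_u2 U x + of_real \<alpha>1 * st_v U x)"

lemma \<alpha>1_pos: "\<alpha>1 > 0"
  using pos by (simp add: \<alpha>1_def add_pos_nonneg)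

lemma bounded_map_stress: "bounded_map stress" and bounded_map_u2_x: "bounded_map u2_x" and bounded_map_potential: "bounded_map potential"
  unfolding stress_def[abs_def] u2_x_def[abs_def] potential_def[abs_def]
  by (intro bounded_map_add bounded_map_scale bounded_map_comp bounded_map_v)+

lemma wd_u2_eq:
  assumes U: "U \<in> X"
  shows "AE x in intv L. wd L (st_u2 U) x = u2_x U x"
  using X_D(12)[OF U]
proof eventually_elim
  case (elim x)
  then have "of_real \<xi> * wd L (st_u2 U) x = st_u3 U x - of_real (\<gamma> / \<epsilon>\<^sub>3) * v_x U x"
    by (metis add.commute add_diff_cancel_left' diff_add_eq diff_eq_eq eq_iff_diff_eq_0)
  then have "wd L (st_u2 U) x = of_real (1 / \<xi>) * (st_u3 U x - of_real (\<gamma> / \<epsilon>\<^sub>3) * v_x U x)"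
    using pos by (simp add: field_simps)
  then show ?case by (simp add: u2_x_def algebra_simps)
qed

lemma potential_H1:
  assumes U: "U \<in> X"
  shows "potential U \<in> H1 L" "AE x in intv L. wd L (potential U) x = stress U x" "val L (potential U) 0 = 0"
proof -
  note a = H1_scale[OF pos(1) X_D(7)[OF U], where k="of_real (\<gamma> * \<xi>)"]
  note b = H1_scale[OF pos(1) X_D(1)[OF U], where k="of_real \<alpha>1"]
  note s = H1_add[OF pos(1) a(1) b(1)]
  show "potential U \<in> H1 L" using s(1) by (simp add: potential_def)
  show "val L (potential U) 0 = 0" unfolding potential_def s(3)[OF zero_le] a(3)[OF zero_le] b(3)[OF zero_le]
    by (simp add: X_D[OF U])
  show "AE x in intv L. wd L (potential U) x = stress U x"
    using s(2) a(2) b(2) wd_u2_eq[OF U]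
  proof eventually_elim
    case (elim x)
    have "wd L (potential U) x = of_real (\<gamma> * \<xi>) * u2_x U x + of_real \<alpha>1 * v_x U x"
      using elim by (simp add: potential_def)
    also have "\<dots> = stress U x"
      using pos by (simp add: u2_x_def stress_def \<alpha>1_def field_simps power2_eq_square)
    finally show ?case .
  qed
qed

lemma D_iff: "U \<in> D \<longleftrightarrow> U \<in> X \<and> st_z U \<in> H1 L \<and> val L (st_z U) 0 = 0 \<and> v_x U \<in> H1 L \<and>
    st_u1 U \<in> H1 L \<and> val L (st_u1 U) 0 = 0 \<and> val L (st_u1 U) L = 0 \<and> st_u3 U \<in> H1 L \<and>
    of_real \<alpha> * val L (v_x U) L + of_real \<gamma> * val L (st_u3 U) L = 0"
proof -
  obtain v z u1 u2 u3 where U: "U = (v, z, u1, u2, u3)" by (cases U)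
  show ?thesis unfolding X_iff unfolding U comp_tuple
    by (auto simp: op_dom_def energy_space_def H1_left_def H1_zero_def H2_def)
qed

lemma D_D:
  assumes "U \<in> D"
  shows "U \<in> X" "st_z U \<in> H1 L" "val L (st_z U) 0 = 0" "v_x U \<in> H1 L" "st_u1 U \<in> H1 L" "val L (st_u1 U) 0 = 0"
    "val L (st_u1 U) L = 0" "st_u3 U \<in> H1 L" "of_real \<alpha> * val L (v_x U) L + of_real \<gamma> * val L (st_u3 U) L = 0"
  using assms unfolding D_iff by blast+

lemma stress_H1:
  assumes U: "U \<in> D"
  shows "stress U \<in> H1 L" "AE x in intv L. wd L (stress U) x = of_real \<alpha> * wd L (v_x U) x + of_real \<gamma> * wd L (st_u3 U) x"
    "val L (stress U) L = 0"
proof -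
  note a = H1_scale[OF pos(1) D_D(4)[OF U], where k="of_real \<alpha>"]
  note b = H1_scale[OF pos(1) D_D(8)[OF U], where k="of_real \<gamma>"]
  note s = H1_add[OF pos(1) a(1) b(1)]
  show "stress U \<in> H1 L" using s(1) by (simp add: stress_def)
  show "val L (stress U) L = 0" unfolding stress_def s(3)[OF L_le] a(3)[OF L_le] b(3)[OF L_le]
    by (rule D_D(9)[OF U])
  show "AE x in intv L. wd L (stress U) x = of_real \<alpha> * wd L (v_x U) x + of_real \<gamma> * wd L (st_u3 U) x"
    using s(2) a(2) b(2) by eventually_elim (simp add: stress_def)
qed

text \<open>From here on stress and u3 are the independent quantities: the stress has zero trace at
  L, and the trace of u3 is the one to be controlled.\<close>

lemma v_x_eq: "v_x U = (\<lambda>x. of_real (1 / \<alpha>) * stress U x + of_real (- (\<gamma> / \<alpha>)) * st_u3 U x)"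
  using pos by (auto simp: stress_def fun_eq_iff field_simps)

lemma u2_x_eq: "u2_x U = (\<lambda>x. of_real (\<alpha>1 / (\<alpha> * \<xi>)) * st_u3 U x + of_real (- (\<gamma> / (\<alpha> * \<xi> * \<epsilon>\<^sub>3))) * stress U x)"
  using pos by (auto simp: u2_x_def stress_def \<alpha>1_def fun_eq_iff field_simps power2_eq_square)

lemma G_comp:
  "st_v (G U) = st_z U"
  "st_z (G U) = (\<lambda>x. of_real (\<alpha> / \<rho>) * wd L (v_x U) x + of_real (\<gamma> / \<rho>) * wd L (st_u3 U) x - of_real (a / \<rho>) * st_z U x)"
  "st_u1 (G U) = (\<lambda>x. st_u2 U x - wd L (st_u3 U) x)"
  "st_u2 (G U) = (\<lambda>x. of_real (- (\<mu> / (\<xi> * \<epsilon>\<^sub>3))) * st_u1 U x)"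
  "st_u3 (G U) = (\<lambda>x. of_real (- (\<mu> / \<epsilon>\<^sub>3)) * wd L (st_u1 U) x + of_real (\<gamma> / \<epsilon>\<^sub>3) * wd L (st_z U) x)"
proof -
  obtain v z u1 u2 u3 where U: "U = (v, z, u1, u2, u3)" by (cases U)
  show "st_v (G U) = st_z U"
    "st_z (G U) = (\<lambda>x. of_real (\<alpha> / \<rho>) * wd L (v_x U) x + of_real (\<gamma> / \<rho>) * wd L (st_u3 U) x - of_real (a / \<rho>) * st_z U x)"
    "st_u1 (G U) = (\<lambda>x. st_u2 U x - wd L (st_u3 U) x)"
    "st_u2 (G U) = (\<lambda>x. of_real (- (\<mu> / (\<xi> * \<epsilon>\<^sub>3))) * st_u1 U x)"
    "st_u3 (G U) = (\<lambda>x. of_real (- (\<mu> / \<epsilon>\<^sub>3)) * wd L (st_u1 U) x + of_real (\<gamma> / \<epsilon>\<^sub>3) * wd L (st_z U) x)"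
    unfolding U comp_tuple op_A_damped_def comp_minus op_A.simps op_B.simps by (simp_all add: fun_eq_iff)
qed

lemma potential_G: "potential (G U) = (\<lambda>x. of_real (- (\<gamma> * \<mu> / \<epsilon>\<^sub>3)) * st_u1 U x + of_real \<alpha>1 * st_z U x)"
  using pos by (simp add: potential_def G_comp fun_eq_iff)

text \<open>The z_x parts coming from u3 and from v_x cancel, reflecting that the generator respects
  the constraint. Equality holds at every point because both are the same choice
  \<open>wd L (st_z U)\<close>.\<close>

lemma u2_x_G: "u2_x (G U) = (\<lambda>x. of_real (- (\<mu> / (\<xi> * \<epsilon>\<^sub>3))) * wd L (st_u1 U) x)"
  using pos by (simp add: u2_x_def G_comp fun_eq_iff field_simps)

section \<open>Derivatives of the energy and of the auxiliary forms along the generator\<close>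

lemmas ip_linear = ip_add_left ip_diff_left ip_scale_left ip_add_right ip_diff_right ip_scale_right
lemmas L2_rules = L2_add L2_diff L2_scale

lemma D_L2:
  assumes U: "U \<in> D"
  shows "st_v U \<in> L2 L" "v_x U \<in> L2 L" "st_z U \<in> L2 L" "st_u1 U \<in> L2 L" "st_u2 U \<in> L2 L" "st_u3 U \<in> L2 L"
    "wd L (st_z U) \<in> L2 L" "wd L (v_x U) \<in> L2 L" "wd L (st_u1 U) \<in> L2 L" "wd L (st_u3 U) \<in> L2 L"
    "stress U \<in> L2 L" "potential U \<in> L2 L" "u2_x U \<in> L2 L" "wd L (stress U) \<in> L2 L" "wd L (potential U) \<in> L2 L"
  using X_D[OF D_D(1)[OF U]] D_D[OF U] stress_H1(1)[OF U] potential_H1(1)[OF D_D(1)[OF U]]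
    bounded_map_L2[OF bounded_map_u2_x D_D(1)[OF U]] by (blast intro: wd_weak(1) H1_L2)+

lemma ip_cz_G:
  assumes U: "U \<in> D" and f: "f \<in> L2 L"
  shows "\<rho> * ip L (st_z (G U)) f = ip L (wd L (stress U)) f - a * ip L (st_z U) f"
proof -
  note l = D_L2[OF U]
  have "ip L (wd L (stress U)) f = ip L (\<lambda>x. of_real \<alpha> * wd L (v_x U) x + of_real \<gamma> * wd L (st_u3 U) x) f"
    by (intro ip_cong_AE L2_rules l f stress_H1(2)[OF U]) simp
  also have "\<dots> = \<alpha> * ip L (wd L (v_x U)) f + \<gamma> * ip L (wd L (st_u3 U)) f"
    by (simp only: ip_linear L2_rules l f)
  finally show ?thesis unfolding G_comp
    using pos by (simp only: ip_linear L2_rules l f) (simp add: field_simps)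
qed

text \<open>The energy weights cancel all interior couplings. At L the traces of v_x and u3 against
  z vanish only in combination, by the stress condition of the domain; u1 vanishes at both
  ends.\<close>

lemma Q_deriv:
  assumes U: "U \<in> D"
  shows "Q (G U) U + Q U (G U) = - 2 * a * ip L (st_z U) (st_z U)"
proof -
  note l = D_L2[OF U] and d = D_D[OF U]
  let ?zL = "val L (st_z U) L" and ?pL = "val L (v_x U) L" and ?yL = "val L (st_u3 U) L"
  have s: "Q U (G U) = Q (G U) U" unfolding Q_def by (simp only: ip_commute)
  have 1: "\<alpha> * (ip L (wd L (st_z U)) (v_x U) + ip L (st_z U) (wd L (v_x U))) = \<alpha> * Re (?zL * cnj ?pL)"
    using H1_by_parts_1[OF pos(1) d(2) d(4)] d(3) by simp
  have 2: "\<gamma> * (ip L (wd L (st_z U)) (st_u3 U) + ip L (st_z U) (wd L (st_u3 U))) = \<gamma> * Re (?zL * cnj ?yL)"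
    using H1_by_parts_1[OF pos(1) d(2) d(8)] d(3) by simp
  have 3: "ip L (wd L (st_u1 U)) (st_u3 U) + ip L (st_u1 U) (wd L (st_u3 U)) = 0"
    using H1_by_parts_1[OF pos(1) d(5) d(8)] d(6,7) by simp
  have "\<alpha> * Re (?zL * cnj ?pL) + \<gamma> * Re (?zL * cnj ?yL) = Re (?zL * cnj (of_real \<alpha> * ?pL + of_real \<gamma> * ?yL))"
    by (simp add: algebra_simps)
  then have 4: "\<alpha> * Re (?zL * cnj ?pL) + \<gamma> * Re (?zL * cnj ?yL) = 0" by (simp only: d(9)) simp
  have zG: "\<rho> * ip L (st_z (G U)) (st_z U) = \<alpha> * ip L (wd L (v_x U)) (st_z U) + \<gamma> * ip L (wd L (st_u3 U)) (st_z U) - a * ip L (st_z U) (st_z U)"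
    unfolding G_comp using pos by (simp only: ip_linear L2_rules l) (simp add: field_simps)
  have "Q (G U) U = \<alpha> * ip L (wd L (st_z U)) (v_x U)
      + (\<alpha> * ip L (wd L (v_x U)) (st_z U) + \<gamma> * ip L (wd L (st_u3 U)) (st_z U) - a * ip L (st_z U) (st_z U))
      + \<mu> * (ip L (st_u2 U) (st_u1 U) - ip L (wd L (st_u3 U)) (st_u1 U))
      + \<xi> * \<epsilon>\<^sub>3 * (- (\<mu> / (\<xi> * \<epsilon>\<^sub>3)) * ip L (st_u1 U) (st_u2 U))
      + \<epsilon>\<^sub>3 * (- (\<mu> / \<epsilon>\<^sub>3) * ip L (wd L (st_u1 U)) (st_u3 U) + (\<gamma> / \<epsilon>\<^sub>3) * ip L (wd L (st_z U)) (st_u3 U))"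
    unfolding Q_def zG unfolding G_comp(1,3,4,5) by (simp only: ip_linear L2_rules l)
  also have "\<dots> = \<alpha> * (ip L (wd L (st_z U)) (v_x U) + ip L (st_z U) (wd L (v_x U)))
      + \<gamma> * (ip L (wd L (st_z U)) (st_u3 U) + ip L (st_z U) (wd L (st_u3 U)))
      - \<mu> * (ip L (wd L (st_u1 U)) (st_u3 U) + ip L (st_u1 U) (wd L (st_u3 U))) - a * ip L (st_z U) (st_z U)"
    using pos by (simp add: ip_commute[of L "wd L (v_x U)" "st_z U"] ip_commute[of L "wd L (st_u3 U)" "st_z U"]
      ip_commute[of L "wd L (st_u3 U)" "st_u1 U"] ip_commute[of L "st_u2 U" "st_u1 U"] algebra_simps)
  also have "\<dots> = - a * ip L (st_z U) (st_z U)" unfolding 1 2 3 using 4 by simp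
  finally show ?thesis unfolding s by simp
qed

text \<open>The boundary term disappears at L through the stress and at 0 through the potential,
  which is why the antiderivative is anchored at 0.\<close>

lemma F1_deriv:
  assumes U: "U \<in> D"
  shows "\<rho> * ip L (st_z (G U)) (potential U) + \<rho> * ip L (st_z U) (potential (G U)) =
    - ip L (stress U) (stress U) - a * ip L (st_z U) (potential U) + \<rho> * \<alpha>1 * ip L (st_z U) (st_z U)
      - \<rho> * (\<gamma> * \<mu> / \<epsilon>\<^sub>3) * ip L (st_z U) (st_u1 U)"
proof -
  note l = D_L2[OF U] and d = D_D[OF U]
  have "ip L (wd L (stress U)) (potential U) + ip L (stress U) (wd L (potential U)) = 0"
    using H1_by_parts_1[OF pos(1) stress_H1(1)[OF U] potential_H1(1)[OF d(1)]] stress_H1(3)[OF U] potential_H1(3)[OF d(1)] by simp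
  moreover have "ip L (stress U) (wd L (potential U)) = ip L (stress U) (stress U)"
    by (intro ip_cong_AE l potential_H1(2) d) simp
  ultimately have 1: "\<rho> * ip L (st_z (G U)) (potential U) = - ip L (stress U) (stress U) - a * ip L (st_z U) (potential U)"
    using ip_cz_G[OF U l(12)] by simp
  have 2: "ip L (st_z U) (potential (G U)) = - (\<gamma> * \<mu> / \<epsilon>\<^sub>3) * ip L (st_z U) (st_u1 U) + \<alpha>1 * ip L (st_z U) (st_z U)"
    unfolding potential_G by (simp only: ip_linear L2_rules l)
  show ?thesis unfolding 1 2 by (simp add: algebra_simps)
qed

text \<open>Only the end 0 is free of boundary terms. At L the potential reduces to \<alpha>1 v, so
  its product with the trace of u3 remains.\<close>

lemma F2_deriv:
  assumes U: "U \<in> D"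
  shows "ip L (st_u1 (G U)) (potential U) + ip L (st_u1 U) (potential (G U)) =
    ip L (st_u2 U) (potential U) + ip L (st_u3 U) (stress U) - Re (val L (st_u3 U) L * cnj (val L (potential U) L))
      - (\<gamma> * \<mu> / \<epsilon>\<^sub>3) * ip L (st_u1 U) (st_u1 U) + \<alpha>1 * ip L (st_u1 U) (st_z U)"
proof -
  note l = D_L2[OF U] and d = D_D[OF U]
  have "ip L (wd L (st_u3 U)) (potential U) + ip L (st_u3 U) (wd L (potential U)) = Re (val L (st_u3 U) L * cnj (val L (potential U) L))"
    using H1_by_parts_1[OF pos(1) d(8) potential_H1(1)[OF d(1)]] potential_H1(3)[OF d(1)] by simp
  moreover have "ip L (st_u3 U) (wd L (potential U)) = ip L (st_u3 U) (stress U)"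
    by (intro ip_cong_AE l potential_H1(2) d) simp
  moreover have "ip L (st_u1 (G U)) (potential U) = ip L (st_u2 U) (potential U) - ip L (wd L (st_u3 U)) (potential U)"
    unfolding G_comp by (simp only: ip_linear L2_rules l)
  moreover have "ip L (st_u1 U) (potential (G U)) = - (\<gamma> * \<mu> / \<epsilon>\<^sub>3) * ip L (st_u1 U) (st_u1 U) + \<alpha>1 * ip L (st_u1 U) (st_z U)"
    unfolding potential_G by (simp only: ip_linear L2_rules l)
  ultimately show ?thesis by simp
qed

text \<open>Since u2 vanishes at both ends, the derivative moves onto it without boundary terms. In
  the quantities u3 and stress, u2_x contains a positive multiple of u3, the source of the square.
  The sign is that of <u1, u2>, opposite to \<open>F3\<close>.\<close>

lemma F3_deriv:
  assumes U: "U \<in> D"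
  shows "ip L (st_u1 (G U)) (st_u2 U) + ip L (st_u1 U) (st_u2 (G U)) =
    ip L (st_u2 U) (st_u2 U) + \<alpha>1 / (\<alpha> * \<xi>) * ip L (st_u3 U) (st_u3 U) - \<gamma> / (\<alpha> * \<xi> * \<epsilon>\<^sub>3) * ip L (st_u3 U) (stress U)
      - \<mu> / (\<xi> * \<epsilon>\<^sub>3) * ip L (st_u1 U) (st_u1 U)"
proof -
  note l = D_L2[OF U] and d = D_D[OF U] and x = X_D[OF D_D(1)[OF U]]
  have "ip L (wd L (st_u3 U)) (st_u2 U) + ip L (st_u3 U) (wd L (st_u2 U)) = 0"
    using H1_by_parts_1[OF pos(1) d(8) x(7)] x(9,10) by simp
  moreover have "ip L (st_u3 U) (wd L (st_u2 U)) = ip L (st_u3 U) (u2_x U)"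
    by (intro ip_cong_AE l wd_u2_eq d wd_weak(1) x) simp
  moreover have "ip L (st_u3 U) (u2_x U) = \<alpha>1 / (\<alpha> * \<xi>) * ip L (st_u3 U) (st_u3 U) + - (\<gamma> / (\<alpha> * \<xi> * \<epsilon>\<^sub>3)) * ip L (st_u3 U) (stress U)"
    unfolding u2_x_eq by (simp only: ip_linear L2_rules l)
  moreover have "ip L (st_u1 (G U)) (st_u2 U) = ip L (st_u2 U) (st_u2 U) - ip L (wd L (st_u3 U)) (st_u2 U)"
    unfolding G_comp by (simp only: ip_linear L2_rules l)
  moreover have "ip L (st_u1 U) (st_u2 (G U)) = - (\<mu> / (\<xi> * \<epsilon>\<^sub>3)) * ip L (st_u1 U) (st_u1 U)"
    unfolding G_comp by (simp only: ip_linear L2_rules l)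
  ultimately show ?thesis by simp
qed

end

section \<open>The Lyapunov functional\<close>

definition xw :: "(real \<Rightarrow> complex) \<Rightarrow> real \<Rightarrow> complex" where "xw f = (\<lambda>x. of_real x * f x)"

lemma xw_L2: "f \<in> L2 L \<Longrightarrow> xw f \<in> L2 L"
  unfolding xw_def by (rule L2_weight[where w="\<lambda>x. x"]) simp

lemma xw_linear:
  "xw (\<lambda>x. f x + g x) = (\<lambda>x. xw f x + xw g x)" "xw (\<lambda>x. f x - g x) = (\<lambda>x. xw f x - xw g x)"
  "xw (\<lambda>x. c * f x) = (\<lambda>x. c * xw f x)"
  by (simp_all add: xw_def algebra_simps)

lemma ip_xw: "ip L (xw f) g = ip L (xw g) f"
proof -
  have "ip L (xw f) g = ip L f (xw g)"
    by (simp add: ip_def cip_def xw_def mult_ac)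
  then show ?thesis by (metis ip_commute)
qed

lemma ip_xw_le:
  assumes L: "L \<ge> 0" and f: "f \<in> L2 L"
  shows "ip L (xw f) (xw f) \<le> L\<^sup>2 * ip L f f"
proof -
  have m: "(\<lambda>x. complex_of_real x) \<in> borel_measurable (intv L)"
    by (rule L2D(1), rule L2_continuous) (intro continuous_intros)
  have "nm L (xw f) \<le> L * nm L f" unfolding xw_def
    by (rule nm_mult_bounded[OF f m]) (use L in auto)
  then have "(nm L (xw f))\<^sup>2 \<le> (L * nm L f)\<^sup>2" by (intro power_mono nm_nonneg)
  then show ?thesis by (simp add: power_mult_distrib nm_sq)
qed

lemma H1_by_parts_xw:
  assumes L: "L > 0" and f: "f \<in> H1 L" and g: "g \<in> H1 L"
  shows "ip L (xw (wd L f)) g + ip L (xw (wd L g)) f = L * Re (val L f L * cnj (val L g L)) - ip L f g"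
  using H1_by_parts_x[OF assms] ip_xw[of L f "wd L g"] by (simp add: xw_def)

lemma H1_by_parts_xw_self:
  assumes L: "L > 0" and f: "f \<in> H1 L"
  shows "ip L (xw (wd L f)) f = (L * (cmod (val L f L))\<^sup>2 - ip L f f) / 2"
proof -
  have "Re (val L f L * cnj (val L f L)) = (cmod (val L f L))\<^sup>2"
    by (metis complex_norm_square Re_complex_of_real of_real_power)
  then show ?thesis using H1_by_parts_xw[OF L f f] by simp
qed

lemma ip_young:
  assumes f: "f \<in> L2 L" and g: "g \<in> L2 L" and \<eta>: "\<eta> > 0"
  shows "\<bar>ip L f g\<bar> \<le> \<eta> * ip L f f + ip L g g / (4 * \<eta>)"
proof -
  have "0 \<le> (2 * \<eta> * nm L f - nm L g)\<^sup>2 / (4 * \<eta>)" using \<eta> by simp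
  also have "\<dots> = \<eta> * (nm L f)\<^sup>2 + (nm L g)\<^sup>2 / (4 * \<eta>) - nm L f * nm L g"
    using \<eta> by (simp add: field_simps power2_eq_square)
  finally show ?thesis using ip_bound[OF f g] by (simp add: nm_sq)
qed

text \<open>Here \<open>Z\<close>, \<open>U\<close>, \<open>W\<close>, \<open>Y\<close>, \<open>S\<close> stand for the squared norms of \<open>z\<close>, \<open>u1\<close>, \<open>u2\<close>, \<open>u3\<close> and the stress,
  \<open>b\<close> for the squared trace of \<open>u3\<close> at \<open>L\<close>, and \<open>e\<close>, \<open>f1\<close>, \<dots>, \<open>f4\<close> for the derivatives of the energy and of
  the four auxiliary forms. The weights are fixed in the order \<open>k4\<close>, \<open>k2\<close>, \<open>k1\<close>, \<open>M\<close>; each one absorbs the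
  error terms of those before it.\<close>

lemma lyapunov_coefficients:
  fixes a c C :: real
  assumes "a > 0" "c > 0" "C \<ge> 0"
  obtains k1 k2 k4 M0 l where "k1 \<ge> 0" "k2 \<ge> 0" "k4 \<ge> 0" "l > 0"
    "\<And>M Z U W Y S b e f1 f2 f3 f4. M \<ge> M0 \<Longrightarrow> Z \<ge> 0 \<Longrightarrow> U \<ge> 0 \<Longrightarrow> W \<ge> 0 \<Longrightarrow> Y \<ge> 0 \<Longrightarrow> S \<ge> 0 \<Longrightarrow> b \<ge> 0 \<Longrightarrow>
       e = - 2 * a * Z \<Longrightarrow>
       (\<And>\<eta>. 0 < \<eta> \<Longrightarrow> \<eta> \<le> 1 \<Longrightarrow> f1 \<le> - S / 2 + C / \<eta> * Z + \<eta> * U) \<Longrightarrow>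
       (\<And>\<eta>. 0 < \<eta> \<Longrightarrow> \<eta> \<le> 1 \<Longrightarrow> f2 \<le> - c * U + \<eta> * (W + Y + b) + C / \<eta> * (S + Z)) \<Longrightarrow>
       f3 \<le> - c * (W + Y) + C * (S + U) \<Longrightarrow>
       f4 \<le> - c * b + C * (Z + U + W + Y + S) \<Longrightarrow>
       M * e + k1 * f1 + k2 * f2 + f3 + k4 * f4 \<le> - l * (Z + U + W + Y + S)"
proof -
  \<comment> \<open>The weight of f4, so small that its full-energy error d C is at most c/4; f3 is
    normalised to weight 1.\<close>
  define d where "d = c / (4 * (C + c))"
  \<comment> \<open>Makes k2 c = C + c: the gain in U pays the error C U of f3 and leaves c.\<close>
  define k2 where "k2 = (C + c) / c"
  \<comment> \<open>The two bounds serve the W and Y errors of f2 and its trace error, which must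
    stay below the gain d c from f4.\<close>
  define n2 where "n2 = min 1 (min (c / (4 * k2)) (d * c / k2))"
  \<comment> \<open>Half of k1 pays the S errors of f2 and f3 plus c/2, of which f4 consumes at most
    c/4.\<close>
  define k1 where "k1 = 2 * (k2 * (C / n2) + C + c / 2)"
  define n1 where "n1 = min 1 (c / (4 * k1))"
  define M0 where "M0 = (k1 * (C / n1) + k2 * (C / n2) + c / 2) / (2 * a)"
  have d: "d > 0" "d * C \<le> c / 4" using assms by (auto simp: d_def field_simps)
  have k2: "k2 > 0" "k2 * c = C + c" using assms by (auto simp: k2_def)
  have n2: "n2 > 0" "n2 \<le> 1" using assms d k2 by (auto simp: n2_def)
  have k2n2: "k2 * n2 \<le> c / 4" "k2 * n2 \<le> d * c"
  proof -
    have "n2 \<le> c / (4 * k2)" "n2 \<le> d * c / k2" unfolding n2_def by linarith+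
    then show "k2 * n2 \<le> c / 4" "k2 * n2 \<le> d * c" using k2(1) by (auto simp: field_simps)
  qed
  have "k2 * (C / n2) \<ge> 0" using k2 n2 assms by simp
  moreover have "0 < 2 * (x + C + c / 2)" if "x \<ge> 0" for x using that assms by argo
  ultimately have k1: "k1 > 0" unfolding k1_def by blast
  have n1: "n1 > 0" "n1 \<le> 1" using assms k1 by (auto simp: n1_def)
  have k1n1: "k1 * n1 \<le> c / 4"
  proof -
    have "n1 \<le> c / (4 * k1)" unfolding n1_def by linarith
    then show ?thesis using k1 by (auto simp: field_simps)
  qed
  have main: "M * e + k1 * f1 + k2 * f2 + f3 + d * f4 \<le> - (c / 4) * (Z + U + W + Y + S)"
    if M: "M \<ge> M0" and nn: "Z \<ge> 0" "U \<ge> 0" "W \<ge> 0" "Y \<ge> 0" "S \<ge> 0" "b \<ge> 0" and e: "e = - 2 * a * Z"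
      and f1: "\<And>\<eta>. 0 < \<eta> \<Longrightarrow> \<eta> \<le> 1 \<Longrightarrow> f1 \<le> - S / 2 + C / \<eta> * Z + \<eta> * U"
      and f2: "\<And>\<eta>. 0 < \<eta> \<Longrightarrow> \<eta> \<le> 1 \<Longrightarrow> f2 \<le> - c * U + \<eta> * (W + Y + b) + C / \<eta> * (S + Z)"
      and f3: "f3 \<le> - c * (W + Y) + C * (S + U)"
      and f4: "f4 \<le> - c * b + C * (Z + U + W + Y + S)" for M Z U W Y S b e f1 f2 f3 f4 :: real
  proof -
    define A where "A = k1 * (C / n1)"
    define B where "B = k2 * (C / n2)"
    have "M0 * (2 * a) = A + B + c / 2" using assms(1) by (simp add: M0_def A_def B_def)
    then have "2 * a * M \<ge> A + B + c / 2"
      using mult_right_mono[OF M, of "2 * a"] assms(1) by (simp add: mult.commute)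
    then have cZ: "(A + B + d * C - 2 * a * M) * Z \<le> - (c / 4) * Z"
      using d by (intro mult_right_mono nn) auto
    have cU: "(k1 * n1 - k2 * c + C + d * C) * U \<le> - (c / 4) * U"
      using k1n1 k2 d assms by (intro mult_right_mono nn) auto
    have "k2 * n2 - c + d * C \<le> - (c / 4)" using k2n2 d assms by linarith
    then have cW: "(k2 * n2 - c + d * C) * W \<le> - (c / 4) * W" and cY: "(k2 * n2 - c + d * C) * Y \<le> - (c / 4) * Y"
      by (intro mult_right_mono nn; simp)+
    \<comment> \<open>The trace is not part of the energy, so it only has to be cancelled, not
      dominated.\<close>
    have cb: "(k2 * n2 - d * c) * b \<le> 0 * b"
      using k2n2 by (intro mult_right_mono nn) auto
    have "k1 = 2 * (B + C + c / 2)" by (simp add: k1_def B_def)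
    then have "- k1 / 2 + B + C + d * C \<le> - (c / 4)" using d by argo
    then have cS: "(- k1 / 2 + B + C + d * C) * S \<le> - (c / 4) * S"
      by (intro mult_right_mono nn)
    have "k1 * f1 \<le> k1 * (- S / 2 + C / n1 * Z + n1 * U)"
      using f1[OF n1] k1 by (intro mult_left_mono) auto
    also have "\<dots> = - k1 / 2 * S + A * Z + (k1 * n1) * U" by (simp add: A_def algebra_simps)
    finally have g1: "k1 * f1 \<le> - k1 / 2 * S + A * Z + (k1 * n1) * U" .
    have "k2 * f2 \<le> k2 * (- c * U + n2 * (W + Y + b) + C / n2 * (S + Z))"
      using f2[OF n2] k2 by (intro mult_left_mono) auto
    also have "\<dots> = - (k2 * c) * U + (k2 * n2) * (W + Y + b) + B * (S + Z)" by (simp add: B_def algebra_simps)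
    finally have g2: "k2 * f2 \<le> - (k2 * c) * U + (k2 * n2) * (W + Y + b) + B * (S + Z)" .
    have "d * f4 \<le> d * (- c * b + C * (Z + U + W + Y + S))"
      using f4 d by (intro mult_left_mono) auto
    also have "\<dots> = - (d * c) * b + (d * C) * (Z + U + W + Y + S)" by (simp add: algebra_simps)
    finally have g4: "d * f4 \<le> - (d * c) * b + (d * C) * (Z + U + W + Y + S)" .
    have "M * e + k1 * f1 + k2 * f2 + f3 + d * f4 \<le> M * (- 2 * a * Z) + (- k1 / 2 * S + A * Z + (k1 * n1) * U)
       + (- (k2 * c) * U + (k2 * n2) * (W + Y + b) + B * (S + Z)) + (- c * (W + Y) + C * (S + U))
       + (- (d * c) * b + (d * C) * (Z + U + W + Y + S))"
      unfolding e using g1 g2 f3 g4 by linarith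
    also have "\<dots> = (A + B + d * C - 2 * a * M) * Z + (k1 * n1 - k2 * c + C + d * C) * U
       + (k2 * n2 - c + d * C) * W + (k2 * n2 - c + d * C) * Y + (- k1 / 2 + B + C + d * C) * S + (k2 * n2 - d * c) * b"
      by (simp add: algebra_simps)
    also have "\<dots> \<le> - (c / 4) * Z + - (c / 4) * U + - (c / 4) * W + - (c / 4) * Y + - (c / 4) * S + 0 * b"
      using cZ cU cW cY cS cb by linarith
    finally show ?thesis by (simp only: distrib_left mult_zero_left add_0_right)
  qed
  show ?thesis
    by (rule that[of k1 k2 d "c / 4" M0]) (use k1 k2 d assms main in \<open>auto\<close>)
qed

context piezo_beam begin

definition F1 :: "state \<Rightarrow> state \<Rightarrow> real" where "F1 U V = \<rho> * ip L (st_z U) (potential V)"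
definition F2 :: "state \<Rightarrow> state \<Rightarrow> real" where "F2 U V = ip L (st_u1 U) (potential V)"
text \<open>The sign is written as a scalar factor to match the closure rule for multiples of
  bounded forms.\<close>

definition F3 :: "state \<Rightarrow> state \<Rightarrow> real" where "F3 U V = - 1 * ip L (st_u1 U) (st_u2 V)"
text \<open>The relative factor of the two multipliers gives the cross terms x s_x u3 and x u3_x s
  the same coefficient \<gamma>/\<alpha>, so together they integrate exactly.\<close>

definition F4 :: "state \<Rightarrow> state \<Rightarrow> real" where
  "F4 U V = - \<rho> * ip L (xw (st_z U)) (v_x V) + \<xi> * \<epsilon>\<^sub>3 * ip L (xw (st_u1 U)) (u2_x V)"

lemma bounded_map_xw: "bounded_map l \<Longrightarrow> bounded_map (\<lambda>U. xw (l U))"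
  unfolding xw_def by (rule bounded_map_weight[where w="\<lambda>x. x"]) auto

lemma bounded_form_F: "bounded_form F1" "bounded_form F2" "bounded_form F3" "bounded_form F4"
  unfolding F1_def[abs_def] F2_def[abs_def] F3_def[abs_def] F4_def[abs_def]
  by (intro bounded_form_add bounded_form_cmult bounded_form_ip bounded_map_xw bounded_map_comp bounded_map_potential bounded_map_u2_x)+

text \<open>Stress and u1 vanish at L, so only the traces of u3 and z survive, both with negative
  coefficient.\<close>

lemma F4_deriv:
  assumes U: "U \<in> D"
  shows "F4 (G U) U + F4 U (G U) =
    (ip L (stress U) (stress U) / 2 - \<gamma> * ip L (stress U) (st_u3 U)
       - \<epsilon>\<^sub>3 * \<alpha>1 / 2 * (L * (cmod (val L (st_u3 U) L))\<^sup>2 - ip L (st_u3 U) (st_u3 U))) / \<alpha>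
     + a * ip L (xw (st_z U)) (v_x U) + \<xi> * \<epsilon>\<^sub>3 * ip L (xw (st_u2 U)) (u2_x U)
     - \<rho> / 2 * (L * (cmod (val L (st_z U) L))\<^sup>2 - ip L (st_z U) (st_z U)) + \<mu> / 2 * ip L (st_u1 U) (st_u1 U)"
proof -
  note l = D_L2[OF U] and d = D_D[OF U] and s = stress_H1[OF U]
  let ?S = "ip L (stress U) (stress U)" and ?SY = "ip L (stress U) (st_u3 U)" and ?Y = "ip L (st_u3 U) (st_u3 U)"
  have z: "ip L (xw (st_z U)) (wd L (st_z U)) = (L * (cmod (val L (st_z U) L))\<^sup>2 - ip L (st_z U) (st_z U)) / 2"
    using H1_by_parts_xw_self[OF pos(1) d(2)] ip_xw[of L "st_z U" "wd L (st_z U)"] by simp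
  have u1: "ip L (xw (st_u1 U)) (wd L (st_u1 U)) = - ip L (st_u1 U) (st_u1 U) / 2"
    using H1_by_parts_xw_self[OF pos(1) d(5)] ip_xw[of L "st_u1 U" "wd L (st_u1 U)"] d(7) by simp
  have sself: "ip L (xw (wd L (stress U))) (stress U) = - ?S / 2"
    using H1_by_parts_xw_self[OF pos(1) s(1)] s(3) by simp
  have sy: "ip L (xw (wd L (stress U))) (st_u3 U) + ip L (xw (wd L (st_u3 U))) (stress U) = - ?SY"
    using H1_by_parts_xw[OF pos(1) s(1) d(8)] s(3) by simp
  have y: "ip L (xw (wd L (st_u3 U))) (st_u3 U) = (L * (cmod (val L (st_u3 U) L))\<^sup>2 - ?Y) / 2"
    by (rule H1_by_parts_xw_self[OF pos(1) d(8)])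
  have zG: "\<rho> * ip L (xw (st_z (G U))) (v_x U) = ip L (xw (wd L (stress U))) (v_x U) - a * ip L (xw (st_z U)) (v_x U)"
    using ip_cz_G[OF U xw_L2[OF l(2)]] by (simp add: ip_xw[of L "st_z (G U)" "v_x U"] ip_xw[of L "st_z U" "v_x U"]
      ip_xw[of L "wd L (stress U)" "v_x U"] ip_commute[of L "xw (v_x U)"])
  have p: "ip L (xw (wd L (stress U))) (v_x U) = 1 / \<alpha> * ip L (xw (wd L (stress U))) (stress U) + - (\<gamma> / \<alpha>) * ip L (xw (wd L (stress U))) (st_u3 U)"
    unfolding v_x_eq[of U] by (simp only: ip_linear L2_rules l xw_L2)
  have q: "ip L (xw (wd L (st_u3 U))) (u2_x U) = \<alpha>1 / (\<alpha> * \<xi>) * ip L (xw (wd L (st_u3 U))) (st_u3 U)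
      + - (\<gamma> / (\<alpha> * \<xi> * \<epsilon>\<^sub>3)) * ip L (xw (wd L (st_u3 U))) (stress U)"
    unfolding u2_x_eq[of U] by (simp only: ip_linear L2_rules l xw_L2)
  have u1G: "ip L (xw (st_u1 (G U))) (u2_x U) = ip L (xw (st_u2 U)) (u2_x U) - ip L (xw (wd L (st_u3 U))) (u2_x U)"
    unfolding G_comp xw_linear by (simp only: ip_linear L2_rules l xw_L2)
  have qG: "ip L (xw (st_u1 U)) (u2_x (G U)) = - (\<mu> / (\<xi> * \<epsilon>\<^sub>3)) * ip L (xw (st_u1 U)) (wd L (st_u1 U))"
    unfolding u2_x_G by (simp only: ip_linear)
  have "F4 (G U) U + F4 U (G U) = - ip L (xw (wd L (stress U))) (v_x U) + a * ip L (xw (st_z U)) (v_x U)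
      + \<xi> * \<epsilon>\<^sub>3 * (ip L (xw (st_u2 U)) (u2_x U) - ip L (xw (wd L (st_u3 U))) (u2_x U))
      - \<rho> * ip L (xw (st_z U)) (wd L (st_z U)) - \<mu> * ip L (xw (st_u1 U)) (wd L (st_u1 U))"
    unfolding F4_def u1G qG G_comp(1) using zG pos by (simp add: algebra_simps)
  also have "\<dots> = - (1 / \<alpha> * (- ?S / 2)) + \<gamma> / \<alpha> * (ip L (xw (wd L (stress U))) (st_u3 U) + ip L (xw (wd L (st_u3 U))) (stress U))
      - \<epsilon>\<^sub>3 * \<alpha>1 / \<alpha> * ip L (xw (wd L (st_u3 U))) (st_u3 U)
      + a * ip L (xw (st_z U)) (v_x U) + \<xi> * \<epsilon>\<^sub>3 * ip L (xw (st_u2 U)) (u2_x U)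
      - \<rho> * ip L (xw (st_z U)) (wd L (st_z U)) - \<mu> * ip L (xw (st_u1 U)) (wd L (st_u1 U))"
    unfolding p q sself using pos by (simp add: field_simps)
  also have "\<dots> = (?S / 2 - \<gamma> * ?SY
       - \<epsilon>\<^sub>3 * \<alpha>1 / 2 * (L * (cmod (val L (st_u3 U) L))\<^sup>2 - ?Y)) / \<alpha>
     + a * ip L (xw (st_z U)) (v_x U) + \<xi> * \<epsilon>\<^sub>3 * ip L (xw (st_u2 U)) (u2_x U)
     - \<rho> / 2 * (L * (cmod (val L (st_z U) L))\<^sup>2 - ip L (st_z U) (st_z U)) + \<mu> / 2 * ip L (st_u1 U) (st_u1 U)"
    unfolding sy y z u1 using pos by (simp add: field_simps)
  finally show ?thesis .
qed

lemma potential_bounds: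
  assumes U: "U \<in> X"
  shows "ip L (potential U) (potential U) \<le> (nm L (\<lambda>_. 1)) ^ 4 * ip L (stress U) (stress U)"
    "(cmod (val L (potential U) L))\<^sup>2 \<le> (nm L (\<lambda>_. 1))\<^sup>2 * ip L (stress U) (stress U)"
proof -
  note r = potential_H1[OF U]
  have e: "nm L (wd L (potential U)) = nm L (stress U)"
    by (rule nm_cong_AE[OF wd_weak(1)[OF r(1)] bounded_map_L2[OF bounded_map_stress U] r(2)])
  have "(nm L (potential U))\<^sup>2 \<le> ((nm L (\<lambda>_. 1))\<^sup>2 * nm L (stress U))\<^sup>2"
    using poincare(1)[OF pos(1) r(1,3)] unfolding e by (intro power_mono nm_nonneg)
  then have "ip L (potential U) (potential U) \<le> ((nm L (\<lambda>_. 1))\<^sup>2)\<^sup>2 * ip L (stress U) (stress U)"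
    by (simp only: power_mult_distrib nm_sq[of L "potential U"] nm_sq[of L "stress U"])
  then show "ip L (potential U) (potential U) \<le> (nm L (\<lambda>_. 1)) ^ 4 * ip L (stress U) (stress U)"
    by (simp only: power_mult[symmetric]) simp
  have "(cmod (val L (potential U) L))\<^sup>2 \<le> (nm L (\<lambda>_. 1) * nm L (stress U))\<^sup>2"
    using poincare(2)[OF pos(1) r(1,3) L_le] unfolding e by (intro power_mono) auto
  then show "(cmod (val L (potential U) L))\<^sup>2 \<le> (nm L (\<lambda>_. 1))\<^sup>2 * ip L (stress U) (stress U)"
    by (simp add: power_mult_distrib nm_sq)
qed

section \<open>Estimates by Young's inequality\<close>

lemma le_divide_unit: "0 \<le> x \<Longrightarrow> 0 < \<eta> \<Longrightarrow> \<eta> \<le> 1 \<Longrightarrow> x \<le> x / (\<eta>::real)"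
  by (simp add: le_divide_eq mult_left_le)

lemma F1_estimate:
  "\<exists>C\<ge>0. \<forall>U\<in>D. \<forall>\<eta>. 0 < \<eta> \<and> \<eta> \<le> 1 \<longrightarrow>
     F1 (G U) U + F1 U (G U) \<le> - ip L (stress U) (stress U) / 2 + C / \<eta> * ip L (st_z U) (st_z U) + \<eta> * ip L (st_u1 U) (st_u1 U)"
proof -
  define R where "R = nm L (\<lambda>_. 1) ^ 4"
  define m where "m = \<rho> * (\<gamma> * \<mu> / \<epsilon>\<^sub>3)"
  \<comment> \<open>Chosen so that the Young term in the potential costs at most half of the gained
    S; R + 1 keeps the denominator positive.\<close>
  define n0 where "n0 = 1 / (2 * a * (R + 1))"
  define C where "C = a / (4 * n0) + \<rho> * \<alpha>1 + m\<^sup>2 / 4"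
  have R: "R \<ge> 0" by (simp add: R_def nm_nonneg)
  have m: "m > 0" using pos by (simp add: m_def)
  have n0: "n0 > 0" using pos R by (simp add: n0_def)
  have "a * (n0 * R) = R / (2 * (R + 1))" using pos by (simp add: n0_def)
  then have an0: "a * (n0 * R) \<le> 1 / 2" using R by (simp add: divide_le_eq)
  have C: "a / (4 * n0) + \<rho> * \<alpha>1 \<ge> 0" using pos \<alpha>1_pos n0 by simp
  show ?thesis
  proof (intro exI conjI ballI allI impI)
    show "C \<ge> 0" using C by (simp add: C_def)
    fix U \<eta> assume U: "U \<in> D" and \<eta>: "0 < \<eta> \<and> \<eta> \<le> (1::real)"
    note l = D_L2[OF U]
    define Z where "Z = ip L (st_z U) (st_z U)"
    define V where "V = ip L (st_u1 U) (st_u1 U)"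
    define S where "S = ip L (stress U) (stress U)"
    have nn: "Z \<ge> 0" "S \<ge> 0" by (simp_all add: Z_def S_def ip_self_nonneg)
    have "\<bar>ip L (potential U) (st_z U)\<bar> \<le> n0 * (R * S) + Z / (4 * n0)"
      using ip_young[OF l(12,3) n0] mult_left_mono[OF potential_bounds(1)[OF D_D(1)[OF U]] less_imp_le[OF n0]]
      unfolding R_def S_def Z_def by linarith
    then have "a * \<bar>ip L (potential U) (st_z U)\<bar> \<le> a * (n0 * (R * S) + Z / (4 * n0))"
      using pos by (intro mult_left_mono) auto
    also have "\<dots> = (a * (n0 * R)) * S + a / (4 * n0) * Z" by (simp add: algebra_simps)
    also have "\<dots> \<le> 1 / 2 * S + a / (4 * n0) * Z" by (intro add_right_mono mult_right_mono an0 nn)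
    finally have 1: "a * \<bar>ip L (potential U) (st_z U)\<bar> \<le> 1 / 2 * S + a / (4 * n0) * Z" .
    \<comment> \<open>The parameter \<eta>/m makes the cost in u1 exactly \<eta> after
      multiplication by m.\<close>
    have "\<bar>ip L (st_u1 U) (st_z U)\<bar> \<le> (\<eta> / m) * V + Z / (4 * (\<eta> / m))"
      unfolding V_def Z_def by (rule ip_young[OF l(4,3)]) (use \<eta> m in simp)
    then have "m * \<bar>ip L (st_u1 U) (st_z U)\<bar> \<le> m * ((\<eta> / m) * V + Z / (4 * (\<eta> / m)))"
      using m by (intro mult_left_mono) auto
    also have "\<dots> = \<eta> * V + m\<^sup>2 / 4 / \<eta> * Z" using m \<eta> by (simp add: field_simps power2_eq_square)
    finally have 2: "m * \<bar>ip L (st_u1 U) (st_z U)\<bar> \<le> \<eta> * V + m\<^sup>2 / 4 / \<eta> * Z" .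
    \<comment> \<open>As \<eta> is at most 1, terms without \<eta> are enlarged to the common form
      C/\<eta>.\<close>
    have 3: "(a / (4 * n0) + \<rho> * \<alpha>1) * Z \<le> (a / (4 * n0) + \<rho> * \<alpha>1) / \<eta> * Z"
      by (intro mult_right_mono le_divide_unit C nn) (use \<eta> in auto)
    have "F1 (G U) U + F1 U (G U) = - S - a * ip L (potential U) (st_z U) + \<rho> * \<alpha>1 * Z - m * ip L (st_u1 U) (st_z U)"
      unfolding F1_def F1_deriv[OF U] S_def Z_def m_def
      by (simp add: ip_commute[of L "st_z U" "potential U"] ip_commute[of L "st_z U" "st_u1 U"])
    also have "\<dots> \<le> - S + a * \<bar>ip L (potential U) (st_z U)\<bar> + \<rho> * \<alpha>1 * Z + m * \<bar>ip L (st_u1 U) (st_z U)\<bar>"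
    proof -
      have "- (a * ip L (potential U) (st_z U)) \<le> a * \<bar>ip L (potential U) (st_z U)\<bar>"
        "- (m * ip L (st_u1 U) (st_z U)) \<le> m * \<bar>ip L (st_u1 U) (st_z U)\<bar>"
        using pos(8) m abs_ge_minus_self[of "a * ip L (potential U) (st_z U)"] abs_ge_minus_self[of "m * ip L (st_u1 U) (st_z U)"]
        by (simp_all add: abs_mult)
      then show ?thesis by linarith
    qed
    also have "\<dots> \<le> - S + (1 / 2 * S + a / (4 * n0) * Z) + \<rho> * \<alpha>1 * Z + (\<eta> * V + m\<^sup>2 / 4 / \<eta> * Z)"
      using 1 2 by linarith
    also have "\<dots> = - S / 2 + (a / (4 * n0) + \<rho> * \<alpha>1) * Z + m\<^sup>2 / 4 / \<eta> * Z + \<eta> * V" by (simp add: algebra_simps)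
    also have "\<dots> \<le> - S / 2 + (a / (4 * n0) + \<rho> * \<alpha>1) / \<eta> * Z + m\<^sup>2 / 4 / \<eta> * Z + \<eta> * V"
      using 3 by linarith
    also have "\<dots> = - S / 2 + C / \<eta> * Z + \<eta> * V" by (simp add: C_def add_divide_distrib algebra_simps)
    finally show "F1 (G U) U + F1 U (G U) \<le> - ip L (stress U) (stress U) / 2 + C / \<eta> * ip L (st_z U) (st_z U) + \<eta> * ip L (st_u1 U) (st_u1 U)"
      by (simp only: S_def Z_def V_def)
  qed
qed

text \<open>The terms in u2, u3 and the trace of u3 are all paired with quantities bounded by the
  stress, so each can be made small at the price of a large multiple of S.\<close>

lemma F2_estimate:
  "\<exists>C\<ge>0. \<exists>c>0. \<forall>U\<in>D. \<forall>\<eta>. 0 < \<eta> \<and> \<eta> \<le> 1 \<longrightarrow>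
     F2 (G U) U + F2 U (G U) \<le> - c * ip L (st_u1 U) (st_u1 U)
       + \<eta> * (ip L (st_u2 U) (st_u2 U) + ip L (st_u3 U) (st_u3 U) + (cmod (val L (st_u3 U) L))\<^sup>2)
       + C / \<eta> * (ip L (stress U) (stress U) + ip L (st_z U) (st_z U))"
proof -
  define r where "r = nm L (\<lambda>_. 1)"
  define k where "k = \<gamma> * \<mu> / \<epsilon>\<^sub>3"
  define C where "C = (r ^ 4 + 1 + r\<^sup>2) / 4 + \<alpha>1\<^sup>2 / (2 * k)"
  have k: "k > 0" using pos by (simp add: k_def)
  have r: "r \<ge> 0" by (simp add: r_def nm_nonneg)
  have C0: "(r ^ 4 + 1 + r\<^sup>2) / 4 \<ge> 0" "\<alpha>1\<^sup>2 / (2 * k) \<ge> 0" using r k by auto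
  show ?thesis
  proof (intro exI conjI ballI allI impI)
    show "C \<ge> 0" using C0 by (simp add: C_def)
    show "k / 2 > 0" using k by simp
    fix U \<eta> assume U: "U \<in> D" and \<eta>': "0 < \<eta> \<and> \<eta> \<le> (1::real)"
    then have \<eta>: "0 < \<eta>" "\<eta> \<le> 1" by auto
    note l = D_L2[OF U]
    define Z where "Z = ip L (st_z U) (st_z U)"
    define V where "V = ip L (st_u1 U) (st_u1 U)"
    define W where "W = ip L (st_u2 U) (st_u2 U)"
    define Y where "Y = ip L (st_u3 U) (st_u3 U)"
    define S where "S = ip L (stress U) (stress U)"
    define b where "b = (cmod (val L (st_u3 U) L))\<^sup>2"
    have nn: "Z \<ge> 0" "S \<ge> 0" by (simp_all add: Z_def S_def ip_self_nonneg)
    have 1: "ip L (st_u2 U) (potential U) \<le> \<eta> * W + r ^ 4 * S / (4 * \<eta>)"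
    proof -
      have "ip L (st_u2 U) (potential U) \<le> \<eta> * W + ip L (potential U) (potential U) / (4 * \<eta>)"
        using ip_young[OF l(5,12) \<eta>(1)] by (simp add: W_def)
      moreover have "ip L (potential U) (potential U) / (4 * \<eta>) \<le> r ^ 4 * S / (4 * \<eta>)"
        using potential_bounds(1)[OF D_D(1)[OF U]] \<eta> by (intro divide_right_mono) (auto simp: r_def S_def)
      ultimately show ?thesis by linarith
    qed
    have 2: "ip L (st_u3 U) (stress U) \<le> \<eta> * Y + S / (4 * \<eta>)"
      using ip_young[OF l(6,11) \<eta>(1)] by (simp add: Y_def S_def)
    have 3: "- Re (val L (st_u3 U) L * cnj (val L (potential U) L)) \<le> \<eta> * b + r\<^sup>2 * S / (4 * \<eta>)"
    proof -
      let ?A = "cmod (val L (st_u3 U) L)" and ?B = "cmod (val L (potential U) L)"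
      have "- Re (val L (st_u3 U) L * cnj (val L (potential U) L)) \<le> cmod (val L (st_u3 U) L * cnj (val L (potential U) L))"
        using abs_Re_le_cmod[of "val L (st_u3 U) L * cnj (val L (potential U) L)"] by linarith
      also have "\<dots> = ?A * ?B" by (simp add: norm_mult)
      also have "\<dots> \<le> \<eta> * ?A\<^sup>2 + ?B\<^sup>2 / (4 * \<eta>)"
      proof -
        have "0 \<le> (2 * \<eta> * ?A - ?B)\<^sup>2 / (4 * \<eta>)" using \<eta> by simp
        also have "\<dots> = \<eta> * ?A\<^sup>2 + ?B\<^sup>2 / (4 * \<eta>) - ?A * ?B"
          using \<eta> by (simp add: field_simps power2_eq_square)
        finally show ?thesis by simp
      qed
      also have "\<dots> \<le> \<eta> * b + r\<^sup>2 * S / (4 * \<eta>)"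
        using potential_bounds(2)[OF D_D(1)[OF U]] \<eta> unfolding b_def
        by (intro add_left_mono divide_right_mono) (auto simp: r_def S_def)
      finally show ?thesis .
    qed
    \<comment> \<open>Half of the gain k in u1 is spent on the cross term with z; the other half is
      the constant c of the statement.\<close>
    have 4: "\<alpha>1 * ip L (st_u1 U) (st_z U) \<le> k / 2 * V + \<alpha>1\<^sup>2 / (2 * k) * Z"
    proof -
      have "ip L (st_u1 U) (st_z U) \<le> k / (2 * \<alpha>1) * V + Z / (4 * (k / (2 * \<alpha>1)))"
        using ip_young[OF l(4,3), of "k / (2 * \<alpha>1)"] k \<alpha>1_pos by (simp add: V_def Z_def)
      then have "\<alpha>1 * ip L (st_u1 U) (st_z U) \<le> \<alpha>1 * (k / (2 * \<alpha>1) * V + Z / (4 * (k / (2 * \<alpha>1))))"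
        using \<alpha>1_pos by (intro mult_left_mono) auto
      also have "\<dots> = k / 2 * V + \<alpha>1\<^sup>2 / (2 * k) * Z" using k \<alpha>1_pos by (simp add: field_simps power2_eq_square)
      finally show ?thesis .
    qed
    have "F2 (G U) U + F2 U (G U) = ip L (st_u2 U) (potential U) + ip L (st_u3 U) (stress U) - Re (val L (st_u3 U) L * cnj (val L (potential U) L))
      - k * V + \<alpha>1 * ip L (st_u1 U) (st_z U)"
      unfolding F2_def F2_deriv[OF U] k_def V_def ..
    also have "\<dots> \<le> (\<eta> * W + r ^ 4 * S / (4 * \<eta>)) + (\<eta> * Y + S / (4 * \<eta>)) + (\<eta> * b + r\<^sup>2 * S / (4 * \<eta>))
      - k * V + (k / 2 * V + \<alpha>1\<^sup>2 / (2 * k) * Z)"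
      using 1 2 3 4 by linarith
    also have "\<dots> = - (k / 2) * V + \<eta> * (W + Y + b) + (r ^ 4 + 1 + r\<^sup>2) / 4 / \<eta> * S + \<alpha>1\<^sup>2 / (2 * k) * Z"
      using \<eta> by (simp add: field_simps)
    also have "\<dots> \<le> - (k / 2) * V + \<eta> * (W + Y + b) + C / \<eta> * S + C / \<eta> * Z"
    proof -
      have "(r ^ 4 + 1 + r\<^sup>2) / 4 / \<eta> * S \<le> C / \<eta> * S"
        using C0 \<eta> nn by (intro mult_right_mono divide_right_mono) (auto simp: C_def)
      moreover have "\<alpha>1\<^sup>2 / (2 * k) \<le> C / \<eta>"
        using le_divide_unit[OF C0(2) \<eta>] divide_right_mono[of "\<alpha>1\<^sup>2 / (2 * k)" C \<eta>] C0 \<eta> by (simp add: C_def)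
      then have "\<alpha>1\<^sup>2 / (2 * k) * Z \<le> C / \<eta> * Z" using nn by (intro mult_right_mono)
      ultimately show ?thesis by linarith
    qed
    also have "\<dots> = - (k / 2) * V + \<eta> * (W + Y + b) + C / \<eta> * (S + Z)"
      by (simp only: distrib_left add.assoc)
    finally show "F2 (G U) U + F2 U (G U) \<le> - (k / 2) * ip L (st_u1 U) (st_u1 U)
       + \<eta> * (ip L (st_u2 U) (st_u2 U) + ip L (st_u3 U) (st_u3 U) + (cmod (val L (st_u3 U) L))\<^sup>2)
       + C / \<eta> * (ip L (stress U) (stress U) + ip L (st_z U) (st_z U))"
      by (simp only: S_def Z_def V_def W_def Y_def b_def)
  qed
qed

lemma F3_estimate:
  "\<exists>C\<ge>0. \<exists>c>0. \<forall>U\<in>D.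
     F3 (G U) U + F3 U (G U) \<le> - c * (ip L (st_u2 U) (st_u2 U) + ip L (st_u3 U) (st_u3 U))
       + C * (ip L (stress U) (stress U) + ip L (st_u1 U) (st_u1 U))"
proof -
  define k3 where "k3 = \<alpha>1 / (\<alpha> * \<xi>)"
  define k4 where "k4 = \<gamma> / (\<alpha> * \<xi> * \<epsilon>\<^sub>3)"
  define k5 where "k5 = \<mu> / (\<xi> * \<epsilon>\<^sub>3)"
  define c where "c = min 1 (k3 / 2)"
  define C where "C = k4\<^sup>2 / (2 * k3) + k5"
  have k: "k3 > 0" "k4 > 0" "k5 > 0" using pos \<alpha>1_pos by (simp_all add: k3_def k4_def k5_def)
  show ?thesis
  proof (intro exI conjI ballI)
    show "C \<ge> 0" using k by (simp add: C_def)
    show "c > 0" using k by (simp add: c_def)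
    fix U assume U: "U \<in> D"
    note l = D_L2[OF U]
    define V where "V = ip L (st_u1 U) (st_u1 U)"
    define W where "W = ip L (st_u2 U) (st_u2 U)"
    define Y where "Y = ip L (st_u3 U) (st_u3 U)"
    define S where "S = ip L (stress U) (stress U)"
    have nn: "V \<ge> 0" "W \<ge> 0" "Y \<ge> 0" "S \<ge> 0" by (simp_all add: V_def W_def Y_def S_def ip_self_nonneg)
    \<comment> \<open>The parameter spends half of the gain k3 in u3.\<close>
    have "ip L (st_u3 U) (stress U) \<le> k3 / (2 * k4) * Y + S / (4 * (k3 / (2 * k4)))"
      using ip_young[OF l(6,11), of "k3 / (2 * k4)"] k by (simp add: Y_def S_def)
    then have "k4 * ip L (st_u3 U) (stress U) \<le> k4 * (k3 / (2 * k4) * Y + S / (4 * (k3 / (2 * k4))))"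
      using k by (intro mult_left_mono) auto
    also have "\<dots> = k3 / 2 * Y + k4\<^sup>2 / (2 * k3) * S" using k by (simp add: field_simps power2_eq_square)
    finally have 1: "k4 * ip L (st_u3 U) (stress U) \<le> k3 / 2 * Y + k4\<^sup>2 / (2 * k3) * S" .
    have "F3 (G U) U + F3 U (G U) = - W - k3 * Y + k4 * ip L (st_u3 U) (stress U) + k5 * V"
      using F3_deriv[OF U] by (simp add: F3_def k3_def k4_def k5_def V_def W_def Y_def)
    also have "\<dots> \<le> - (1 * W) - (k3 / 2) * Y + k4\<^sup>2 / (2 * k3) * S + k5 * V" using 1 by (simp add: field_simps)
    also have "\<dots> \<le> - (c * W) - c * Y + C * S + C * V"
    proof -
      have "c * W \<le> 1 * W" "c * Y \<le> (k3 / 2) * Y" by (intro mult_right_mono nn, simp add: c_def)+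
      moreover have "k4\<^sup>2 / (2 * k3) * S \<le> C * S" "k5 * V \<le> C * V"
        using k by (intro mult_right_mono nn; simp add: C_def)+
      ultimately show ?thesis by linarith
    qed
    finally show "F3 (G U) U + F3 U (G U) \<le> - c * (ip L (st_u2 U) (st_u2 U) + ip L (st_u3 U) (st_u3 U))
       + C * (ip L (stress U) (stress U) + ip L (st_u1 U) (st_u1 U))"
      by (simp add: V_def W_def Y_def S_def algebra_simps)
  qed
qed

lemma F4_estimate:
  "\<exists>C\<ge>0. \<exists>c>0. \<forall>U\<in>D.
     F4 (G U) U + F4 U (G U) \<le> - c * (cmod (val L (st_u3 U) L))\<^sup>2
       + C * (ip L (st_z U) (st_z U) + ip L (st_u1 U) (st_u1 U) + ip L (st_u2 U) (st_u2 U) + ip L (st_u3 U) (st_u3 U) + ip L (stress U) (stress U))"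
proof -
  define k3 where "k3 = \<alpha>1 / (\<alpha> * \<xi>)"
  define k4 where "k4 = \<gamma> / (\<alpha> * \<xi> * \<epsilon>\<^sub>3)"
  define c where "c = \<epsilon>\<^sub>3 * \<alpha>1 * L / (2 * \<alpha>)"
  define d where "d = \<epsilon>\<^sub>3 * \<alpha>1 / (2 * \<alpha>)"
  define e where "e = \<xi> * \<epsilon>\<^sub>3"
  define C where "C = 1 / (2 * \<alpha>) + \<gamma> / \<alpha> + d + a / \<alpha> * (L\<^sup>2 + 1) + a * \<gamma> / \<alpha> * (L\<^sup>2 + 1)
     + e * k3 * (L\<^sup>2 + 1) + e * k4 * (L\<^sup>2 + 1) + \<rho> / 2 + \<mu> / 2"
  have k: "k3 > 0" "k4 > 0" "d > 0" "e > 0" using pos \<alpha>1_pos by (simp_all add: k3_def k4_def d_def e_def)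
  have t: "1 / (2 * \<alpha>) \<ge> 0" "\<gamma> / \<alpha> \<ge> 0" "d \<ge> 0" "a / \<alpha> * (L\<^sup>2 + 1) \<ge> 0" "a * \<gamma> / \<alpha> * (L\<^sup>2 + 1) \<ge> 0"
     "e * k3 * (L\<^sup>2 + 1) \<ge> 0" "e * k4 * (L\<^sup>2 + 1) \<ge> 0" "\<rho> / 2 \<ge> 0" "\<mu> / 2 \<ge> 0"
    using pos k by simp_all
  show ?thesis
  proof (intro exI conjI ballI)
    show "C \<ge> 0" using t unfolding C_def by linarith
    show "c > 0" using pos \<alpha>1_pos by (simp add: c_def)
    fix U assume U: "U \<in> D"
    note l = D_L2[OF U]
    define Z where "Z = ip L (st_z U) (st_z U)"
    define V where "V = ip L (st_u1 U) (st_u1 U)"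
    define W where "W = ip L (st_u2 U) (st_u2 U)"
    define Y where "Y = ip L (st_u3 U) (st_u3 U)"
    define S where "S = ip L (stress U) (stress U)"
    define b where "b = (cmod (val L (st_u3 U) L))\<^sup>2"
    define E where "E = Z + V + W + Y + S"
    have nn: "Z \<ge> 0" "V \<ge> 0" "W \<ge> 0" "Y \<ge> 0" "S \<ge> 0" by (simp_all add: Z_def V_def W_def Y_def S_def ip_self_nonneg)
    have le: "Z \<le> E" "V \<le> E" "W \<le> E" "Y \<le> E" "S \<le> E" "E \<ge> 0" using nn by (simp_all add: E_def)
    have half: "\<bar>ip L f g\<bar> \<le> (ip L f f + ip L g g) / 2" if "f \<in> L2 L" "g \<in> L2 L" for f g
      using ip_young[OF that, of "1/2"] by simp
    have w: "\<bar>ip L (xw f) g\<bar> \<le> (L\<^sup>2 + 1) * E" if "f \<in> L2 L" "g \<in> L2 L" "ip L f f \<le> E" "ip L g g \<le> E" for f g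
    proof -
      have "\<bar>ip L (xw f) g\<bar> \<le> (ip L (xw f) (xw f) + ip L g g) / 2" by (intro half xw_L2 that)
      also have "\<dots> \<le> (L\<^sup>2 * E + E) / 2"
        using ip_xw_le[OF less_imp_le[OF pos(1)] that(1)] mult_left_mono[OF that(3), of "L\<^sup>2"] that(4) by simp
      also have "\<dots> \<le> (L\<^sup>2 + 1) * E" using le(6) by (simp add: algebra_simps)
      finally show ?thesis .
    qed
    have sy: "\<bar>ip L (stress U) (st_u3 U)\<bar> \<le> E"
      using half[OF l(11,6)] le by (simp add: S_def Y_def)
    have zp: "ip L (xw (st_z U)) (v_x U) = 1 / \<alpha> * ip L (xw (st_z U)) (stress U) + - (\<gamma> / \<alpha>) * ip L (xw (st_z U)) (st_u3 U)"
      unfolding v_x_eq[of U] by (simp only: ip_linear L2_rules l xw_L2)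
    have wq: "ip L (xw (st_u2 U)) (u2_x U) = k3 * ip L (xw (st_u2 U)) (st_u3 U) + - k4 * ip L (xw (st_u2 U)) (stress U)"
      unfolding u2_x_eq[of U] k3_def k4_def by (simp only: ip_linear L2_rules l xw_L2)
    have bd: "r * x \<le> r * y" "- (r * x) \<le> r * y" if "r \<ge> 0" "\<bar>x\<bar> \<le> y" for r x y :: real
      using mult_left_mono[of x y r] mult_left_mono[of "-x" y r] that by auto
    have 1: "- (\<gamma> / \<alpha> * ip L (stress U) (st_u3 U)) \<le> \<gamma> / \<alpha> * E" by (rule bd(2)[OF t(2) sy])
    have 2: "a / \<alpha> * ip L (xw (st_z U)) (stress U) \<le> a / \<alpha> * ((L\<^sup>2 + 1) * E)"
      by (rule bd(1)[OF _ w]) (use pos l le in \<open>simp_all add: Z_def S_def\<close>)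
    have 3: "- (a * \<gamma> / \<alpha> * ip L (xw (st_z U)) (st_u3 U)) \<le> a * \<gamma> / \<alpha> * ((L\<^sup>2 + 1) * E)"
      by (rule bd(2)[OF _ w]) (use pos l le in \<open>simp_all add: Z_def Y_def\<close>)
    have 4: "e * k3 * ip L (xw (st_u2 U)) (st_u3 U) \<le> e * k3 * ((L\<^sup>2 + 1) * E)"
      by (rule bd(1)[OF _ w]) (use k l le in \<open>simp_all add: W_def Y_def\<close>)
    have 5: "- (e * k4 * ip L (xw (st_u2 U)) (stress U)) \<le> e * k4 * ((L\<^sup>2 + 1) * E)"
      by (rule bd(2)[OF _ w]) (use k l le in \<open>simp_all add: W_def S_def\<close>)
    have 6: "1 / (2 * \<alpha>) * S \<le> 1 / (2 * \<alpha>) * E" "d * Y \<le> d * E" "\<rho> / 2 * Z \<le> \<rho> / 2 * E" "\<mu> / 2 * V \<le> \<mu> / 2 * E"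
      by (intro mult_left_mono le t)+
    \<comment> \<open>The trace of z has the favourable sign and is dropped.\<close>
    have 7: "0 \<le> \<rho> / 2 * (L * (cmod (val L (st_z U) L))\<^sup>2)" using pos by simp
    have "F4 (G U) U + F4 U (G U) = 1 / (2 * \<alpha>) * S + - (\<gamma> / \<alpha> * ip L (stress U) (st_u3 U)) - c * b + d * Y
        + a / \<alpha> * ip L (xw (st_z U)) (stress U) + - (a * \<gamma> / \<alpha> * ip L (xw (st_z U)) (st_u3 U))
        + e * k3 * ip L (xw (st_u2 U)) (st_u3 U) + - (e * k4 * ip L (xw (st_u2 U)) (stress U))
        - \<rho> / 2 * (L * (cmod (val L (st_z U) L))\<^sup>2) + \<rho> / 2 * Z + \<mu> / 2 * V"
      unfolding F4_deriv[OF U] zp wq S_def[symmetric] Y_def[symmetric] Z_def[symmetric] V_def[symmetric] b_def[symmetric] e_def[symmetric] c_def d_def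
      using pos(3) by (simp add: field_simps)
    also have "\<dots> \<le> - c * b + (1 / (2 * \<alpha>) * E + \<gamma> / \<alpha> * E + d * E + a / \<alpha> * ((L\<^sup>2 + 1) * E)
        + a * \<gamma> / \<alpha> * ((L\<^sup>2 + 1) * E) + e * k3 * ((L\<^sup>2 + 1) * E) + e * k4 * ((L\<^sup>2 + 1) * E) + \<rho> / 2 * E + \<mu> / 2 * E)"
      using 1 2 3 4 5 6 7 by linarith
    also have "\<dots> = - c * b + C * E" unfolding C_def by (simp only: distrib_right mult.assoc)
    finally show "F4 (G U) U + F4 U (G U) \<le> - c * (cmod (val L (st_u3 U) L))\<^sup>2
       + C * (ip L (st_z U) (st_z U) + ip L (st_u1 U) (st_u1 U) + ip L (st_u2 U) (st_u2 U) + ip L (st_u3 U) (st_u3 U) + ip L (stress U) (stress U))"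
      by (simp only: S_def Z_def V_def W_def Y_def b_def E_def)
  qed
qed

lemma Q_le_sum:
  assumes U: "U \<in> D"
  shows "Q U U \<le> (2 / \<alpha> + 2 * \<gamma>\<^sup>2 / \<alpha> + \<rho> + \<mu> + \<xi> * \<epsilon>\<^sub>3 + \<epsilon>\<^sub>3) *
    (ip L (st_z U) (st_z U) + ip L (st_u1 U) (st_u1 U) + ip L (st_u2 U) (st_u2 U) + ip L (st_u3 U) (st_u3 U) + ip L (stress U) (stress U))"
proof -
  note l = D_L2[OF U]
  define Z where "Z = ip L (st_z U) (st_z U)"
  define V where "V = ip L (st_u1 U) (st_u1 U)"
  define W where "W = ip L (st_u2 U) (st_u2 U)"
  define Y where "Y = ip L (st_u3 U) (st_u3 U)"
  define S where "S = ip L (stress U) (stress U)"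
  define E where "E = Z + V + W + Y + S"
  have nn: "Z \<ge> 0" "V \<ge> 0" "W \<ge> 0" "Y \<ge> 0" "S \<ge> 0" by (simp_all add: Z_def V_def W_def Y_def S_def ip_self_nonneg)
  have le: "Z \<le> E" "V \<le> E" "W \<le> E" "Y \<le> E" "S \<le> E" using nn by (simp_all add: E_def)
  \<comment> \<open>The companion of v_x with the opposite sign: by the parallelogram identity the
    cross terms cancel in the sum of the two squares.\<close>
  let ?m = "\<lambda>x. of_real (1 / \<alpha>) * stress U x + of_real (\<gamma> / \<alpha>) * st_u3 U x"
  have "ip L (v_x U) (v_x U) + ip L ?m ?m = 2 / \<alpha>\<^sup>2 * S + 2 * \<gamma>\<^sup>2 / \<alpha>\<^sup>2 * Y"
    unfolding v_x_eq[of U] S_def Y_def by (simp only: ip_linear L2_rules l)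
      (use pos in \<open>simp add: ip_commute[of L "st_u3 U" "stress U"] power2_eq_square field_simps\<close>)
  then have "ip L (v_x U) (v_x U) \<le> 2 / \<alpha>\<^sup>2 * S + 2 * \<gamma>\<^sup>2 / \<alpha>\<^sup>2 * Y"
    using ip_self_nonneg[of L ?m] by linarith
  then have "\<alpha> * ip L (v_x U) (v_x U) \<le> \<alpha> * (2 / \<alpha>\<^sup>2 * S + 2 * \<gamma>\<^sup>2 / \<alpha>\<^sup>2 * Y)"
    using pos by (intro mult_left_mono) auto
  also have "\<dots> = 2 / \<alpha> * S + 2 * \<gamma>\<^sup>2 / \<alpha> * Y" using pos by (simp add: field_simps power2_eq_square)
  also have "\<dots> \<le> 2 / \<alpha> * E + 2 * \<gamma>\<^sup>2 / \<alpha> * E"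
    using pos by (intro add_mono mult_left_mono le) auto
  finally have 1: "\<alpha> * ip L (v_x U) (v_x U) \<le> 2 / \<alpha> * E + 2 * \<gamma>\<^sup>2 / \<alpha> * E" .
  have "\<rho> * Z \<le> \<rho> * E" "\<mu> * V \<le> \<mu> * E" "\<xi> * \<epsilon>\<^sub>3 * W \<le> \<xi> * \<epsilon>\<^sub>3 * E" "\<epsilon>\<^sub>3 * Y \<le> \<epsilon>\<^sub>3 * E"
    using pos by (auto intro!: mult_left_mono le)
  with 1 have "Q U U \<le> 2 / \<alpha> * E + 2 * \<gamma>\<^sup>2 / \<alpha> * E + \<rho> * E + \<mu> * E + \<xi> * \<epsilon>\<^sub>3 * E + \<epsilon>\<^sub>3 * E"
    unfolding Q_def Z_def V_def W_def Y_def by linarith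
  then show ?thesis unfolding E_def Z_def V_def W_def Y_def S_def by (simp only: distrib_right)
qed

text \<open>A multiple M of the energy at least twice the bound K of the auxiliary part makes V
  comparable with the energy, between M/2 and 3M/2 times \<open>Q\<close>.\<close>

theorem lyapunov_functional:
  "\<exists>V m e. bounded_form V \<and> m > 0 \<and> e > 0 \<and> (\<forall>U\<in>X. m * Q U U \<le> V U U \<and> V U U \<le> 3 * m * Q U U) \<and>
     (\<forall>U\<in>D. V (G U) U + V U (G U) \<le> - e * V U U)"
proof -
  obtain C1 where C1: "C1 \<ge> 0" "\<And>U \<eta>. U \<in> D \<Longrightarrow> 0 < \<eta> \<Longrightarrow> \<eta> \<le> 1 \<Longrightarrow>
      F1 (G U) U + F1 U (G U) \<le> - ip L (stress U) (stress U) / 2 + C1 / \<eta> * ip L (st_z U) (st_z U) + \<eta> * ip L (st_u1 U) (st_u1 U)"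
    using F1_estimate by blast
  obtain C2 d2 where C2: "C2 \<ge> 0" "d2 > 0" "\<And>U \<eta>. U \<in> D \<Longrightarrow> 0 < \<eta> \<Longrightarrow> \<eta> \<le> 1 \<Longrightarrow>
      F2 (G U) U + F2 U (G U) \<le> - d2 * ip L (st_u1 U) (st_u1 U)
       + \<eta> * (ip L (st_u2 U) (st_u2 U) + ip L (st_u3 U) (st_u3 U) + (cmod (val L (st_u3 U) L))\<^sup>2)
       + C2 / \<eta> * (ip L (stress U) (stress U) + ip L (st_z U) (st_z U))"
    using F2_estimate by blast
  obtain C3 d3 where C3: "C3 \<ge> 0" "d3 > 0" "\<And>U. U \<in> D \<Longrightarrow>
      F3 (G U) U + F3 U (G U) \<le> - d3 * (ip L (st_u2 U) (st_u2 U) + ip L (st_u3 U) (st_u3 U))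
       + C3 * (ip L (stress U) (stress U) + ip L (st_u1 U) (st_u1 U))"
    using F3_estimate by blast
  obtain C4 d4 where C4: "C4 \<ge> 0" "d4 > 0" "\<And>U. U \<in> D \<Longrightarrow>
      F4 (G U) U + F4 U (G U) \<le> - d4 * (cmod (val L (st_u3 U) L))\<^sup>2
       + C4 * (ip L (st_z U) (st_z U) + ip L (st_u1 U) (st_u1 U) + ip L (st_u2 U) (st_u2 U) + ip L (st_u3 U) (st_u3 U) + ip L (stress U) (stress U))"
    using F4_estimate by blast
  define C where "C = C1 + C2 + C3 + C4"
  define c where "c = min d2 (min d3 d4)"
  have C: "C \<ge> 0" "C1 \<le> C" "C2 \<le> C" "C3 \<le> C" "C4 \<le> C" using C1(1) C2(1) C3(1) C4(1) by (simp_all add: C_def)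
  have c: "c > 0" "c \<le> d2" "c \<le> d3" "c \<le> d4" using C2(2) C3(2) C4(2) by (simp_all add: c_def)
  obtain k1 k2 k4 M0 l where k: "k1 \<ge> 0" "k2 \<ge> 0" "k4 \<ge> 0" "l > 0" and
    main: "\<And>M Z U W Y S b e f1 f2 f3 f4. M \<ge> M0 \<Longrightarrow> Z \<ge> 0 \<Longrightarrow> U \<ge> 0 \<Longrightarrow> W \<ge> 0 \<Longrightarrow> Y \<ge> 0 \<Longrightarrow> S \<ge> 0 \<Longrightarrow> b \<ge> 0 \<Longrightarrow>
       e = - 2 * a * Z \<Longrightarrow>
       (\<And>\<eta>. 0 < \<eta> \<Longrightarrow> \<eta> \<le> 1 \<Longrightarrow> f1 \<le> - S / 2 + C / \<eta> * Z + \<eta> * U) \<Longrightarrow>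
       (\<And>\<eta>. 0 < \<eta> \<Longrightarrow> \<eta> \<le> 1 \<Longrightarrow> f2 \<le> - c * U + \<eta> * (W + Y + b) + C / \<eta> * (S + Z)) \<Longrightarrow>
       f3 \<le> - c * (W + Y) + C * (S + U) \<Longrightarrow>
       f4 \<le> - c * b + C * (Z + U + W + Y + S) \<Longrightarrow>
       M * e + k1 * f1 + k2 * f2 + f3 + k4 * f4 \<le> - l * (Z + U + W + Y + S)"
    using lyapunov_coefficients[OF pos(8) c(1) C(1)] by metis
  define P where "P = (\<lambda>U V. k1 * F1 U V + k2 * F2 U V + F3 U V + k4 * F4 U V)"
  have bP: "bounded_form P" unfolding P_def by (intro bounded_form_add bounded_form_cmult bounded_form_F)
  obtain K where K: "K \<ge> 0" "\<And>U V. U \<in> X \<Longrightarrow> V \<in> X \<Longrightarrow> \<bar>P U V\<bar> \<le> K * N U * N V"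
    using bounded_form_bound[OF bP] by blast
  \<comment> \<open>The summand 1 keeps M positive also when K = 0.\<close>
  define M where "M = max M0 (2 * K + 1)"
  define V where "V = (\<lambda>U W. M * Q U W + P U W)"
  have M: "M \<ge> M0" "M \<ge> 2 * K + 1" "M > 0" using K(1) by (auto simp: M_def)
  have bV: "bounded_form V" unfolding V_def by (intro bounded_form_add bounded_form_cmult bounded_form_Q bP)
  define \<kappa> where "\<kappa> = 2 / \<alpha> + 2 * \<gamma>\<^sup>2 / \<alpha> + \<rho> + \<mu> + \<xi> * \<epsilon>\<^sub>3 + \<epsilon>\<^sub>3"
  have \<kappa>: "\<kappa> > 0" unfolding \<kappa>_def using pos by (intro add_pos_pos) auto
  have cmp: "M / 2 * Q U U \<le> V U U \<and> V U U \<le> 3 * (M / 2) * Q U U" if U: "U \<in> X" for U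
  proof -
    have "\<bar>P U U\<bar> \<le> K * Q U U" using K(2)[OF U U] N_sq[OF U] by (simp add: power2_eq_square mult.assoc)
    moreover have "K * Q U U \<le> M / 2 * Q U U" using M by (intro mult_right_mono Q_nonneg) auto
    ultimately show ?thesis unfolding V_def by (simp add: abs_le_iff)
  qed
  \<comment> \<open>The rate divides l by the two comparison constants: \<kappa> for
    \<open>Q\<close> against the sum of squares, 3M/2 for V against \<open>Q\<close>.\<close>
  have dec: "V (G U) U + V U (G U) \<le> - (l / (\<kappa> * (3 * (M / 2)))) * V U U" if U: "U \<in> D" for U
  proof -
    define S where "S = ip L (stress U) (stress U)"
    define b where "b = (cmod (val L (st_u3 U) L))\<^sup>2"
    define Z where "Z = ip L (st_z U) (st_z U)"
    define A where "A = ip L (st_u1 U) (st_u1 U)"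
    define W where "W = ip L (st_u2 U) (st_u2 U)"
    define Y where "Y = ip L (st_u3 U) (st_u3 U)"
    have nn: "Z \<ge> 0" "A \<ge> 0" "W \<ge> 0" "Y \<ge> 0" "S \<ge> 0" "b \<ge> 0"
      by (simp_all add: Z_def A_def W_def Y_def S_def b_def ip_self_nonneg)
    define e where "e = Q (G U) U + Q U (G U)"
    define f1 where "f1 = F1 (G U) U + F1 U (G U)"
    define f2 where "f2 = F2 (G U) U + F2 U (G U)"
    define f3 where "f3 = F3 (G U) U + F3 U (G U)"
    define f4 where "f4 = F4 (G U) U + F4 U (G U)"
    have "M * e + k1 * f1 + k2 * f2 + f3 + k4 * f4 \<le> - l * (Z + A + W + Y + S)"
    proof (rule main[OF M(1) nn])
      show "e = - 2 * a * Z" unfolding e_def Z_def by (rule Q_deriv[OF U])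
      show "f1 \<le> - S / 2 + C / \<eta> * Z + \<eta> * A" if \<eta>: "0 < \<eta>" "\<eta> \<le> 1" for \<eta>
      proof -
        have "C1 / \<eta> * Z \<le> C / \<eta> * Z" using \<eta> by (intro mult_right_mono divide_right_mono C nn) auto
        then show ?thesis using C1(2)[OF U \<eta>] unfolding f1_def S_def[symmetric] Z_def[symmetric] A_def[symmetric] by linarith
      qed
      show "f2 \<le> - c * A + \<eta> * (W + Y + b) + C / \<eta> * (S + Z)" if \<eta>: "0 < \<eta>" "\<eta> \<le> 1" for \<eta>
      proof -
        have "C2 / \<eta> * (S + Z) \<le> C / \<eta> * (S + Z)" using \<eta> by (intro mult_right_mono divide_right_mono C nn add_nonneg_nonneg) auto
        moreover have "c * A \<le> d2 * A" by (intro mult_right_mono c nn)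
        ultimately show ?thesis using C2(3)[OF U \<eta>]
          unfolding f2_def S_def[symmetric] Z_def[symmetric] A_def[symmetric] W_def[symmetric] Y_def[symmetric] b_def[symmetric] by linarith
      qed
      have "C3 * (S + A) \<le> C * (S + A)" "c * (W + Y) \<le> d3 * (W + Y)" "c * b \<le> d4 * b"
        "C4 * (Z + A + W + Y + S) \<le> C * (Z + A + W + Y + S)"
        by (intro mult_right_mono add_nonneg_nonneg C c nn)+
      then show "f3 \<le> - c * (W + Y) + C * (S + A)" "f4 \<le> - c * b + C * (Z + A + W + Y + S)"
        using C3(3)[OF U] C4(3)[OF U]
        unfolding f3_def f4_def S_def[symmetric] Z_def[symmetric] A_def[symmetric] W_def[symmetric] Y_def[symmetric] b_def[symmetric]
        by linarith+
    qed
    moreover have "V (G U) U + V U (G U) = M * e + k1 * f1 + k2 * f2 + f3 + k4 * f4"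
      by (simp add: V_def P_def e_def f1_def f2_def f3_def f4_def distrib_left)
    ultimately have 1: "V (G U) U + V U (G U) \<le> - l * (Z + A + W + Y + S)" by simp
    have "V U U \<le> 3 * (M / 2) * Q U U" using cmp[OF D_D(1)[OF U]] by blast
    also have "\<dots> \<le> 3 * (M / 2) * (\<kappa> * (Z + A + W + Y + S))"
      using Q_le_sum[OF U] M unfolding \<kappa>_def Z_def A_def W_def Y_def S_def by (intro mult_left_mono) auto
    finally have "V U U \<le> (\<kappa> * (3 * (M / 2))) * (Z + A + W + Y + S)" by (simp only: mult_ac)
    then have "l / (\<kappa> * (3 * (M / 2))) * V U U \<le> l / (\<kappa> * (3 * (M / 2))) * ((\<kappa> * (3 * (M / 2))) * (Z + A + W + Y + S))"
      using k \<kappa> M by (intro mult_left_mono) auto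
    also have "\<dots> = l * (Z + A + W + Y + S)" using \<kappa> M by simp
    finally show ?thesis using 1 by linarith
  qed
  have "l / (\<kappa> * (3 * (M / 2))) > 0" "M / 2 > 0" using k \<kappa> M by simp_all
  with bV cmp dec show ?thesis by blast
qed

end

section \<open>Density of the domain and exponential stability\<close>

lemma poly_cmult:
  fixes p :: "real \<Rightarrow> complex"
  assumes "polynomial_function p"
  shows "polynomial_function (\<lambda>x. c * p x)"
  using polynomial_function_compose[OF assms polynomial_function_bounded_linear[OF bounded_linear_mult_right[of c]]]
  by (simp add: o_def)

lemma poly_H1:
  fixes p :: "real \<Rightarrow> complex"
  assumes L: "L > 0" and p: "polynomial_function p"
  shows "p \<in> H1 L" "x \<in> {0..L} \<Longrightarrow> val L p x = p x"
proof -
  obtain p' where p': "polynomial_function p'" "\<And>x. (p has_vector_derivative p' x) (at x)"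
    using has_vector_derivative_polynomial_function[OF p] by blast
  note * = H1_C1[OF L continuous_on_polymonial_function[OF p'(1)] has_vector_derivative_at_within[OF p'(2)]]
  show "p \<in> H1 L" "x \<in> {0..L} \<Longrightarrow> val L p x = p x" using * by auto
qed

text \<open>Meant for the derivative of u2, whose mean is zero because u2 vanishes at both ends. The
  mean of an approximation is removed by a multiple of x (L - x), which keeps the zeros at the ends.
  As f has mean zero, that multiple is controlled by the approximation error.\<close>

lemma poly_approx_mean_zero:
  assumes L: "L > 0" and f: "f \<in> L2 L" and mean: "prim L 0 f L = 0" and e: "e > 0"
  obtains q :: "real \<Rightarrow> complex" where "polynomial_function q" "q 0 = 0" "q L = 0" "prim L 0 q L = 0" "nm L (\<lambda>x. f x - q x) < e"
proof -
  define g :: "real \<Rightarrow> complex" where "g = (\<lambda>x. of_real (x * (L - x)))"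
  \<comment> \<open>The integral of x (L - x) over the interval.\<close>
  define B where "B = L ^ 3 / 6"
  have B: "B > 0" using L by (simp add: B_def)
  have gp: "polynomial_function g"
  proof -
    have "real_polynomial_function (\<lambda>x::real. x * (L - x))"
      by (intro real_polynomial_function.intros(4) real_polynomial_function_diff real_polynomial_function.intros(2)
        real_polynomial_function.intros(1)[OF bounded_linear_ident])
    then have "polynomial_function (\<lambda>x. (x * (L - x)) *\<^sub>R (1::complex))"
      by (intro polynomial_function_mult) (auto simp: real_polynomial_function_eq)
    then show ?thesis by (simp add: g_def scaleR_conv_of_real)
  qed
  have gL: "g \<in> L2 L" by (rule poly_L2[OF gp])
  have pg: "prim L 0 g L = of_real B"
  proof -
    let ?G = "\<lambda>x. complex_of_real (L * x\<^sup>2 / 2 - x ^ 3 / 3)"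
    have "(?G has_vector_derivative g x) (at x within {0..L})" for x
    proof -
      have "((\<lambda>x. L * x\<^sup>2 / 2 - x ^ 3 / 3) has_real_derivative x * (L - x)) (at x within {0..L})"
        by (auto intro!: derivative_eq_intros simp: field_simps power2_eq_square)
      then show ?thesis unfolding g_def
        by (intro has_vector_derivative_of_real) (simp add: has_real_derivative_iff_has_vector_derivative)
    qed
    then have "prim L (?G 0) g L = ?G L"
      by (intro prim_of_C1 continuous_on_polymonial_function[OF gp]) (use L in auto)
    moreover have "L * L\<^sup>2 / 2 - L ^ 3 / 3 = B"
      by (simp add: B_def power2_eq_square power3_eq_cube)
    ultimately show ?thesis by simp
  qed
  \<comment> \<open>The factor by which the mean correction enlarges the error.\<close>
  define K where "K = 1 + nm L (\<lambda>_. 1) / B * nm L g"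
  have K: "K \<ge> 1" using B by (simp add: K_def nm_nonneg)
  then have "e / K > 0" using e by simp
  then obtain p where p: "polynomial_function p" "p 0 = 0" "p L = 0" "nm L (\<lambda>x. f x - p x) < e / K"
    using L2_poly_approx[OF L f] unfolding poly_approx_def by blast
  note pL = poly_L2[OF p(1)]
  define c where "c = prim L 0 p L / of_real B"
  define q where "q = (\<lambda>x. p x - c * g x)"
  have "polynomial_function (\<lambda>x. c * g x)"
    by (rule poly_cmult[OF gp])
  then have 1: "polynomial_function q" unfolding q_def by (intro polynomial_function_diff p(1))
  have 2: "q 0 = 0" "q L = 0" by (simp_all add: q_def p g_def)
  have "prim L 0 q L = prim L 0 p L - c * prim L 0 g L"
    unfolding q_def prim_def using pL gL
    by (simp add: cip_diff_left L2_scale cip_scale_left indicator_L2)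
  then have 3: "prim L 0 q L = 0" using B by (simp add: pg c_def)
  have "cmod (prim L 0 f L - prim L 0 p L) \<le> nm L (\<lambda>x. f x - p x) * nm L (\<lambda>_. 1)"
    by (rule prim_diff_bound[OF f pL])
  then have "cmod c \<le> nm L (\<lambda>x. f x - p x) * nm L (\<lambda>_. 1) / B"
    using B mean by (simp add: c_def norm_divide divide_right_mono)
  then have cb: "cmod c * nm L g \<le> nm L (\<lambda>x. f x - p x) * nm L (\<lambda>_. 1) / B * nm L g"
    by (intro mult_right_mono nm_nonneg)
  have "nm L (\<lambda>x. (f x - p x) + c * g x) \<le> nm L (\<lambda>x. f x - p x) + nm L (\<lambda>x. c * g x)"
    by (intro nm_triangle L2_diff L2_scale f pL gL)
  also have "\<dots> \<le> nm L (\<lambda>x. f x - p x) + nm L (\<lambda>x. f x - p x) * nm L (\<lambda>_. 1) / B * nm L g"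
    using cb by (simp add: nm_scale)
  also have "\<dots> = nm L (\<lambda>x. f x - p x) * K" by (simp add: K_def algebra_simps)
  also have "\<dots> < e" using p(4) K by (simp add: less_divide_eq)
  finally have 4: "nm L (\<lambda>x. f x - q x) < e" by (simp add: q_def algebra_simps)
  show ?thesis by (rule that[OF 1 2 3 4])
qed

context piezo_beam begin

text \<open>The constraint forbids approximating u3 separately: v_x and u2_x are approximated, and
  u3 is then dictated by them. All polynomials vanish at L, so the stress condition holds trivially
  there.\<close>

lemma D_dense:
  assumes U: "U \<in> X" and e: "e > 0"
  shows "\<exists>V\<in>D. N (U - V) < e"
proof -
  note u = X_D[OF U]
  define K where "K = \<alpha> + \<rho> + \<mu> + \<xi> * \<epsilon>\<^sub>3 * nm L (\<lambda>_. 1) ^ 4 + \<epsilon>\<^sub>3 * (\<xi> + \<gamma> / \<epsilon>\<^sub>3)\<^sup>2"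
  have K: "K \<ge> 0" unfolding K_def using pos by (intro add_nonneg_nonneg mult_nonneg_nonneg) (auto simp: nm_nonneg)
  define d where "d = e / (K + 1)"
  have d: "d > 0" using e K by (simp add: d_def)
  obtain pv where pv: "polynomial_function pv" "pv 0 = 0" "pv L = 0" "nm L (\<lambda>x. v_x U x - pv x) < d"
    using L2_poly_approx[OF pos(1) u(4)] d unfolding poly_approx_def by blast
  obtain pz where pz: "polynomial_function pz" "pz 0 = 0" "pz L = 0" "nm L (\<lambda>x. st_z U x - pz x) < d"
    using L2_poly_approx[OF pos(1) u(5)] d unfolding poly_approx_def by blast
  obtain p1 where p1: "polynomial_function p1" "p1 0 = 0" "p1 L = 0" "nm L (\<lambda>x. st_u1 U x - p1 x) < d"
    using L2_poly_approx[OF pos(1) u(6)] d unfolding poly_approx_def by blast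
  have wL: "wd L (st_u2 U) \<in> L2 L" by (rule wd_weak(1)[OF u(7)])
  have "prim L 0 (wd L (st_u2 U)) L = 0" using H1_prim(2)[OF pos(1) u(7) L_le] u(9,10) by simp
  then obtain q where q: "polynomial_function q" "q 0 = 0" "q L = 0" "prim L 0 q L = 0" "nm L (\<lambda>x. wd L (st_u2 U) x - q x) < d"
    using poly_approx_mean_zero[OF pos(1) wL _ d] by blast
  define y where "y = (\<lambda>x. of_real \<xi> * q x + of_real (\<gamma> / \<epsilon>\<^sub>3) * pv x)"
  define V :: state where "V = (prim L 0 pv, pz, p1, prim L 0 q, y)"
  have Vc: "st_v V = prim L 0 pv" "st_z V = pz" "st_u1 V = p1" "st_u2 V = prim L 0 q" "st_u3 V = y"
    by (simp_all add: V_def)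
  note pL = poly_L2[OF pv(1), of L] poly_L2[OF pz(1), of L] poly_L2[OF p1(1), of L] poly_L2[OF q(1), of L]
  have yp: "polynomial_function y" unfolding y_def
    by (intro polynomial_function_add poly_cmult q(1) pv(1))
  note yL = poly_L2[OF yp, of L]
  have v1: "prim L 0 pv \<in> H1 L" "AE x in intv L. wd L (prim L 0 pv) x = pv x" "val L (prim L 0 pv) 0 = 0"
    using H1_of_prim[OF pos(1) pL(1) prim_L2[OF pos(1) pL(1)], of 0 0] pos(1) by (simp_all add: prim_0 less_imp_le)
  have w1: "prim L 0 q \<in> H1 L" "AE x in intv L. wd L (prim L 0 q) x = q x" "val L (prim L 0 q) 0 = 0" "val L (prim L 0 q) L = 0"
    using H1_of_prim[OF pos(1) pL(4) prim_L2[OF pos(1) pL(4)], of 0 0] pos(1) q(4) by (simp_all add: prim_0 less_imp_le)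
  have VX: "V \<in> X" unfolding X_iff Vc
  proof (intro conjI v1 w1 pL yL)
    show "AE x in intv L. of_real \<xi> * wd L (prim L 0 q) x - y x + of_real (\<gamma> / \<epsilon>\<^sub>3) * wd L (prim L 0 pv) x = 0"
      using v1(2) w1(2) by eventually_elim (simp add: y_def)
  qed
  have ae: "AE x in intv L. pv x = wd L (prim L 0 pv) x" using v1(2) by eventually_elim simp
  \<comment> \<open>The chosen weak derivative equals \<open>pv\<close> only almost everywhere, so
    regularity and trace have to be transferred to it.\<close>
  note wpv = H1_cong[OF poly_H1(1)[OF pos(1) pv(1)] wd_weak(1)[OF v1(1)] ae]
  have VD: "V \<in> D" unfolding D_iff Vc
  proof (intro conjI VX poly_H1(1)[OF pos(1) pz(1)] poly_H1(1)[OF pos(1) p1(1)] poly_H1(1)[OF pos(1) yp])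
    show "val L pz 0 = 0" "val L p1 0 = 0" "val L p1 L = 0"
      by (simp_all add: poly_H1(2)[OF pos(1)] pz p1 less_imp_le[OF pos(1)])
    show "wd L (prim L 0 pv) \<in> H1 L" by (rule wpv(1))
    have "val L (wd L (prim L 0 pv)) L = 0" unfolding wpv(3) by (simp add: poly_H1(2)[OF pos(1)] pv less_imp_le[OF pos(1)])
    moreover have "val L y L = 0" using poly_H1(2)[OF pos(1) yp L_le] by (simp only:) (simp add: y_def q pv)
    ultimately show "of_real \<alpha> * val L (wd L (prim L 0 pv)) L + of_real \<gamma> * val L y L = 0" by simp
  qed
  have UV: "U - V \<in> X" by (rule X_diff[OF U VX])
  have sq: "ip L f f \<le> r\<^sup>2" if "nm L f \<le> r" for f r
    using power_mono[OF that nm_nonneg, of 2] by (simp add: nm_sq)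
  have n1: "nm L (v_x (U - V)) = nm L (\<lambda>x. v_x U x - pv x)"
  proof (rule nm_cong_AE[OF X_D(4)[OF UV] L2_diff[OF u(4) pL(1)]])
    show "AE x in intv L. v_x (U - V) x = v_x U x - pv x"
      using H1_diff(2)[OF pos(1) u(1) v1(1)] v1(2) unfolding comp_minus Vc by eventually_elim simp
  qed
  have "AE x in intv L. wd L (st_u2 (U - V)) x = wd L (st_u2 U) x - q x"
    using H1_diff(2)[OF pos(1) u(7) w1(1)] w1(2) unfolding comp_minus Vc by eventually_elim simp
  then have n2: "nm L (wd L (st_u2 (U - V))) = nm L (\<lambda>x. wd L (st_u2 U) x - q x)"
    by (rule nm_cong_AE[OF wd_weak(1)[OF X_D(7)[OF UV]] L2_diff[OF wL pL(4)]])
  have "nm L (st_u2 (U - V)) \<le> (nm L (\<lambda>_. 1))\<^sup>2 * nm L (wd L (st_u2 (U - V)))"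
    by (rule poincare(1)[OF pos(1) X_D(7,9)[OF UV]])
  also have "\<dots> \<le> (nm L (\<lambda>_. 1))\<^sup>2 * d" unfolding n2 using q(5) by (intro mult_left_mono) auto
  finally have e2: "ip L (st_u2 (U - V)) (st_u2 (U - V)) \<le> nm L (\<lambda>_. 1) ^ 4 * d\<^sup>2"
    using sq by (metis (no_types, lifting) power_mult power_mult_distrib mult_2 numeral_Bit0)
  have "nm L (st_u3 (U - V)) = nm L (\<lambda>x. of_real \<xi> * (wd L (st_u2 U) x - q x) + of_real (\<gamma> / \<epsilon>\<^sub>3) * (v_x U x - pv x))"
  proof (rule nm_cong_AE[OF X_D(11)[OF UV] L2_add[OF L2_scale[OF L2_diff[OF wL pL(4)]] L2_scale[OF L2_diff[OF u(4) pL(1)]]]])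
    show "AE x in intv L. st_u3 (U - V) x = of_real \<xi> * (wd L (st_u2 U) x - q x) + of_real (\<gamma> / \<epsilon>\<^sub>3) * (v_x U x - pv x)"
      using u(12)
    proof eventually_elim
      case (elim x)
      then have "st_u3 U x = of_real \<xi> * wd L (st_u2 U) x + of_real (\<gamma> / \<epsilon>\<^sub>3) * v_x U x"
        by (simp add: add_diff_eq diff_add_eq)
      then show ?case unfolding comp_minus Vc y_def by (simp only: right_diff_distrib) simp
    qed
  qed
  also have "\<dots> \<le> nm L (\<lambda>x. of_real \<xi> * (wd L (st_u2 U) x - q x)) + nm L (\<lambda>x. of_real (\<gamma> / \<epsilon>\<^sub>3) * (v_x U x - pv x))"
    by (intro nm_triangle L2_scale L2_diff wL pL u)
  also have "\<dots> = \<xi> * nm L (\<lambda>x. wd L (st_u2 U) x - q x) + \<gamma> / \<epsilon>\<^sub>3 * nm L (\<lambda>x. v_x U x - pv x)"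
    unfolding nm_scale using pos by (simp add: norm_divide)
  also have "\<dots> \<le> \<xi> * d + \<gamma> / \<epsilon>\<^sub>3 * d"
    using q(5) pv(4) pos by (intro add_mono mult_left_mono) auto
  also have "\<dots> = (\<xi> + \<gamma> / \<epsilon>\<^sub>3) * d" by (simp only: distrib_right)
  finally have "ip L (st_u3 (U - V)) (st_u3 (U - V)) \<le> ((\<xi> + \<gamma> / \<epsilon>\<^sub>3) * d)\<^sup>2" by (rule sq)
  then have e3: "ip L (st_u3 (U - V)) (st_u3 (U - V)) \<le> (\<xi> + \<gamma> / \<epsilon>\<^sub>3)\<^sup>2 * d\<^sup>2" by (simp only: power_mult_distrib)
  have ev: "ip L (v_x (U - V)) (v_x (U - V)) \<le> d\<^sup>2" by (rule sq) (use n1 pv(4) in simp)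
  have ez: "ip L (st_z (U - V)) (st_z (U - V)) \<le> d\<^sup>2" by (rule sq) (use pz(4) in \<open>simp add: Vc\<close>)
  have e1: "ip L (st_u1 (U - V)) (st_u1 (U - V)) \<le> d\<^sup>2" by (rule sq) (use p1(4) in \<open>simp add: Vc\<close>)
  have "Q (U - V) (U - V) \<le> \<alpha> * d\<^sup>2 + \<rho> * d\<^sup>2 + \<mu> * d\<^sup>2 + \<xi> * \<epsilon>\<^sub>3 * (nm L (\<lambda>_. 1) ^ 4 * d\<^sup>2) + \<epsilon>\<^sub>3 * ((\<xi> + \<gamma> / \<epsilon>\<^sub>3)\<^sup>2 * d\<^sup>2)"
    unfolding Q_def using pos by (intro add_mono mult_left_mono ev ez e1 e2 e3) auto
  also have "\<dots> = K * d\<^sup>2" unfolding K_def by (simp only: distrib_right mult.assoc)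
  also have "\<dots> < e\<^sup>2"
  proof -
    have "K * d\<^sup>2 < (K + 1)\<^sup>2 * d\<^sup>2" using K d by (intro mult_strict_right_mono) (auto simp: power2_eq_square algebra_simps intro!: add_pos_nonneg)
    also have "\<dots> = e\<^sup>2" using K by (simp add: d_def power_divide)
    finally show ?thesis .
  qed
  finally have "(N (U - V))\<^sup>2 < e\<^sup>2" by (simp add: N_sq[OF UV])
  then have "N (U - V) < e" by (rule power2_less_imp_less) (use e in simp)
  with VD show ?thesis by blast
qed

text \<open>The parallelogram identity with one square dropped, of U - 2V or of V - 2U, serves in
  place of the triangle inequality.\<close>

lemma N_sq_le_double:
  assumes U: "U \<in> X" and V: "V \<in> X"
  shows "(N U)\<^sup>2 \<le> 2 * (N (U - V))\<^sup>2 + 2 * (N V)\<^sup>2" "(N V)\<^sup>2 \<le> 2 * (N (U - V))\<^sup>2 + 2 * (N U)\<^sup>2"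
proof -
  note UV = X_diff[OF U V]
  have lin: "Q (A - B) C = Q A C - Q B C" "Q C (A - B) = Q C A - Q C B" if "A \<in> X" "B \<in> X" "C \<in> X" for A B C
    using bounded_form_Q that unfolding bounded_form_def by blast+
  note W1 = X_diff[OF UV V]
  have a: "Q (U - V) (U - V) = Q U U - Q U V - Q V U + Q V V"
    by (simp only: lin[OF U V UV] lin[OF U V U] lin[OF U V V])
  have b: "Q (U - V) V = Q U V - Q V V" "Q V (U - V) = Q V U - Q V V" "Q (U - V) U = Q U U - Q V U" "Q U (U - V) = Q U U - Q U V"
    by (simp_all only: lin[OF U V V] lin[OF U V U])
  have "Q ((U - V) - V) ((U - V) - V) = Q (U - V) (U - V) - Q (U - V) V - Q V (U - V) + Q V V"
    by (simp only: lin[OF UV V W1] lin[OF UV V UV] lin[OF UV V V])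
  then have 1: "Q (U - V) (U - V) - Q (U - V) V - Q V (U - V) + Q V V \<ge> 0" using Q_nonneg by metis
  show "(N U)\<^sup>2 \<le> 2 * (N (U - V))\<^sup>2 + 2 * (N V)\<^sup>2"
    using 1 a b unfolding N_sq[OF U] N_sq[OF V] N_sq[OF UV] by linarith
  have VU: "V - U \<in> X" by (rule X_diff[OF V U])
  have W4: "V - U - U \<in> X" by (rule X_diff[OF VU U])
  have "Q ((V - U) - U) ((V - U) - U) = Q V V - 2 * Q V U - 2 * Q U V + 4 * Q U U"
    by (simp only: lin[OF VU U W4] lin[OF V U W4] lin[OF VU U VU] lin[OF VU U U] lin[OF VU U V] lin[OF V U U] lin[OF V U V] lin[OF V U VU])
  then have 2: "Q V V - 2 * Q V U - 2 * Q U V + 4 * Q U U \<ge> 0" using Q_nonneg by metis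
  show "(N V)\<^sup>2 \<le> 2 * (N (U - V))\<^sup>2 + 2 * (N U)\<^sup>2"
    using 2 a unfolding N_sq[OF U] N_sq[OF V] N_sq[OF UV] by linarith
qed

end

section \<open>Passage from the domain to all states\<close>

context piezo_semigroup begin

theorem exponential_stability:
  "\<exists>M \<epsilon>. M \<ge> 1 \<and> \<epsilon> > 0 \<and> (\<forall>U\<in>X. \<forall>t\<ge>0. N (T t U) \<le> M * exp (- \<epsilon> * t) * N U)"
proof -
  obtain V m e where V: "bounded_form V" "m > 0" "e > 0"
    and cmp: "\<And>U. U \<in> X \<Longrightarrow> m * Q U U \<le> V U U \<and> V U U \<le> 3 * m * Q U U"
    and dec: "\<And>U. U \<in> D \<Longrightarrow> V (G U) U + V U (G U) \<le> - e * V U U"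
    using lyapunov_functional by blast
  \<comment> \<open>The factor 3 is the ratio of the two constants comparing V with the
    energy.\<close>
  have smooth: "(N (T t U))\<^sup>2 \<le> 3 * exp (- e * t) * (N U)\<^sup>2" if U: "U \<in> D" and t: "t \<ge> 0" for U t
  proof -
    note UX = D_X[OF U]
    note TX = T_X[OF t UX]
    have "m * (N (T t U))\<^sup>2 \<le> V (T t U) (T t U)" using cmp[OF TX] by (simp add: N_sq[OF TX])
    also have "\<dots> \<le> exp (- e * t) * V U U" by (rule lyapunov_decay[OF V(1) dec U t])
    also have "\<dots> \<le> exp (- e * t) * (3 * m * (N U)\<^sup>2)"
      using cmp[OF UX] by (intro mult_left_mono) (auto simp: N_sq[OF UX])
    also have "\<dots> = m * (3 * exp (- e * t) * (N U)\<^sup>2)" by simp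
    finally show ?thesis using V(2) by (simp only: mult_le_cancel_left_pos)
  qed
  have "N (T t U) \<le> 4 * exp (- (e / 2) * t) * N U" if U: "U \<in> X" and t: "t \<ge> 0" for U t
  proof -
    define E where "E = exp (- e * t)"
    have E: "E > 0" "E \<le> 1" using V(3) t by (auto simp: E_def)
    have "(N (T t U))\<^sup>2 \<le> 12 * E * (N U)\<^sup>2"
    proof (rule field_le_epsilon)
      fix r :: real assume r: "r > 0"
      \<comment> \<open>The approximation enters twice, directly with 2 and through the decay of W
        with 2 * 3 * 2, which adds up to 14 d^2; the factor 12 of the main term arises
        likewise.\<close>
      define d where "d = sqrt (r / 14)"
      have d: "d > 0" "14 * d\<^sup>2 = r" using r by (simp_all add: d_def)
      obtain W where W: "W \<in> D" "N (U - W) < d" using D_dense[OF U d(1)] by blast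
      note WX = D_X[OF W(1)]
      have 1: "(N (U - W))\<^sup>2 \<le> d\<^sup>2" using W(2) N_nonneg[OF X_diff[OF U WX]] by (intro power_mono) auto
      have "(N (T t U - T t W))\<^sup>2 \<le> (N (U - W))\<^sup>2"
        by (intro power_mono N_T_diff t U WX N_nonneg X_diff T_X)
      then have 2: "(N (T t U))\<^sup>2 \<le> 2 * d\<^sup>2 + 2 * (N (T t W))\<^sup>2"
        using N_sq_le_double(1)[OF T_X[OF t U] T_X[OF t WX]] 1 by linarith
      have 3: "(N W)\<^sup>2 \<le> 2 * d\<^sup>2 + 2 * (N U)\<^sup>2"
        using N_sq_le_double(2)[OF U WX] 1 by linarith
      have "E * (N W)\<^sup>2 \<le> E * (2 * d\<^sup>2 + 2 * (N U)\<^sup>2)" using 3 E by (intro mult_left_mono) auto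
      also have "\<dots> \<le> 2 * d\<^sup>2 + 2 * (E * (N U)\<^sup>2)"
        using mult_right_mono[OF E(2), of "2 * d\<^sup>2"] by (simp add: distrib_left)
      finally have 4: "E * (N W)\<^sup>2 \<le> 2 * d\<^sup>2 + 2 * (E * (N U)\<^sup>2)" .
      have "(N (T t W))\<^sup>2 \<le> 3 * (E * (N W)\<^sup>2)" using smooth[OF W(1) t] by (simp add: E_def mult.assoc)
      with 2 4 show "(N (T t U))\<^sup>2 \<le> 12 * E * (N U)\<^sup>2 + r" using d(2) by linarith
    qed
    \<comment> \<open>Enlarging 12 to the square 16 gives the constant 4 after the root.\<close>
    also have "\<dots> \<le> 16 * E * (N U)\<^sup>2" using E by (intro mult_right_mono) auto
    also have "\<dots> = (4 * exp (- (e / 2) * t) * N U)\<^sup>2"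
    proof -
      have "E = (exp (- (e / 2) * t))\<^sup>2" by (simp add: E_def power2_eq_square flip: exp_add)
      then show ?thesis by (simp add: power_mult_distrib)
    qed
    finally show ?thesis by (rule power2_le_imp_le) (simp add: N_nonneg[OF U])
  qed
  then show ?thesis using V(3) by (intro exI[of _ 4] exI[of _ "e / 2"]) auto
qed

end

theorem theorem8p1:
  fixes L \<rho> \<alpha> \<gamma> \<xi> \<epsilon>\<^sub>3 \<mu> a :: real
    and T :: "real \<Rightarrow> state \<Rightarrow> state"
  assumes "L > 0" "\<rho> > 0" "\<alpha> > 0" "\<gamma> > 0" "\<xi> > 0" "\<epsilon>\<^sub>3 > 0" "\<mu> > 0"
    and "a > 0"
    and "C0_contraction_semigroup (energy_space L \<gamma> \<xi> \<epsilon>\<^sub>3) (state_eq L)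
           (energy_norm L \<rho> \<alpha> \<xi> \<epsilon>\<^sub>3 \<mu>) T"
    and "generates (energy_space L \<gamma> \<xi> \<epsilon>\<^sub>3) (state_eq L) (energy_norm L \<rho> \<alpha> \<xi> \<epsilon>\<^sub>3 \<mu>)
           (op_dom L \<alpha> \<gamma> \<xi> \<epsilon>\<^sub>3) (op_A_damped L \<rho> \<alpha> \<gamma> \<xi> \<epsilon>\<^sub>3 \<mu> a 0 0) T"
  shows "\<exists>M \<epsilon>. M \<ge> 1 \<and> \<epsilon> > 0 \<and>
           (\<forall>U\<^sub>0 \<in> energy_space L \<gamma> \<xi> \<epsilon>\<^sub>3. \<forall>t\<ge>0.
              energy_norm L \<rho> \<alpha> \<xi> \<epsilon>\<^sub>3 \<mu> (T t U\<^sub>0)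
                \<le> M * exp (- \<epsilon> * t) * energy_norm L \<rho> \<alpha> \<xi> \<epsilon>\<^sub>3 \<mu> U\<^sub>0)"
proof -
  interpret piezo_semigroup L \<rho> \<alpha> \<gamma> \<xi> \<epsilon>\<^sub>3 \<mu> a T
    by unfold_locales (fact assms)+
  show ?thesis by (rule exponential_stability)
qed

end
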